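(* Let $G={}^2G_2(q)$ where $q=3^{2n+1}$, $n$ a positive integer, put $m=3^n$, and let $N=N_G(P)$ be the normaliser of a Sylow $3$-subgroup $P$ of $G$. With the classes labelled as in the context (for a suitable choice of which of the classes is called $T$ and which $T^{-1}$, and of which are called $Y$, $YT$, $YT^{-1}$), there is a sign $\varepsilon\in\{\pm1\}$ such that the irreducible complex characters of $N$ are exactly the following $q+7$ characters $$\alpha_0=1_N,\alpha_1,\dots,\alpha_{q-2},\ \lambda,\ \mu_1,\ \mu_2,\ \overline{\mu_1},\ \overline{\mu_2},\ \chi,\ \overline{\chi},\ \psi,$$ where bars denote complex conjugates, with the values below. The orders of the centralisers $C_N(g)$ for $g$ in the classes $1,X,T,T^{-1},Y,YT,YT^{-1},Ph(w_j),J,JT,JT^{-1}$ are respectively $q^3(q-1),\ q^3,\ 2q^2,\ 2q^2,\ 3q,\ 3q,\ 3q,\ q-1,\ q(q-1),\ 2q,\ 2q$. (The values on $1,X,T,T^{-1},Y,YT,YT^{-1}$:) $$\begin{array}{c|ccccccc} & 1 & X & T & T^{-1} & Y & YT & YT^{-1}\\ \hline \alpha_i\ (0\le i\le q-2) & 1&1&1&1&1&1&1\\ \lambda & q-1&q-1&q-1&q-1&-1&-1&-1\\ \mu_1 & \frac{m(q-1)}{2}&\frac{m(q-1)}{2}&\frac{-m+m^2\sqrt{-3}}{2}&\frac{-m-m^2\sqrt{-3}}{2}&-\varepsilon m&-\varepsilon m\overline{\omega}&-\varepsilon m\omega\\ \mu_2 & \frac{m(q-1)}{2}&\frac{m(q-1)}{2}&\frac{-m+m^2\sqrt{-3}}{2}&\frac{-m-m^2\sqrt{-3}}{2}&-\varepsilon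 m&-\varepsilon m\overline{\omega}&-\varepsilon m\omega\\ \overline{\mu_1} & \frac{m(q-1)}{2}&\frac{m(q-1)}{2}&\frac{-m-m^2\sqrt{-3}}{2}&\frac{-m+m^2\sqrt{-3}}{2}&-\varepsilon m&-\varepsilon m\omega&-\varepsilon m\overline{\omega}\\ \overline{\mu_2} & \frac{m(q-1)}{2}&\frac{m(q-1)}{2}&\frac{-m-m^2\sqrt{-3}}{2}&\frac{-m+m^2\sqrt{-3}}{2}&-\varepsilon m&-\varepsilon m\omega&-\varepsilon m\overline{\omega}\\ \chi & m(q-1)&m(q-1)&-m+m^2\sqrt{-3}&-m-m^2\sqrt{-3}&\varepsilon m&\varepsilon m\overline{\omega}&\varepsilon m\omega\\ \overline{\chi} & m(q-1)&m(q-1)&-m-m^2\sqrt{-3}&-m+m^2\sqrt{-3}&\varepsilon m&\varepsilon m\omega&\varepsilon m\overline{\omega}\\ \psi & q(q-1)&-q&0&0&0&0&0 \end{array}$$ (The values on $Ph(w_j),J,JT,JT^{-1}$:) $$\begin{array}{c|cccc} & Ph(w_j) & J & JT & JT^{-1}\\ \hline \alpha_i\ (0\le i\le q-2) & \xi^{ij}&(-1)^i&(-1)^i&(-1)^i\\ \lambda &0&0&0&0\\ \mu_1 &0&\frac{q-1}{2}&\frac{-1-m\sqrt{-3}}{2}&\frac{-1+m\sqrt{-3}}{2}\\ \mu_2 &0&-\frac{q-1}{2}&\frac{1+m\sqrt{-3}}{2}&\frac{1-m\sqrt{-3}}{2}\\ \overline{\mu_1} &0&\frac{q-1}{2}&\frac{-1+m\sqrt{-3}}{2}&\frac{-1-m\sqrt{-3}}{2}\\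 \overline{\mu_2} &0&-\frac{q-1}{2}&\frac{1-m\sqrt{-3}}{2}&\frac{1+m\sqrt{-3}}{2}\\ \chi,\ \overline{\chi},\ \psi &0&0&0&0 \end{array}$$ Here $\omega=e^{2\pi i/3}$ and $\xi$ is a fixed primitive $(q-1)$-th root of unity.
   Context: ${}^2G_2(q)$ is the simple Ree group of order $q^3(q^3+1)(q-1)$. Put $\theta=3^n$, so that $\lambda^{\theta}=\lambda^{3^n}$ for $\lambda\in\mathbb F_q$. The Sylow $3$-subgroup is $P=\{x(t,u,v)\mid t,u,v\in\mathbb F_q\}$ with multiplication $x(t_1,u_1,v_1)x(t_2,u_2,v_2)=x(t_1+t_2,\ u_1+u_2-t_1t_2^{3\theta},\ v_1+v_2-t_2u_1+t_1t_2^{3\theta+1}-t_1^2t_2^{3\theta})$. Its normaliser is $N=P\rtimes W$ with $W=\{h(w)\mid w\in\mathbb F_q^\times\}$ cyclic of order $q-1$ (with $h(w)h(w')=h(ww')$), acting by $h(w)x(t,u,v)h(w)^{-1}=x(w^{2-3\theta}t,w^{3\theta-1}u,wv)$. Conjugacy classes of $N$: $1$ is the identity class; $X=\{x(0,0,v)\mid v\neq0\}$; $T$ and $T^{-1}$ are the two mutually inverse classes whose union is $\{x(0,u,v)\mid u\ne0\}$; $Y,YT,YT^{-1}$ are the three classes whose union is $\{x(t,u,v)\mid t\ne0\}$; for a fixed generator $h$ of $W$, write $h(w_j)=h^j$; for $1\le j\le q-2$, $j\neq\frac{q-1}{2}$, the coset $Ph(w_j)$ is a single class (these are the classes $Ph(w_j)$,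 $w_j\neq\pm1$); $J$ is the class of the involution $h(-1)$; $JT$ is the class of $x(0,-1,0)h(-1)$ and $JT^{-1}$ is the class of its inverse $x(0,1,0)h(-1)$. These are all $q+7$ classes of $N$. *)

theory Defs
  imports
    "HOL-Algebra.SimpleGroups"
    "HOL-Algebra.Zassenhaus"
    "HOL-Algebra.Generated_Groups"
    "HOL-Library.Cardinality"
    "Jordan_Normal_Form.VS_Connect"
begin

definition sylow_subgroup :: "nat \<Rightarrow> 'a set \<Rightarrow> ('a, 'b) monoid_scheme \<Rightarrow> bool" where
  "sylow_subgroup p P G \<longleftrightarrow>
     subgroup P G \<and> card P = p ^ multiplicity p (Coset.order G)"

definition conj_class :: "('a, 'b) monoid_scheme \<Rightarrow> 'a \<Rightarrow> 'a set" where
  "conj_class G a = {g \<otimes>\<^bsub>G\<^esub> a \<otimes>\<^bsub>G\<^esub> inv\<^bsub>G\<^esub> g | g. g \<in> carrier G}"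

definition conj_classes :: "('a, 'b) monoid_scheme \<Rightarrow> 'a set set" where
  "conj_classes G = conj_class G ` carrier G"

definition centralizer :: "('a, 'b) monoid_scheme \<Rightarrow> 'a \<Rightarrow> 'a set" where
  "centralizer G a = {g \<in> carrier G. g \<otimes>\<^bsub>G\<^esub> a = a \<otimes>\<^bsub>G\<^esub> g}"

abbreviation GL :: "nat \<Rightarrow> complex mat monoid" where
  "GL d \<equiv> units_of (ring_mat TYPE(complex) d ())"

definition irreducible_rep ::
  "('a, 'b) monoid_scheme \<Rightarrow> nat \<Rightarrow> ('a \<Rightarrow> complex mat) \<Rightarrow> bool" where
  "irreducible_rep G d \<rho> \<longleftrightarrow>
     0 < d \<and> \<rho> \<in> hom G (GL d) \<and>
     (\<forall>U. subspace class_ring U (module_vec TYPE(complex) d) \<and>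
          (\<forall>g\<in>carrier G. \<forall>v\<in>U. \<rho> g *\<^sub>v v \<in> U)
        \<longrightarrow> U = {0\<^sub>v d} \<or> U = carrier_vec d)"

text \<open>
  Characters are functions on \<^term>\<open>carrier G\<close> and \<^const>\<open>undefined\<close> elsewhere, so that
  equality of characters is equality of functions and characters can be counted.
\<close>

definition character ::
  "('a, 'b) monoid_scheme \<Rightarrow> nat \<Rightarrow> ('a \<Rightarrow> complex mat) \<Rightarrow> 'a \<Rightarrow> complex" where
  "character G d \<rho> = (\<lambda>g\<in>carrier G. \<Sum>i<d. \<rho> g $$ (i, i))"

definition irr_characters :: "('a, 'b) monoid_scheme \<Rightarrow> ('a \<Rightarrow> complex) set" where
  "irr_characters G = {character G d \<rho> | d \<rho>. irreducible_rep G d \<rho>}"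

definition conj_char :: "('a, 'b) monoid_scheme \<Rightarrow> ('a \<Rightarrow> complex) \<Rightarrow> 'a \<Rightarrow> complex" where
  "conj_char G f = (\<lambda>g\<in>carrier G. cnj (f g))"

text \<open>\<open>table_row f Cs zs\<close>: \<open>f\<close> is constant on each class in \<open>Cs\<close>, with the values listed in
  \<open>zs\<close>; the two lists have the same length.\<close>

definition table_row :: "('a \<Rightarrow> 'c) \<Rightarrow> 'a set list \<Rightarrow> 'c list \<Rightarrow> bool" where
  "table_row f Cs zs \<longleftrightarrow> list_all2 (\<lambda>C z. \<forall>g\<in>C. f g = z) Cs zs"

definition ree_P :: "('f \<Rightarrow> 'f \<Rightarrow> 'f \<Rightarrow> 'a) \<Rightarrow> 'a set" where
  "ree_P x = {x t u v | t u v. True}"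

definition ree_W :: "('f::zero \<Rightarrow> 'a) \<Rightarrow> 'a set" where
  "ree_W h = {h w | w. w \<noteq> 0}"

definition ree_N :: "('a, 'b) monoid_scheme \<Rightarrow> ('f \<Rightarrow> 'f \<Rightarrow> 'f \<Rightarrow> 'a) \<Rightarrow> ('a, 'b) monoid_scheme" where
  "ree_N G x = G\<lparr>carrier := normalizer G (ree_P x)\<rparr>"

text \<open>
  The Ree group \<open>\<^sup>2G\<^sub>2(q)\<close>, \<open>q = 3\<^bsup>2n+1\<^esup>\<close>, enters as a simple group of order
  \<open>q\<^sup>3(q\<^sup>3+1)(q-1)\<close> whose Sylow 3-normaliser carries the standard coordinates \<open>x(t,u,v)\<close> and
  \<open>h(w)\<close>; it is not constructed. The type \<^typ>\<open>'f\<close> is the field with \<open>q\<close> elements, and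
  \<open>\<theta>\<close> acts as the exponent \<open>3 ^ n\<close>. Nothing is assumed about \<open>h 0\<close>.
\<close>

locale ree_group = simple_group G
  for G :: "('a, 'b) monoid_scheme" (structure) +
  fixes n :: nat
    and x :: "'f::{field, finite} \<Rightarrow> 'f \<Rightarrow> 'f \<Rightarrow> 'a"
    and h :: "'f \<Rightarrow> 'a"
  assumes n_pos: "0 < n"
    and card_field: "CARD('f) = 3 ^ (2 * n + 1)"
    and order_G: "Coset.order G = CARD('f) ^ 3 * (CARD('f) ^ 3 + 1) * (CARD('f) - 1)"
    and sylow_P: "sylow_subgroup 3 (ree_P x) G"
    and x_inj: "x t u v = x t' u' v' \<Longrightarrow> t = t' \<and> u = u' \<and> v = v'"
    and x_mult: "x t1 u1 v1 \<otimes> x t2 u2 v2 =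
      x (t1 + t2)
        (u1 + u2 - t1 * t2 ^ (3 * 3 ^ n))
        (v1 + v2 - t2 * u1 + t1 * t2 ^ (3 * 3 ^ n + 1) - t1\<^sup>2 * t2 ^ (3 * 3 ^ n))"
    and subgroup_W: "subgroup (ree_W h) G"
    and h_inj: "inj_on h {w. w \<noteq> 0}"
    and h_mult: "w \<noteq> 0 \<Longrightarrow> w' \<noteq> 0 \<Longrightarrow> h w \<otimes> h w' = h (w * w')"
    and h_conj: "w \<noteq> 0 \<Longrightarrow> h w \<otimes> x t u v \<otimes> inv (h w) =
      x (w powi (2 - 3 * 3 ^ n) * t) (w powi (3 * 3 ^ n - 1) * u) (w * v)"
    and normalizer_P: "normalizer G (ree_P x) = ree_P x <#> ree_W h"
    and P_W_disjoint: "ree_P x \<inter> ree_W h = {\<one>}"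

end

theory Submission
  imports Defs
begin

text \<open>
  Every irreducible character of the Sylow normaliser \<open>N = P W\<close> is induced from a linear
  character. The table is therefore obtained by inducing explicit linear characters of explicit
  subgroups and proving irreducibility by Mackey's criterion (\<open>ind_char_irreducible\<close>). The list is
  complete because the regular character is the combination of its members weighted by their
  degrees, as one reads off from the values (\<open>irr_characters_eqI\<close>, \<open>sum_table\<close>).

  Let \<open>S t = t\<^bsup>3\<theta>\<^esup>\<close>, a field automorphism whose square is cubing. Replacing \<open>u\<close> by \<open>u - t S t\<close>
  turns the quotient of \<open>P\<close> by its centre into the set of pairs with the product
  \<open>(t\<^sub>1, u\<^sub>1) (t\<^sub>2, u\<^sub>2) = (t\<^sub>1 + t\<^sub>2, u\<^sub>1 + u\<^sub>2 + B t\<^sub>1 t\<^sub>2)\<close>, where \<open>B s t = s S t - S s t\<close> is alternating.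
  Let \<open>phi\<close> be the additive character of \<open>F\<^sub>q\<close> given by the trace.

  The linear characters of \<open>W\<close> give the \<open>\<alpha>\<^sub>i\<close>, and the linear character \<open>phi t\<close> of \<open>P\<close> induces the
  character of degree \<open>q - 1\<close>. The character \<open>phi v\<close> of the abelian subgroup \<open>t = 0\<close> of \<open>P\<close> induces
  \<open>\<psi>\<close>. The remaining characters are trivial on the centre of \<open>P\<close> but not on the elements with
  \<open>t = 0\<close>. The radical of the alternating form \<open>phi \<circ> B\<close> is the prime field, so there is a
  self-orthogonal subgroup \<open>L\<close> of order \<open>3 m\<close> (\<open>Lagrangian_exists\<close>), and \<open>phi u\<close> is a linear
  character of the subgroup \<open>t \<in> L\<close>, invariant under the involution \<open>h (- 1)\<close>. It has two extensions
  to the group generated by that subgroup and \<open>h (- 1)\<close>; they induce \<open>\<mu>\<^sub>1\<close> and \<open>\<mu>\<^sub>2\<close>. Twisting \<open>phi u\<close> by a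
  linear character of \<open>L\<close> that is non-trivial on the prime field destroys the invariance and
  gives \<open>\<chi>\<close>, of twice the degree.

  At \<open>t = 0\<close> the values of \<open>\<mu>\<^sub>1\<close>, \<open>\<mu>\<^sub>2\<close> and \<open>\<chi>\<close>, and on the coset of the involution those of \<open>\<mu>\<^sub>1\<close> and
  \<open>\<mu>\<^sub>2\<close>, are multiples of the sum of \<open>phi (a u)\<close> over the non-zero squares \<open>a\<close>. For \<open>u = \<plusminus>1\<close> this Gauss
  sum is \<open>(- 1 \<plusminus> m \<surd>-3) / 2\<close>, if the cube root of unity that defines \<open>phi\<close> is chosen suitably. For
  \<open>t \<noteq> 0\<close> only two elements of \<open>W\<close> contribute, and \<open>\<mu>\<^sub>1\<close>, \<open>\<mu>\<^sub>2\<close> have the value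
  \<open>m phi (u / (t S t))\<close>; in \<open>\<chi>\<close> the twist contributes the factor \<open>\<omega> + \<omega>\<^sup>2 = - 1\<close>. So
  the sign in the theorem is \<open>- 1\<close>, the classes \<open>T\<close> and \<open>T\<^sup>-\<^sup>1\<close> are told apart by whether \<open>u\<close> is a
  square, and \<open>Y\<close>, \<open>YT\<close>, \<open>YT\<^sup>-\<^sup>1\<close> by the cube root of unity \<open>phi (u / (t S t))\<close>.
\<close>

section \<open>Irreducible characters and their orthogonality\<close>

lemma (in group) mult_inv_cancel:
  assumes "a \<in> carrier G" "z \<in> carrier G"
  shows "inv a \<otimes> (a \<otimes> z) = z" "a \<otimes> (inv a \<otimes> z) = z"
  using assms by (simp_all add: m_assoc[symmetric])

lemma irreducible_repD:
  fixes G (structure)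
  assumes "irreducible_rep G d \<rho>" "group G"
  shows "0 < d"
    and "\<And>g. g \<in> carrier G \<Longrightarrow> \<rho> g \<in> carrier_mat d d"
    and "\<And>g k. g \<in> carrier G \<Longrightarrow> k \<in> carrier G \<Longrightarrow> \<rho> (g \<otimes> k) = \<rho> g * \<rho> k"
    and "\<rho> \<one> = 1\<^sub>m d"
proof -
  interpret group G by fact
  show "0 < d" using assms(1) by (simp add: irreducible_rep_def)
  have hom: "\<rho> \<in> hom G (GL d)" using assms(1) by (simp add: irreducible_rep_def)
  show C: "\<rho> g \<in> carrier_mat d d" if "g \<in> carrier G" for g
    using hom that by (auto simp: hom_def units_of_def Units_def ring_mat_simps)
  show "\<rho> (g \<otimes> k) = \<rho> g * \<rho> k" if "g \<in> carrier G" "k \<in> carrier G" for g k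
    using hom that by (auto simp: hom_def units_of_def ring_mat_simps)
  interpret R: ring "ring_mat TYPE(complex) d ()" by (rule ring_mat)
  interpret U: group "GL d" by (rule R.units_group)
  have "\<rho> \<one> = \<one>\<^bsub>GL d\<^esub>" using hom by (intro hom_one) (auto intro: U.is_group is_group)
  then show "\<rho> \<one> = 1\<^sub>m d" by (simp add: units_of_def ring_mat_simps)
qed

lemma hom_GLI:
  fixes G (structure)
  assumes "group G" and C: "\<And>g. g \<in> carrier G \<Longrightarrow> \<rho> g \<in> carrier_mat d d"
    and mult: "\<And>g k. g \<in> carrier G \<Longrightarrow> k \<in> carrier G \<Longrightarrow> \<rho> (g \<otimes> k) = \<rho> g * \<rho> k"
    and one: "\<rho> \<one> = 1\<^sub>m d"
  shows "\<rho> \<in> hom G (GL d)"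
proof (rule homI)
  interpret group G by fact
  fix g assume g: "g \<in> carrier G"
  have "\<rho> (inv g) * \<rho> g = 1\<^sub>m d" "\<rho> g * \<rho> (inv g) = 1\<^sub>m d"
    using mult[of g "inv g"] mult[of "inv g" g] g one by auto
  then show "\<rho> g \<in> carrier (GL d)"
    using C g by (auto simp: units_of_def Units_def ring_mat_simps intro!: bexI[of _ "\<rho> (inv g)"])
qed (use mult in \<open>auto simp: units_of_def ring_mat_simps\<close>)

lemma subspace_vec_iff:
  "subspace class_ring U (module_vec TYPE(complex) d) \<longleftrightarrow>
     U \<subseteq> carrier_vec d \<and> 0\<^sub>v d \<in> U \<and> (\<forall>v\<in>U. \<forall>w\<in>U. v + w \<in> U) \<and> (\<forall>a. \<forall>v\<in>U. a \<cdot>\<^sub>v v \<in> U)"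
  using vec_vs[where ?n=d and 'a=complex]
  by (auto simp: VectorSpace.subspace_def LinearCombinations.submodule_def module_vec_simps
      vectorspace_def)

lemma irreducible_rep_invariant:
  assumes "irreducible_rep G d \<rho>" "U \<subseteq> carrier_vec d" "0\<^sub>v d \<in> U"
    and "\<And>v w. v \<in> U \<Longrightarrow> w \<in> U \<Longrightarrow> v + w \<in> U" "\<And>a v. v \<in> U \<Longrightarrow> a \<cdot>\<^sub>v v \<in> U"
    and "\<And>g v. g \<in> carrier G \<Longrightarrow> v \<in> U \<Longrightarrow> \<rho> g *\<^sub>v v \<in> U"
  shows "U = {0\<^sub>v d} \<or> U = carrier_vec d"
  using assms unfolding irreducible_rep_def subspace_vec_iff by metis

lemma trace_mult_commute:
  assumes "A \<in> carrier_mat n m" "B \<in> carrier_mat m n"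
  shows "(\<Sum>i<n. (A * B) $$ (i, i)) = (\<Sum>i<m. ((B :: 'a :: comm_ring mat) * A) $$ (i, i))"
proof -
  have "(\<Sum>i<n. (A * B) $$ (i, i)) = (\<Sum>i<n. \<Sum>j<m. A $$ (i, j) * B $$ (j, i))"
    using assms by (intro sum.cong) (auto simp: scalar_prod_def atLeast0LessThan)
  also have "\<dots> = (\<Sum>j<m. \<Sum>i<n. B $$ (j, i) * A $$ (i, j))"
    by (subst sum.swap) (simp add: mult.commute)
  also have "\<dots> = (\<Sum>j<m. (B * A) $$ (j, j))"
    using assms by (intro sum.cong) (auto simp: scalar_prod_def atLeast0LessThan)
  finally show ?thesis .
qed

lemma mult_mat_unit_vec:
  assumes "(A :: 'a :: comm_semiring_1 mat) \<in> carrier_mat n m" "j < m"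
  shows "A *\<^sub>v unit_vec m j = col A j"
  using assms by (intro eq_vecI) auto

text \<open>Kernel and image of \<open>T\<close> are invariant subspaces, so a non-zero \<open>T\<close> is bijective; conjugation by
  it then identifies the traces of the two representations.\<close>

lemma schur_intertwiner:
  assumes G: "group G" and \<rho>: "irreducible_rep G d \<rho>" and \<tau>: "irreducible_rep G e \<tau>"
    and T: "T \<in> carrier_mat d e"
    and comm: "\<And>g. g \<in> carrier G \<Longrightarrow> \<rho> g * T = T * \<tau> g"
    and neq: "character G d \<rho> \<noteq> character G e \<tau>"
  shows "T = 0\<^sub>m d e"
proof (rule ccontr)
  assume T0: "T \<noteq> 0\<^sub>m d e"
  note rD = irreducible_repD[OF \<rho> G] and tD = irreducible_repD[OF \<tau> G]
  define Ker where "Ker = {v \<in> carrier_vec e. T *\<^sub>v v = 0\<^sub>v d}"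
  have "Ker = {0\<^sub>v e} \<or> Ker = carrier_vec e"
  proof (rule irreducible_rep_invariant[OF \<tau>])
    show "v + w \<in> Ker" if "v \<in> Ker" "w \<in> Ker" for v w
      using that T by (auto simp: Ker_def mult_add_distrib_mat_vec[OF T])
    show "a \<cdot>\<^sub>v v \<in> Ker" if "v \<in> Ker" for a v
      using that T by (auto simp: Ker_def mult_mat_vec[OF T])
    show "\<tau> g *\<^sub>v v \<in> Ker" if "g \<in> carrier G" "v \<in> Ker" for g v
    proof -
      have v: "v \<in> carrier_vec e" and Tv: "T *\<^sub>v v = 0\<^sub>v d" using that by (auto simp: Ker_def)
      have "T *\<^sub>v (\<tau> g *\<^sub>v v) = (T * \<tau> g) *\<^sub>v v"
        using T tD(2)[OF that(1)] v by simp
      also have "\<dots> = (\<rho> g * T) *\<^sub>v v" using comm that by simp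
      also have "\<dots> = \<rho> g *\<^sub>v (T *\<^sub>v v)" using T rD(2)[OF that(1)] v by simp
      also have "\<dots> = 0\<^sub>v d" using Tv rD(2)[OF that(1)] by (intro eq_vecI) auto
      finally show ?thesis using v tD(2)[OF that(1)] by (auto simp: Ker_def)
    qed
  qed (use T in \<open>auto simp: Ker_def\<close>)
  moreover have "Ker \<noteq> carrier_vec e"
  proof
    assume all: "Ker = carrier_vec e"
    have "T = 0\<^sub>m d e"
    proof (rule eq_matI)
      fix i j assume ij: "i < dim_row (0\<^sub>m d e :: complex mat)" "j < dim_col (0\<^sub>m d e :: complex mat)"
      have "unit_vec e j \<in> Ker" using all by simp
      then have "T *\<^sub>v unit_vec e j = 0\<^sub>v d" by (simp add: Ker_def)
      moreover have "T *\<^sub>v unit_vec e j = col T j" using ij T by (simp add: mult_mat_unit_vec)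
      ultimately have "col T j $ i = 0" using ij by simp
      then show "T $$ (i, j) = 0\<^sub>m d e $$ (i, j)" using ij T by simp
    qed (use T in auto)
    then show False using T0 by simp
  qed
  ultimately have ker: "Ker = {0\<^sub>v e}" by simp
  define Im where "Im = (*\<^sub>v) T ` carrier_vec e"
  have "Im = {0\<^sub>v d} \<or> Im = carrier_vec d"
  proof (rule irreducible_rep_invariant[OF \<rho>])
    show "Im \<subseteq> carrier_vec d" using T by (auto simp: Im_def)
    show "0\<^sub>v d \<in> Im" using T by (auto simp: Im_def intro!: image_eqI[of _ _ "0\<^sub>v e"])
    show "v + w \<in> Im" if vw: "v \<in> Im" "w \<in> Im" for v w
    proof -
      obtain a b where "a \<in> carrier_vec e" "b \<in> carrier_vec e" "v = T *\<^sub>v a" "w = T *\<^sub>v b"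
        using vw by (auto simp: Im_def)
      then show ?thesis using mult_add_distrib_mat_vec[OF T, of a b, symmetric] by (auto simp: Im_def)
    qed
    show "a \<cdot>\<^sub>v v \<in> Im" if v: "v \<in> Im" for a v
    proof -
      obtain b where "b \<in> carrier_vec e" "v = T *\<^sub>v b" using v by (auto simp: Im_def)
      then show ?thesis using mult_mat_vec[OF T, of b a, symmetric] by (auto simp: Im_def)
    qed
    show "\<rho> g *\<^sub>v v \<in> Im" if g: "g \<in> carrier G" and v: "v \<in> Im" for g v
    proof -
      obtain b where b: "b \<in> carrier_vec e" "v = T *\<^sub>v b" using v by (auto simp: Im_def)
      have "\<rho> g *\<^sub>v v = (\<rho> g * T) *\<^sub>v b" using b T rD(2)[OF g] by simp
      also have "\<dots> = T *\<^sub>v (\<tau> g *\<^sub>v b)" using b T tD(2)[OF g] comm[OF g] by simp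
      finally show ?thesis using tD(2)[OF g] b by (auto simp: Im_def)
    qed
  qed
  moreover have "Im \<noteq> {0\<^sub>v d}"
  proof
    assume im: "Im = {0\<^sub>v d}"
    have "unit_vec e 0 \<in> Ker" using im by (auto simp: Ker_def Im_def)
    then show False using ker tD(1) by (auto dest: arg_cong[of _ _ "\<lambda>v. v $ 0"])
  qed
  ultimately have im: "Im = carrier_vec d" by simp
  \<comment> \<open>a two-sided inverse of \<open>T\<close>, whose columns are preimages of the unit vectors\<close>
  have "\<exists>b. b \<in> carrier_vec e \<and> T *\<^sub>v b = unit_vec d i" for i
    using im unfolding Im_def by (metis imageE unit_vec_carrier)
  then obtain b where b: "\<And>i. b i \<in> carrier_vec e" "\<And>i. T *\<^sub>v b i = unit_vec d i" by metis
  define S where "S = mat e d (\<lambda>(i, j). b j $ i)"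
  have S: "S \<in> carrier_mat e d" by (simp add: S_def)
  have colS: "col S j = b j" if "j < d" for j
    using that b(1)[of j] by (intro eq_vecI) (auto simp: S_def)
  have TS: "T * S = 1\<^sub>m d"
  proof (rule eq_matI)
    fix i j assume "i < dim_row (1\<^sub>m d :: complex mat)" "j < dim_col (1\<^sub>m d :: complex mat)"
    then have ij: "i < d" "j < d" by auto
    have "(T * S) $$ (i, j) = (T *\<^sub>v b j) $ i" using ij T S colS by simp
    also have "\<dots> = 1\<^sub>m d $$ (i, j)" using ij b(2) by simp
    finally show "(T * S) $$ (i, j) = 1\<^sub>m d $$ (i, j)" .
  qed (use T S in auto)
  have inj: "v = w" if vw: "v \<in> carrier_vec e" "w \<in> carrier_vec e" "T *\<^sub>v v = T *\<^sub>v w" for v w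
  proof -
    have Tw: "T *\<^sub>v w \<in> carrier_vec d" using T vw by simp
    have "T *\<^sub>v (v - w) = T *\<^sub>v v - T *\<^sub>v w" using T vw by (simp add: mult_minus_distrib_mat_vec)
    then have "v - w \<in> Ker" using vw Tw by (auto simp: Ker_def)
    then have d0: "v - w = 0\<^sub>v e" using ker by simp
    show ?thesis
    proof (rule eq_vecI)
      fix i assume i: "i < dim_vec w"
      then have "(v - w) $ i = 0" using d0 vw by simp
      then show "v $ i = w $ i" using i vw by simp
    qed (use vw in auto)
  qed
  have ST: "S * T = 1\<^sub>m e"
  proof (rule eq_matI)
    fix i j assume "i < dim_row (1\<^sub>m e :: complex mat)" "j < dim_col (1\<^sub>m e :: complex mat)"
    then have ij: "i < e" "j < e" by auto
    have cT: "col T j \<in> carrier_vec d" using T ij by auto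
    have "T *\<^sub>v (S *\<^sub>v col T j) = col T j"
      using assoc_mult_mat_vec[OF T S cT] TS cT by simp
    also have "\<dots> = T *\<^sub>v unit_vec e j" using T ij by (simp add: mult_mat_unit_vec)
    finally have TST: "T *\<^sub>v (S *\<^sub>v col T j) = T *\<^sub>v unit_vec e j" .
    have "S *\<^sub>v col T j = unit_vec e j" by (rule inj[OF _ _ TST]) (use S cT in auto)
    then show "(S * T) $$ (i, j) = 1\<^sub>m e $$ (i, j)" using ij T S
      by (metis carrier_matD index_mult_mat(1) index_mult_mat_vec index_one_mat(1) index_unit_vec(1))
  qed (use T S in auto)
  have "character G d \<rho> g = character G e \<tau> g" if g: "g \<in> carrier G" for g
  proof -
    note C = rD(2)[OF g] tD(2)[OF g]
    have "\<rho> g = \<rho> g * (T * S)" using C TS by simp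
    also have "\<dots> = (\<rho> g * T) * S" using C T S by simp
    also have "\<dots> = T * (\<tau> g * S)" using C T S comm[OF g] by simp
    finally have 1: "\<rho> g = T * (\<tau> g * S)" .
    have "(\<tau> g * S) * T = \<tau> g * (S * T)" using C T S by simp
    then have 2: "(\<tau> g * S) * T = \<tau> g" using ST C by simp
    show ?thesis
      using trace_mult_commute[of T d e "\<tau> g * S"] T S C g 1 2
      by (simp add: character_def)
  qed
  then have "character G d \<rho> = character G e \<tau>"
    by (auto simp: character_def fun_eq_iff restrict_def)
  then show False using neq by simp
qed


lemma sum_group_mult_left:
  fixes G (structure)
  assumes "group G" "k \<in> carrier G"
  shows "(\<Sum>g\<in>carrier G. f (k \<otimes> g)) = (\<Sum>g\<in>carrier G. f g)"
proof -
  interpret group G by fact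
  show ?thesis
    by (rule sum.reindex_bij_witness[where i="\<lambda>g. inv k \<otimes> g" and j="\<lambda>g. k \<otimes> g"])
      (use assms(2) in \<open>auto simp: m_assoc[symmetric]\<close>)
qed

lemma irr_characters_orthogonal:
  fixes G (structure)
  assumes G: "group G"
    and f: "f \<in> irr_characters G" and f': "f' \<in> irr_characters G" and neq: "f \<noteq> f'"
  shows "(\<Sum>g\<in>carrier G. f g * f' (inv g)) = 0"
proof -
  interpret group G by fact
  obtain d \<rho> where \<rho>: "irreducible_rep G d \<rho>" and fd: "f = character G d \<rho>"
    using f by (auto simp: irr_characters_def)
  obtain e \<tau> where \<tau>: "irreducible_rep G e \<tau>" and fe: "f' = character G e \<tau>"
    using f' by (auto simp: irr_characters_def)
  note rD = irreducible_repD[OF \<rho> G] and tD = irreducible_repD[OF \<tau> G]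
  have entry: "(\<Sum>g\<in>carrier G. \<rho> g $$ (i, k) * \<tau> (inv g) $$ (l, j)) = 0"
    if ik: "i < d" "k < d" "l < e" "j < e" for i j k l
  proof -
    \<comment> \<open>averaging the matrix unit \<open>E\<^sub>k\<^sub>l\<close> over the group gives an intertwiner\<close>
    define T where "T = mat d e (\<lambda>(a, b). \<Sum>g\<in>carrier G. \<rho> g $$ (a, k) * \<tau> (inv g) $$ (l, b))"
    have T: "T \<in> carrier_mat d e" by (simp add: T_def)
    have "T = 0\<^sub>m d e"
    proof (rule schur_intertwiner[OF G \<rho> \<tau> T])
      show "character G d \<rho> \<noteq> character G e \<tau>" using neq fd fe by simp
      fix h assume h: "h \<in> carrier G"
      note C = rD(2)[OF h] tD(2)[OF h]
      show "\<rho> h * T = T * \<tau> h"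
      proof (rule eq_matI)
        fix a b assume "a < dim_row (T * \<tau> h)" "b < dim_col (T * \<tau> h)"
        then have ab: "a < d" "b < e" using T C by auto
        have "(\<rho> h * T) $$ (a, b) =
            (\<Sum>c<d. \<rho> h $$ (a, c) * (\<Sum>g\<in>carrier G. \<rho> g $$ (c, k) * \<tau> (inv g) $$ (l, b)))"
          using ab C T by (auto simp: scalar_prod_def atLeast0LessThan T_def intro!: sum.cong)
        also have "\<dots> = (\<Sum>g\<in>carrier G. (\<Sum>c<d. \<rho> h $$ (a, c) * \<rho> g $$ (c, k)) * \<tau> (inv g) $$ (l, b))"
          by (simp add: sum_distrib_left sum_distrib_right mult_ac) (rule sum.swap)
        also have "\<dots> = (\<Sum>g\<in>carrier G. \<rho> (h \<otimes> g) $$ (a, k) * \<tau> (inv g) $$ (l, b))"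
        proof (rule sum.cong[OF refl])
          fix g assume g: "g \<in> carrier G"
          have "(\<Sum>c<d. \<rho> h $$ (a, c) * \<rho> g $$ (c, k)) = \<rho> (h \<otimes> g) $$ (a, k)"
            using rD(2)[OF g] C ab ik rD(3)[OF h g] by (auto simp: scalar_prod_def atLeast0LessThan)
          then show "(\<Sum>c<d. \<rho> h $$ (a, c) * \<rho> g $$ (c, k)) * \<tau> (inv g) $$ (l, b) =
            \<rho> (h \<otimes> g) $$ (a, k) * \<tau> (inv g) $$ (l, b)" by simp
        qed
        also have "\<dots> = (\<Sum>g\<in>carrier G. \<rho> (h \<otimes> g) $$ (a, k) * \<tau> (inv (h \<otimes> g) \<otimes> h) $$ (l, b))"
          using h by (intro sum.cong) (auto simp: inv_mult_group m_assoc)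
        also have "\<dots> = (\<Sum>g\<in>carrier G. \<rho> g $$ (a, k) * \<tau> (inv g \<otimes> h) $$ (l, b))"
          by (rule sum_group_mult_left[OF G h])
        also have "\<dots> = (\<Sum>g\<in>carrier G. \<rho> g $$ (a, k) * (\<Sum>c<e. \<tau> (inv g) $$ (l, c) * \<tau> h $$ (c, b)))"
        proof (rule sum.cong[OF refl])
          fix g assume g: "g \<in> carrier G"
          then have "\<tau> (inv g) \<in> carrier_mat e e" by (intro tD(2)) auto
          then have "(\<Sum>c<e. \<tau> (inv g) $$ (l, c) * \<tau> h $$ (c, b)) = \<tau> (inv g \<otimes> h) $$ (l, b)"
            using C ab ik tD(3)[of "inv g" h] g h
            by (auto simp: scalar_prod_def atLeast0LessThan)
          then show "\<rho> g $$ (a, k) * \<tau> (inv g \<otimes> h) $$ (l, b) =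
            \<rho> g $$ (a, k) * (\<Sum>c<e. \<tau> (inv g) $$ (l, c) * \<tau> h $$ (c, b))" by simp
        qed
        also have "\<dots> = (\<Sum>c<e. (\<Sum>g\<in>carrier G. \<rho> g $$ (a, k) * \<tau> (inv g) $$ (l, c)) * \<tau> h $$ (c, b))"
          by (simp add: sum_distrib_left sum_distrib_right mult_ac) (rule sum.swap)
        also have "\<dots> = (T * \<tau> h) $$ (a, b)"
          using ab C T by (auto simp: scalar_prod_def atLeast0LessThan T_def intro!: sum.cong)
        finally show "(\<rho> h * T) $$ (a, b) = (T * \<tau> h) $$ (a, b)" .
      qed (use T C in auto)
    qed
    then have "T $$ (i, j) = 0" using ik by simp
    then show ?thesis using ik by (simp add: T_def)
  qed
  have "(\<Sum>g\<in>carrier G. f g * f' (inv g)) =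
      (\<Sum>g\<in>carrier G. \<Sum>i<d. \<Sum>j<e. \<rho> g $$ (i, i) * \<tau> (inv g) $$ (j, j))"
    by (intro sum.cong) (auto simp: fd fe character_def sum_product)
  also have "\<dots> = (\<Sum>i<d. \<Sum>j<e. \<Sum>g\<in>carrier G. \<rho> g $$ (i, i) * \<tau> (inv g) $$ (j, j))"
    by (subst sum.swap) (intro sum.cong refl, rule sum.swap)
  also have "\<dots> = 0" by (rule sum.neutral, rule ballI, rule sum.neutral, rule ballI, rule entry) auto
  finally show ?thesis .
qed

text \<open>By \<open>reg\<close>, the members of \<open>A\<close> combine to a multiple of the regular character. An irreducible
  character outside \<open>A\<close> would be orthogonal to it, although its inner product with the regular
  character is its degree.\<close>

lemma irr_characters_eqI:
  fixes G (structure)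
  assumes G: "group G" and fin: "finite (carrier G)"
    and A: "A \<subseteq> irr_characters G"
    and reg: "\<And>g. g \<in> carrier G \<Longrightarrow> g \<noteq> \<one> \<Longrightarrow> (\<Sum>f\<in>A. f \<one> * f g) = 0"
    and one: "(\<Sum>f\<in>A. f \<one> * f \<one>) \<noteq> 0"
  shows "irr_characters G = A"
proof (rule antisym[OF _ A], rule subsetI, rule ccontr)
  interpret group G by fact
  fix f assume f: "f \<in> irr_characters G" "f \<notin> A"
  obtain d \<rho> where \<rho>: "irreducible_rep G d \<rho>" and fd: "f = character G d \<rho>"
    using f by (auto simp: irr_characters_def)
  note rD = irreducible_repD[OF \<rho> G]
  have f1: "f \<one> = of_nat d" using rD by (simp add: fd character_def)
  have "0 = (\<Sum>f'\<in>A. f' \<one> * (\<Sum>g\<in>carrier G. f g * f' (inv g)))"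
    using A f by (intro sum.neutral[symmetric] ballI)
      (metis irr_characters_orthogonal[OF G] mult_zero_right subsetD)
  also have "\<dots> = (\<Sum>g\<in>carrier G. f g * (\<Sum>f'\<in>A. f' \<one> * f' (inv g)))"
    by (simp add: sum_distrib_left mult_ac) (rule sum.swap)
  also have "\<dots> = (\<Sum>g\<in>carrier G. if g = \<one> then f \<one> * (\<Sum>f'\<in>A. f' \<one> * f' \<one>) else 0)"
    by (intro sum.cong) (auto simp: reg)
  also have "\<dots> = f \<one> * (\<Sum>f'\<in>A. f' \<one> * f' \<one>)" using fin by (simp add: sum.delta)
  finally show False using f1 rD(1) one by simp
qed

text \<open>Conjugating all coordinates is a bijection from the invariant subspaces of a representation to
  those of the conjugate one.\<close>

lemma irr_characters_conj:
  assumes G: "group G" and f: "f \<in> irr_characters G"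
  shows "conj_char G f \<in> irr_characters G"
proof -
  interpret group G by fact
  obtain d \<rho> where \<rho>: "irreducible_rep G d \<rho>" and fd: "f = character G d \<rho>"
    using f by (auto simp: irr_characters_def)
  note rD = irreducible_repD[OF \<rho> G]
  define \<tau> where "\<tau> g = map_mat cnj (\<rho> g)" for g
  have C: "\<tau> g \<in> carrier_mat d d" if "g \<in> carrier G" for g using rD(2)[OF that] by (simp add: \<tau>_def)
  have mult: "\<tau> (g \<otimes>\<^bsub>G\<^esub> k) = \<tau> g * \<tau> k" if "g \<in> carrier G" "k \<in> carrier G" for g k
    using rD(2)[OF that(1)] rD(2)[OF that(2)] rD(3)[OF that]
    by (intro eq_matI) (auto simp: \<tau>_def scalar_prod_def)
  have one: "\<tau> \<one>\<^bsub>G\<^esub> = 1\<^sub>m d" unfolding \<tau>_def rD(4) by (intro eq_matI) auto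
  have hom: "\<tau> \<in> hom G (GL d)" by (rule hom_GLI[OF G C mult one])
  have cc: "map_vec cnj (map_vec cnj v) = v" for v by (intro eq_vecI) auto
  have "irreducible_rep G d \<tau>"
    unfolding irreducible_rep_def subspace_vec_iff
  proof (intro conjI allI impI rD(1) hom, elim conjE)
    fix U assume sub: "U \<subseteq> carrier_vec d" and zero: "0\<^sub>v d \<in> U"
      and add: "\<forall>v\<in>U. \<forall>w\<in>U. v + w \<in> U" and smult: "\<forall>a. \<forall>v\<in>U. a \<cdot>\<^sub>v v \<in> U"
      and invar: "\<forall>g\<in>carrier G. \<forall>v\<in>U. \<tau> g *\<^sub>v v \<in> U"
    define V where "V = map_vec cnj ` U"
    have mem: "v \<in> V \<longleftrightarrow> map_vec cnj v \<in> U" for v unfolding V_def by (metis cc imageE imageI)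
    have "V = {0\<^sub>v d} \<or> V = carrier_vec d"
    proof (rule irreducible_rep_invariant[OF \<rho>])
      show "V \<subseteq> carrier_vec d" using sub by (auto simp: V_def)
      have "map_vec cnj (0\<^sub>v d) = 0\<^sub>v d" by (intro eq_vecI) auto
      then show "0\<^sub>v d \<in> V" using zero by (simp add: mem)
      show "v + w \<in> V" if vw: "v \<in> V" "w \<in> V" for v w
      proof -
        have "dim_vec v = d" "dim_vec w = d" using vw sub by (auto simp: V_def)
        then have "map_vec cnj (v + w) = map_vec cnj v + map_vec cnj w" by (intro eq_vecI) auto
        then show ?thesis using vw add by (simp add: mem)
      qed
      show "a \<cdot>\<^sub>v v \<in> V" if v: "v \<in> V" for a v
      proof -
        have "map_vec cnj (a \<cdot>\<^sub>v v) = cnj a \<cdot>\<^sub>v map_vec cnj v" by (intro eq_vecI) auto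
        then show ?thesis using v smult by (simp add: mem)
      qed
      show "\<rho> g *\<^sub>v v \<in> V" if g: "g \<in> carrier G" and v: "v \<in> V" for g v
      proof -
        have "dim_vec v = d" using v sub by (auto simp: V_def)
        then have "map_vec cnj (\<rho> g *\<^sub>v v) = \<tau> g *\<^sub>v map_vec cnj v"
          using rD(2)[OF g] by (intro eq_vecI) (auto simp: \<tau>_def scalar_prod_def)
        then show ?thesis using v invar g by (simp add: mem)
      qed
    qed
    then show "U = {0\<^sub>v d} \<or> U = carrier_vec d"
    proof
      assume V: "V = {0\<^sub>v d}"
      have "v = 0\<^sub>v d" if "v \<in> U" for v
      proof -
        have "map_vec cnj v = 0\<^sub>v d" using that V by (auto simp: V_def)
        then have "v = map_vec cnj (0\<^sub>v d)" using cc by metis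
        also have "\<dots> = 0\<^sub>v d" by (intro eq_vecI) auto
        finally show ?thesis .
      qed
      then show ?thesis using zero by blast
    next
      assume V: "V = carrier_vec d"
      have "v \<in> U" if "v \<in> carrier_vec d" for v
      proof -
        have "map_vec cnj v \<in> V" using that V by simp
        then show ?thesis by (simp add: mem cc)
      qed
      then show ?thesis using sub by blast
    qed
  qed
  moreover have "conj_char G f = character G d \<tau>"
  proof
    fix g
    show "conj_char G f g = character G d \<tau> g"
    proof (cases "g \<in> carrier G")
      case True
      then show ?thesis using rD(2)[OF True] by (simp add: conj_char_def fd character_def \<tau>_def)
    qed (simp add: conj_char_def character_def)
  qed
  ultimately show ?thesis by (auto simp: irr_characters_def)
qed

section \<open>Characters induced from linear characters\<close>

text \<open>Frobenius' formula. Summing over \<open>y g y\<^sup>-\<^sup>1\<close> instead of \<open>y\<^sup>-\<^sup>1 g y\<close> matches a representation on the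
  right cosets of \<open>H\<close>.\<close>

definition ind_char :: "('a, 'b) monoid_scheme \<Rightarrow> 'a set \<Rightarrow> ('a \<Rightarrow> complex) \<Rightarrow> 'a \<Rightarrow> complex" where
  "ind_char G H lam = (\<lambda>g\<in>carrier G.
     (\<Sum>y\<in>carrier G. if y \<otimes>\<^bsub>G\<^esub> g \<otimes>\<^bsub>G\<^esub> inv\<^bsub>G\<^esub> y \<in> H then lam (y \<otimes>\<^bsub>G\<^esub> g \<otimes>\<^bsub>G\<^esub> inv\<^bsub>G\<^esub> y) else 0)
       / of_nat (card H))"

lemma (in group) right_transversal:
  assumes H: "subgroup H G" and fin: "finite (carrier G)"
  shows "\<exists>(d :: nat) r. 0 < d \<and> (\<forall>i<d. r i \<in> carrier G) \<and>
    (\<forall>y\<in>carrier G. \<exists>!i. i < d \<and> y \<otimes> inv (r i) \<in> H)"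
proof -
  interpret H: subgroup H G by fact
  have finR: "finite (rcosets H)"
    using fin rcosets_subset_PowG[OF H] by (meson finite_Pow_iff finite_subset)
  obtain C where C: "bij_betw C {0..<card (rcosets H)} (rcosets H)"
    using ex_bij_betw_nat_finite[OF finR] by blast
  define r where "r i = (SOME y. y \<in> C i)" for i
  have Ci: "C i \<in> rcosets H" if "i < card (rcosets H)" for i
    using C that by (auto simp: bij_betw_def)
  have r: "r i \<in> C i" if "i < card (rcosets H)" for i
    unfolding r_def using H.rcosets_non_empty[OF Ci[OF that]] by (auto intro: someI)
  have rG: "r i \<in> carrier G" if "i < card (rcosets H)" for i
    using r[OF that] H.rcosets_carrier[OF is_group Ci[OF that]] by blast
  have Cr: "C i = H #> r i" if i: "i < card (rcosets H)" for i
  proof -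
    obtain y where "y \<in> carrier G" "C i = H #> y" using Ci[OF i] by (auto simp: RCOSETS_def)
    then show ?thesis using r[OF i] repr_independence[OF _ _ H] by auto
  qed
  have mem: "y \<otimes> inv (r i) \<in> H \<longleftrightarrow> C i = H #> y"
    if "y \<in> carrier G" "i < card (rcosets H)" for y i
  proof -
    have "y \<otimes> inv (r i) \<in> H \<longleftrightarrow> y \<in> H #> r i"
      using H.rcos_module[OF is_group rG[OF that(2)] that(1)] by simp
    also have "\<dots> \<longleftrightarrow> C i = H #> y"
      using Cr[OF that(2)] repr_independence[OF _ rG[OF that(2)] H] rcos_self[OF that(1) H] by auto
    finally show ?thesis .
  qed
  show ?thesis
  proof (intro exI conjI ballI allI impI)
    show "0 < card (rcosets H)" using finR H.subgroup_in_rcosets[OF is_group] by (auto simp: card_gt_0_iff)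
    show "\<exists>!i. i < card (rcosets H) \<and> y \<otimes> inv (r i) \<in> H" if y: "y \<in> carrier G" for y
    proof -
      have "H #> y \<in> rcosets H" using y by (rule rcosetsI[OF H.subset])
      then have "H #> y \<in> C ` {0..<card (rcosets H)}" using C by (simp add: bij_betw_def)
      then obtain i where i: "i < card (rcosets H)" "C i = H #> y" by auto
      show ?thesis
      proof (rule ex1I[of _ i])
        fix j assume "j < card (rcosets H) \<and> y \<otimes> inv (r j) \<in> H"
        then have "j < card (rcosets H)" "C j = C i" using mem y i by auto
        then show "j = i" using C i by (auto simp: bij_betw_def inj_on_def)
      qed (use i mem y in auto)
    qed
  qed (use rG in auto)
qed

text \<open>Mackey's criterion for the monomial representation \<open>\<rho>\<close> on the right cosets \<open>H r\<^sub>i\<close>. An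
  invariant subspace containing \<open>v\<close> with \<open>v\<^sub>j \<noteq> 0\<close> also contains the projection of \<open>v\<close> to the
  \<open>lam\<close>-part for the subgroup \<open>r\<^sub>j\<^sup>-\<^sup>1 H r\<^sub>j\<close>; the hypothesis says precisely that this projection
  kills every basis vector but the \<open>j\<close>-th one.\<close>

lemma ind_char_irreducible:
  fixes G (structure)
  assumes G: "group G" and fin: "finite (carrier G)" and H: "subgroup H G"
    and lam_mult: "\<And>a b. a \<in> H \<Longrightarrow> b \<in> H \<Longrightarrow> lam (a \<otimes> b) = lam a * lam b"
    and lam_nz: "\<And>a. a \<in> H \<Longrightarrow> lam a \<noteq> 0"
    and mackey: "\<And>y. y \<in> carrier G \<Longrightarrow> y \<notin> H \<Longrightarrow>
      \<exists>a\<in>H. y \<otimes> a \<otimes> inv y \<in> H \<and> lam (y \<otimes> a \<otimes> inv y) \<noteq> lam a"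
  shows "ind_char G H lam \<in> irr_characters G"
proof -
  interpret group G by fact
  interpret H: subgroup H G by fact
  have finH: "finite H" using fin H.subset finite_subset by blast
  have cardH: "card H > 0" using finH H.one_closed by (metis card_gt_0_iff empty_iff)
  obtain d :: nat and r where dr: "0 < d \<and> (\<forall>i<d. r i \<in> carrier G) \<and>
      (\<forall>y\<in>carrier G. \<exists>!i. i < d \<and> y \<otimes> inv (r i) \<in> H)"
    using right_transversal[OF H fin] by (elim exE) (rule that)
  then have d: "0 < d" and r: "\<And>i. i < d \<Longrightarrow> r i \<in> carrier G" by simp_all
  have trans: "\<exists>!i. i < d \<and> y \<otimes> inv (r i) \<in> H" if "y \<in> carrier G" for y
    by (rule bspec[OF conjunct2[OF conjunct2[OF dr]] that])
  note [simp] = mult_inv_cancel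
  note [simp] = H.mem_carrier
  define L where "L z = (if z \<in> H then lam z else 0)" for z
  have lam1: "lam \<one> = 1"
    using lam_mult[of \<one> \<one>] lam_nz[of \<one>] by simp
  have mem_mult: "a \<otimes> z \<in> H \<longleftrightarrow> z \<in> H" if "a \<in> H" "z \<in> carrier G" for a z
  proof
    assume "a \<otimes> z \<in> H"
    then have "inv a \<otimes> (a \<otimes> z) \<in> H" using that by (intro H.m_closed[of "inv a" "a \<otimes> z"]) auto
    then show "z \<in> H" using that by simp
  qed (use that in auto)
  have L_mult: "L (a \<otimes> z) = lam a * L z" if "a \<in> H" "z \<in> carrier G" for a z
    using that mem_mult[OF that] by (auto simp: L_def lam_mult)
  have rr: "L (r i \<otimes> inv (r j)) = (if i = j then 1 else 0)" if "i < d" "j < d" for i j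
  proof (cases "i = j")
    case True
    then show ?thesis using that r by (simp add: L_def lam1)
  next
    case False
    have "r i \<otimes> inv (r j) \<notin> H"
      using trans[OF r[OF that(1)]] that False r by (metis H.one_closed r_inv)
    then show ?thesis using False by (simp add: L_def)
  qed
  have L_sum: "(\<Sum>k<d. L (y \<otimes> inv (r k)) * L (r k \<otimes> z)) = L (y \<otimes> z)"
    if y: "y \<in> carrier G" and z: "z \<in> carrier G" for y z
  proof -
    obtain k where k: "k < d" "y \<otimes> inv (r k) \<in> H"
      and uniq: "\<And>j. j < d \<Longrightarrow> y \<otimes> inv (r j) \<in> H \<Longrightarrow> j = k"
      using trans[OF y] by auto
    have "(\<Sum>j<d. L (y \<otimes> inv (r j)) * L (r j \<otimes> z)) =
        (\<Sum>j<d. if j = k then L (y \<otimes> inv (r k)) * L (r k \<otimes> z) else 0)"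
    proof (rule sum.cong[OF refl])
      fix j assume "j \<in> {..<d}"
      then have "j \<noteq> k \<Longrightarrow> L (y \<otimes> inv (r j)) = 0" using uniq[of j] by (auto simp: L_def)
      then show "L (y \<otimes> inv (r j)) * L (r j \<otimes> z) =
          (if j = k then L (y \<otimes> inv (r k)) * L (r k \<otimes> z) else 0)" by simp
    qed
    also have "\<dots> = lam (y \<otimes> inv (r k)) * L (r k \<otimes> z)" using k by (simp add: L_def)
    also have "\<dots> = L ((y \<otimes> inv (r k)) \<otimes> (r k \<otimes> z))"
      using k r z by (intro L_mult[symmetric]) auto
    also have "(y \<otimes> inv (r k)) \<otimes> (r k \<otimes> z) = y \<otimes> z"
      using y z r[OF k(1)] by (simp add: m_assoc)
    finally show ?thesis .
  qed
  define \<rho> where "\<rho> g = mat d d (\<lambda>(i, j). L (r i \<otimes> g \<otimes> inv (r j)))" for g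
  have rho_C: "\<rho> g \<in> carrier_mat d d" for g by (simp add: \<rho>_def)
  have rho_mult: "\<rho> (g \<otimes> k) = \<rho> g * \<rho> k" if "g \<in> carrier G" "k \<in> carrier G" for g k
  proof (rule eq_matI)
    fix i j assume "i < dim_row (\<rho> g * \<rho> k)" "j < dim_col (\<rho> g * \<rho> k)"
    then have ij: "i < d" "j < d" by (auto simp: \<rho>_def)
    have "(\<rho> g * \<rho> k) $$ (i, j) = (\<Sum>l<d. L (r i \<otimes> g \<otimes> inv (r l)) * L (r l \<otimes> (k \<otimes> inv (r j))))"
      using ij that r by (auto simp: \<rho>_def scalar_prod_def atLeast0LessThan m_assoc intro!: sum.cong)
    also have "\<dots> = L (r i \<otimes> g \<otimes> (k \<otimes> inv (r j)))" using that ij r by (intro L_sum) auto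
    finally show "\<rho> (g \<otimes> k) $$ (i, j) = (\<rho> g * \<rho> k) $$ (i, j)"
      using ij that r by (simp add: \<rho>_def m_assoc)
  qed (auto simp: \<rho>_def)
  have rho_one: "\<rho> \<one> = 1\<^sub>m d"
    using r rr by (intro eq_matI) (auto simp: \<rho>_def)
  have hom: "\<rho> \<in> hom G (GL d)" by (rule hom_GLI[OF G rho_C rho_mult rho_one])
  have "irreducible_rep G d \<rho>"
    unfolding irreducible_rep_def subspace_vec_iff
  proof (intro conjI allI impI d hom, elim conjE)
    fix U assume sub: "U \<subseteq> carrier_vec d" and zero: "0\<^sub>v d \<in> U"
      and add: "\<forall>v\<in>U. \<forall>w\<in>U. v + w \<in> U" and smult: "\<forall>a. \<forall>v\<in>U. a \<cdot>\<^sub>v v \<in> U"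
      and invar: "\<forall>g\<in>carrier G. \<forall>v\<in>U. \<rho> g *\<^sub>v v \<in> U"
    have sum_in: "vec d (\<lambda>i. \<Sum>k\<in>S. c k * w k $ i) \<in> U"
      if "finite S" "\<And>k. k \<in> S \<Longrightarrow> w k \<in> U" for S :: "'c set" and c :: "'c \<Rightarrow> complex" and w
      using that
    proof (induction S)
      case empty
      then show ?case using zero by (simp add: zero_vec_def)
    next
      case (insert k S)
      have wk: "w k \<in> carrier_vec d" using insert sub by auto
      have "c k \<cdot>\<^sub>v w k + vec d (\<lambda>i. \<Sum>k\<in>S. c k * w k $ i) \<in> U"
        using insert add smult by auto
      also have "c k \<cdot>\<^sub>v w k + vec d (\<lambda>i. \<Sum>k\<in>S. c k * w k $ i) =
          vec d (\<lambda>i. \<Sum>k\<in>insert k S. c k * w k $ i)"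
        using insert wk by (intro eq_vecI) auto
      finally show ?case .
    qed
    show "U = {0\<^sub>v d} \<or> U = carrier_vec d"
    proof (cases "U = {0\<^sub>v d}")
      case False
      then obtain v where v: "v \<in> U" "v \<noteq> 0\<^sub>v d" using zero by auto
      have vC: "v \<in> carrier_vec d" using v sub by auto
      have "\<exists>j<d. v $ j \<noteq> 0"
      proof (rule ccontr)
        assume "\<not> ?thesis"
        then have "v = 0\<^sub>v d" using vC by (intro eq_vecI) auto
        then show False using v by simp
      qed
      then obtain j where j: "j < d" "v $ j \<noteq> 0" by auto
      define pr where "pr i k = (\<Sum>a\<in>H. inverse (lam a) * L (r i \<otimes> (inv (r j) \<otimes> a \<otimes> r j) \<otimes> inv (r k)))" for i k
      have proj: "pr i k =
          (if i = j \<and> k = j then of_nat (card H) else 0)" if ik: "i < d" "k < d" for i k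
      proof (cases "i = j")
        case True
        have "pr i k =
            (\<Sum>a\<in>H. inverse (lam a) * (lam a * L (r j \<otimes> inv (r k))))"
          unfolding pr_def using True r j ik
          by (intro sum.cong refl arg_cong2[where f="(*)"])
            (auto simp: L_mult[symmetric] m_assoc)
        also have "\<dots> = (\<Sum>a\<in>H. L (r j \<otimes> inv (r k)))" by (intro sum.cong) (auto simp: lam_nz)
        finally show ?thesis using True rr[OF j(1) ik(2)] by simp
      next
        case False
        define y where "y = r i \<otimes> inv (r j)"
        define z where "z = r j \<otimes> inv (r k)"
        have yz: "y \<in> carrier G" "z \<in> carrier G" using r j ik by (auto simp: y_def z_def)
        have "y \<notin> H" using rr[OF ik(1) j(1)] False trans[OF r[OF ik(1)]] ik j r unfolding y_def
          by (metis H.one_closed r_inv)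
        then obtain b where b: "b \<in> H" "y \<otimes> b \<otimes> inv y \<in> H" "lam (y \<otimes> b \<otimes> inv y) \<noteq> lam b"
          using mackey yz by blast
        define s where "s = (\<Sum>a\<in>H. inverse (lam a) * L (y \<otimes> a \<otimes> z))"
        have "s = (\<Sum>a\<in>H. inverse (lam (b \<otimes> a)) * L (y \<otimes> (b \<otimes> a) \<otimes> z))"
          unfolding s_def
          by (rule sum.reindex_bij_witness[where j="\<lambda>a. inv b \<otimes> a" and i="\<lambda>a. b \<otimes> a"])
            (use b in \<open>auto simp: m_assoc[symmetric]\<close>)
        also have "\<dots> = (\<Sum>a\<in>H. inverse (lam b) * lam (y \<otimes> b \<otimes> inv y) * (inverse (lam a) * L (y \<otimes> a \<otimes> z)))"
        proof (rule sum.cong[OF refl])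
          fix a assume a: "a \<in> H"
          have aG: "a \<in> carrier G" "b \<in> carrier G" using a b by auto
          have "y \<otimes> (b \<otimes> a) \<otimes> z = (y \<otimes> b \<otimes> inv y) \<otimes> (y \<otimes> a \<otimes> z)"
            using yz aG by (simp add: m_assoc)
          then have "L (y \<otimes> (b \<otimes> a) \<otimes> z) = lam (y \<otimes> b \<otimes> inv y) * L (y \<otimes> a \<otimes> z)"
            using L_mult[OF b(2), of "y \<otimes> a \<otimes> z"] yz aG by simp
          then show "inverse (lam (b \<otimes> a)) * L (y \<otimes> (b \<otimes> a) \<otimes> z) =
            inverse (lam b) * lam (y \<otimes> b \<otimes> inv y) * (inverse (lam a) * L (y \<otimes> a \<otimes> z))"
            using lam_mult[OF b(1) a] by (simp add: mult_ac)
        qed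
        also have "\<dots> = inverse (lam b) * lam (y \<otimes> b \<otimes> inv y) * s"
          by (simp add: s_def sum_distrib_left)
        finally have "(1 - inverse (lam b) * lam (y \<otimes> b \<otimes> inv y)) * s = 0" by (simp add: algebra_simps)
        moreover have "1 - inverse (lam b) * lam (y \<otimes> b \<otimes> inv y) \<noteq> 0"
          using b lam_nz[OF b(1)] by (simp add: field_simps)
        ultimately have "s = 0" by simp
        moreover have "pr i k = s"
          unfolding pr_def s_def y_def z_def using r ik j by (intro sum.cong) (auto simp: m_assoc)
        ultimately show ?thesis using False by simp
      qed
      define w where "w = vec d (\<lambda>i. \<Sum>a\<in>H. inverse (lam a) * (\<rho> (inv (r j) \<otimes> a \<otimes> r j) *\<^sub>v v) $ i)"
      have "w \<in> U"
        unfolding w_def using finH invar v r j by (intro sum_in) auto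
      also have "w = (of_nat (card H) * v $ j) \<cdot>\<^sub>v unit_vec d j"
      proof (rule eq_vecI)
        fix i assume "i < dim_vec ((of_nat (card H) * v $ j) \<cdot>\<^sub>v unit_vec d j)"
        then have i: "i < d" by simp
        have "w $ i = (\<Sum>a\<in>H. \<Sum>k<d. inverse (lam a) * L (r i \<otimes> (inv (r j) \<otimes> a \<otimes> r j) \<otimes> inv (r k)) * v $ k)"
          using i vC by (auto simp: w_def \<rho>_def scalar_prod_def atLeast0LessThan sum_distrib_left mult_ac intro!: sum.cong)
        also have "\<dots> = (\<Sum>k<d. pr i k * v $ k)"
          by (simp add: pr_def sum_distrib_right) (rule sum.swap)
        also have "\<dots> = (\<Sum>k<d. if k = j then (if i = j then of_nat (card H) * v $ j else 0) else 0)"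
          using i proj by (intro sum.cong) auto
        also have "\<dots> = ((of_nat (card H) * v $ j) \<cdot>\<^sub>v unit_vec d j) $ i"
          using i j by simp
        finally show "w $ i = ((of_nat (card H) * v $ j) \<cdot>\<^sub>v unit_vec d j) $ i" .
      qed (simp add: w_def)
      finally have wU: "(of_nat (card H) * v $ j) \<cdot>\<^sub>v unit_vec d j \<in> U" .
      define b where "b = of_nat (card H) * v $ j"
      have "b \<noteq> 0" using j cardH by (simp add: b_def)
      then have "inverse b \<cdot>\<^sub>v (b \<cdot>\<^sub>v unit_vec d j) = unit_vec d j"
        by (simp add: smult_smult_assoc)
      then have uj: "unit_vec d j \<in> U"
        using smult wU unfolding b_def[symmetric] by metis
      have uk: "unit_vec d k \<in> U" if k: "k < d" for k
      proof -
        have "\<rho> (inv (r k) \<otimes> r j) *\<^sub>v unit_vec d j \<in> U" using invar uj r j k by auto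
        also have "\<rho> (inv (r k) \<otimes> r j) *\<^sub>v unit_vec d j = unit_vec d k"
        proof (rule eq_vecI)
          fix i assume "i < dim_vec (unit_vec d k :: complex vec)"
          then have i: "i < d" by simp
          have "r i \<otimes> (inv (r k) \<otimes> r j) \<otimes> inv (r j) = r i \<otimes> inv (r k)"
            using i j k r by (simp add: m_assoc)
          then show "(\<rho> (inv (r k) \<otimes> r j) *\<^sub>v unit_vec d j) $ i = unit_vec d k $ i"
            using i j k rr[OF i k] mult_mat_unit_vec[OF rho_C j(1)] by (simp add: \<rho>_def)
        qed (use rho_C in \<open>simp add: \<rho>_def\<close>)
        finally show ?thesis .
      qed
      have "v' \<in> U" if v': "v' \<in> carrier_vec d" for v'
      proof -
        have "vec d (\<lambda>i. \<Sum>k\<in>{..<d}. v' $ k * unit_vec d k $ i) \<in> U"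
          using uk by (intro sum_in) auto
        also have "vec d (\<lambda>i. \<Sum>k\<in>{..<d}. v' $ k * unit_vec d k $ i) = v'"
          using v' by (intro eq_vecI) (auto simp: if_distrib[of "\<lambda>z. _ * z"] cong: if_cong)
        finally show ?thesis .
      qed
      then show ?thesis using sub by auto
    qed simp
  qed
  moreover have "character G d \<rho> = ind_char G H lam"
  proof
    fix g
    show "character G d \<rho> g = ind_char G H lam g"
    proof (cases "g \<in> carrier G")
      case g: True
      \<comment> \<open>every element is uniquely \<open>a r\<^sub>i\<close> with \<open>a \<in> H\<close>, and conjugation by \<open>a\<close> preserves \<open>L\<close>\<close>
      have conj: "L (a \<otimes> z \<otimes> inv a) = L z" if a: "a \<in> H" and z: "z \<in> carrier G" for a z
      proof (cases "z \<in> H")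
        case True
        then have "L (a \<otimes> z \<otimes> inv a) * lam a = lam (a \<otimes> z \<otimes> inv a \<otimes> a)"
          using a by (simp add: L_def lam_mult)
        also have "a \<otimes> z \<otimes> inv a \<otimes> a = a \<otimes> z" using a z by (simp add: m_assoc)
        finally show ?thesis using a True lam_nz[OF a] by (simp add: lam_mult L_def) (metis mult.commute)
      next
        case False
        have "a \<otimes> z \<otimes> inv a \<notin> H"
        proof
          assume "a \<otimes> z \<otimes> inv a \<in> H"
          then have "inv a \<otimes> (a \<otimes> z \<otimes> inv a) \<otimes> a \<in> H"
            by (rule H.m_closed[OF H.m_closed[OF H.m_inv_closed[OF a]] a])
          moreover have "inv a \<otimes> (a \<otimes> z \<otimes> inv a) \<otimes> a = z"
            using a z by (simp add: m_assoc)
          ultimately show False using False by simp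
        qed
        then show ?thesis using False by (simp add: L_def)
      qed
      define ix where "ix y = (THE i. i < d \<and> y \<otimes> inv (r i) \<in> H)" for y
      have ix: "ix y < d" "y \<otimes> inv (r (ix y)) \<in> H" if "y \<in> carrier G" for y
        using theI'[OF trans[OF that]] by (auto simp: ix_def)
      have "(\<Sum>y\<in>carrier G. L (y \<otimes> g \<otimes> inv y)) = (\<Sum>(i, a)\<in>{..<d} \<times> H. L (r i \<otimes> g \<otimes> inv (r i)))"
      proof (rule sum.reindex_bij_witness[symmetric, where i="\<lambda>y. (ix y, y \<otimes> inv (r (ix y)))"
            and j="\<lambda>(i, a). a \<otimes> r i"])
        fix y assume y: "y \<in> carrier G"
        show "(ix y, y \<otimes> inv (r (ix y))) \<in> {..<d} \<times> H" using ix[OF y] by simp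
        show "(case (ix y, y \<otimes> inv (r (ix y))) of (i, a) \<Rightarrow> a \<otimes> r i) = y"
          using ix[OF y] y r by (simp add: m_assoc)
      next
        fix p assume "p \<in> {..<d} \<times> H"
        then obtain i a where p: "p = (i, a)" "i < d" "a \<in> H" by auto
        have y: "a \<otimes> r i \<in> carrier G" using p r by auto
        have ai: "a \<otimes> r i \<otimes> inv (r i) = a" using p r by (simp add: m_assoc)
        have the: "ix (a \<otimes> r i) = i"
          unfolding ix_def using trans[OF y] p ai by (intro the1_equality) auto
        show "(case p of (i, a) \<Rightarrow> a \<otimes> r i) \<in> carrier G" using p y by simp
        show "(ix (case p of (i, a) \<Rightarrow> a \<otimes> r i),
           (case p of (i, a) \<Rightarrow> a \<otimes> r i) \<otimes> inv (r (ix (case p of (i, a) \<Rightarrow> a \<otimes> r i)))) = p"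
          using p the ai by simp
        have "L (a \<otimes> (r i \<otimes> g \<otimes> inv (r i)) \<otimes> inv a) = L (r i \<otimes> g \<otimes> inv (r i))"
          using p r g by (intro conj) auto
        moreover have "a \<otimes> (r i \<otimes> g \<otimes> inv (r i)) \<otimes> inv a = (a \<otimes> r i) \<otimes> g \<otimes> inv (a \<otimes> r i)"
          using p r g by (simp add: m_assoc inv_mult_group)
        ultimately show "L ((case p of (i, a) \<Rightarrow> a \<otimes> r i) \<otimes> g \<otimes> inv (case p of (i, a) \<Rightarrow> a \<otimes> r i)) =
            (case p of (i, a) \<Rightarrow> L (r i \<otimes> g \<otimes> inv (r i)))"
          using p by simp
      qed
      also have "\<dots> = of_nat (card H) * (\<Sum>i<d. L (r i \<otimes> g \<otimes> inv (r i)))"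
        by (simp add: sum.cartesian_product[symmetric] sum_distrib_left)
      finally have S: "(\<Sum>y\<in>carrier G. L (y \<otimes> g \<otimes> inv y)) = of_nat (card H) * (\<Sum>i<d. L (r i \<otimes> g \<otimes> inv (r i)))" .
      have "character G d \<rho> g = (\<Sum>i<d. L (r i \<otimes> g \<otimes> inv (r i)))"
        using g by (simp add: character_def \<rho>_def)
      also have "\<dots> = (\<Sum>y\<in>carrier G. L (y \<otimes> g \<otimes> inv y)) / of_nat (card H)"
        using S cardH by simp
      finally show ?thesis using g by (simp add: ind_char_def L_def)
    qed (simp add: character_def ind_char_def)
  qed
  ultimately show ?thesis unfolding irr_characters_def by (metis (mono_tags, lifting) mem_Collect_eq)
qed

section \<open>Fields whose order is an odd power of three\<close>

text \<open>Both primitive cube roots of unity are admitted as \<open>om\<close>: exchanging them changes the sign of the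
  quadratic Gauss sum below.\<close>

locale ree_field =
  fixes F :: "'f::{field, finite} itself" and n :: nat and om :: complex
  assumes card_field: "CARD('f) = 3 ^ (2 * n + 1)"
    and om: "om = exp (2 * of_real pi * \<i> / 3) \<or> om = cnj (exp (2 * of_real pi * \<i> / 3))"
begin

text \<open>The map \<open>S\<close> is the field automorphism \<open>t \<mapsto> t\<^bsup>3\<theta>\<^esup>\<close>, whose square is cubing; \<open>A\<close>, \<open>D\<close> are
  the weights with which the torus acts on the first two coordinates.\<close>

definition S :: "'f \<Rightarrow> 'f" where "S t = t ^ (3 * 3 ^ n)"

definition A :: "'f \<Rightarrow> 'f" where "A w = w powi (2 - 3 * 3 ^ n)"

definition D :: "'f \<Rightarrow> 'f" where "D w = w powi (3 * 3 ^ n - 1)"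

definition B :: "'f \<Rightarrow> 'f \<Rightarrow> 'f" where "B s t = s * S t - S s * t"

lemma three_eq_0: "(3 :: 'f) = 0"
proof -
  have "(\<Sum>x\<in>UNIV. x + 1 :: 'f) = (\<Sum>x\<in>UNIV. x)"
    by (rule sum.reindex_bij_witness[where i="\<lambda>x. x - 1" and j="\<lambda>x. x + 1"]) auto
  then have "of_nat CARD('f) = (0 :: 'f)" by (simp add: sum.distrib)
  then have "(3 :: 'f) ^ (2 * n + 1) = 0" by (simp add: card_field)
  then show ?thesis using power_eq_0_iff by blast
qed

lemma two_eq: "(2 :: 'f) = - 1"
proof -
  have "(2 :: 'f) - (- 1) = 3" by simp
  then show ?thesis using three_eq_0 by simp
qed

lemma double_eq_minus: "(a :: 'f) + a = - a"
  unfolding mult_2[symmetric] two_eq by simp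

lemma triple_eq_0: "(a :: 'f) + a + a = 0"
  by (simp add: double_eq_minus)

lemma eq_mod_3I: "y - x = a + a + a \<Longrightarrow> x = (y :: 'f)"
  unfolding triple_eq_0 by simp

lemma one_neq_minus_one: "(1 :: 'f) \<noteq> - 1" "(- 1 :: 'f) \<noteq> 1"
  using two_eq by (metis add.inverse_inverse one_neq_zero one_add_one add_eq_0_iff neg_equal_iff_equal)+

lemma power_card: "(x :: 'f) ^ (3 ^ (2 * n + 1)) = x"
proof (cases "x = 0")
  case False
  have "(\<Prod>y\<in>UNIV - {0}. x * y) = (\<Prod>y\<in>UNIV - {0 :: 'f}. y)"
    by (rule prod.reindex_bij_witness[where i="\<lambda>y. y / x" and j="\<lambda>y. x * y"]) (use False in auto)
  then have "x ^ (CARD('f) - 1) * (\<Prod>y\<in>UNIV - {0 :: 'f}. y) = (\<Prod>y\<in>UNIV - {0}. y)"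
    by (simp add: prod.distrib card_Diff_singleton)
  then have "x ^ (CARD('f) - 1) = 1" by simp
  then have "x ^ (CARD('f) - 1) * x = x" by simp
  then show ?thesis unfolding power_Suc2[symmetric] using card_field by simp
qed simp

lemma cube_add: "((x :: 'f) + y) ^ 3 = x ^ 3 + y ^ 3"
proof -
  have "(x + y) ^ 3 = x ^ 3 + y ^ 3 + 3 * (x\<^sup>2 * y + x * y\<^sup>2)"
    by (simp add: power3_eq_cube power2_eq_square algebra_simps)
  then show ?thesis using three_eq_0 by simp
qed

lemma frobenius_add: "((x :: 'f) + y) ^ (3 ^ k) = x ^ (3 ^ k) + y ^ (3 ^ k)"
proof (induction k)
  case (Suc k)
  have "z ^ (3 ^ Suc k) = (z ^ (3 ^ k)) ^ 3" for z :: 'f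
    by (simp add: power_mult[symmetric] mult.commute)
  then show ?case by (simp only: Suc cube_add)
qed simp

lemma S_eq_frobenius: "S x = x ^ (3 ^ (n + 1))" by (simp add: S_def)

lemma S_add: "S (x + y) = S x + S y" unfolding S_eq_frobenius by (rule frobenius_add)

lemma S_mult: "S (x * y) = S x * S y" by (simp add: S_def power_mult_distrib)

lemma S_0 [simp]: "S 0 = 0" and S_1 [simp]: "S 1 = 1" by (simp_all add: S_def)

lemma S_minus: "S (- x) = - S x"
  using S_add[of x "- x"] by (simp add: eq_neg_iff_add_eq_0 add.commute)

lemma S_diff: "S (x - y) = S x - S y"
  using S_add[of x "- y"] S_minus by simp

lemma S_S: "S (S x) = x ^ 3"
proof -
  have "(3 * 3 ^ n) * (3 * 3 ^ n) = (3 ^ (2 * n + 1) * 3 :: nat)"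
    by (simp add: power_add mult_2)
  then have "S (S x) = x ^ (3 ^ (2 * n + 1) * 3)"
    by (simp only: S_def power_mult[symmetric])
  also have "\<dots> = x ^ 3" by (simp only: power_mult power_card)
  finally show ?thesis .
qed

lemma S_eq_0 [simp]: "S x = 0 \<longleftrightarrow> x = 0" by (simp add: S_def)

lemma S_inj: "S x = S y \<longleftrightarrow> x = y"
  using S_eq_0[of "x - y"] by (simp add: S_diff)

lemma S_surj: "\<exists>r. x = S r"
  using finite_UNIV_inj_surj[of S] by (metis S_inj finite injI surjE)

lemma S_divide: "S (x / y) = S x / S y" by (simp add: S_def power_divide)

lemma A_mult_S:
  assumes "w \<noteq> 0" shows "A w * S w = w\<^sup>2"
proof -
  have "A w * S w = w powi (2 - 3 * 3 ^ n) * w powi (int (3 * 3 ^ n))"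
    unfolding A_def S_def power_int_of_nat ..
  also have "\<dots> = w powi 2" using assms by (simp add: power_int_add[symmetric])
  finally show ?thesis by simp
qed

lemma D_mult_self:
  assumes "w \<noteq> 0" shows "D w * w = S w"
proof -
  have "D w * w = w powi (3 * 3 ^ n - 1) * w powi 1" by (simp add: D_def)
  also have "\<dots> = w powi (int (3 * 3 ^ n))" using assms by (subst power_int_add[symmetric]) auto
  finally show ?thesis unfolding power_int_of_nat S_def .
qed

lemma A_eq: "w \<noteq> 0 \<Longrightarrow> A w = w\<^sup>2 / S w" using A_mult_S[of w] by (simp add: field_simps)
lemma D_eq: "w \<noteq> 0 \<Longrightarrow> D w = S w / w" using D_mult_self[of w] by (simp add: field_simps)

lemma A_nz [simp]: "w \<noteq> 0 \<Longrightarrow> A w \<noteq> 0" and D_nz [simp]: "w \<noteq> 0 \<Longrightarrow> D w \<noteq> 0"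
  by (simp_all add: A_eq D_eq)

lemma A_mult: "w \<noteq> 0 \<Longrightarrow> z \<noteq> 0 \<Longrightarrow> A (w * z) = A w * A z"
  and D_mult: "w \<noteq> 0 \<Longrightarrow> z \<noteq> 0 \<Longrightarrow> D (w * z) = D w * D z"
  by (simp_all add: A_eq D_eq S_mult power2_eq_square field_simps)

lemma A_1 [simp]: "A 1 = 1" and D_1 [simp]: "D 1 = 1"
  and A_m1 [simp]: "A (- 1) = - 1" and D_m1 [simp]: "D (- 1) = 1"
  by (simp_all add: A_eq D_eq S_minus)

lemma A_mult_D: "w \<noteq> 0 \<Longrightarrow> A w * D w = w"
  by (simp add: A_eq D_eq power2_eq_square)

lemma A_S_A: "w \<noteq> 0 \<Longrightarrow> A w * S (A w) = D w"
  by (simp add: A_eq D_eq S_divide S_S power2_eq_square power3_eq_cube S_mult)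

lemma A_A_S_A: "w \<noteq> 0 \<Longrightarrow> A w * A w * S (A w) = w"
  using A_S_A[of w] A_mult_D[of w] by (simp add: mult.assoc)

lemma A_eq_1: "w \<noteq> 0 \<Longrightarrow> A w = 1 \<longleftrightarrow> w = 1"
  using A_A_S_A[of w] by auto

text \<open>The exponent of \<open>A\<close> is \<open>2 - 3\<theta>\<close>, and \<open>2 + 3\<theta>\<close> is its inverse modulo \<open>q - 1\<close>, because
  \<open>(2 - 3\<theta>) (2 + 3\<theta>) = 4 - 9\<theta>\<^sup>2\<close> and \<open>9\<theta>\<^sup>2 = 3 q\<close>.\<close>

lemma A_inv: "s \<noteq> 0 \<Longrightarrow> A (s * s * S s) = s"
  by (simp add: A_eq S_mult S_S power2_eq_square power3_eq_cube)

lemma cube_eq_self: "(x :: 'f) ^ 3 = x \<longleftrightarrow> x \<in> {0, 1, - 1}"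
proof -
  have "x ^ 3 - x = x * ((x - 1) * (x + 1))" by (simp add: algebra_simps power3_eq_cube)
  then have "x ^ 3 = x \<longleftrightarrow> x * ((x - 1) * (x + 1)) = 0" by (metis eq_iff_diff_eq_0)
  also have "\<dots> \<longleftrightarrow> x \<in> {0, 1, - 1}" by (auto simp: add_eq_0_iff2)
  finally show ?thesis .
qed

text \<open>As \<open>S\<close> squares to cubing, its fixed points satisfy \<open>x\<^sup>3 = x\<close>.\<close>

lemma S_eq_self: "S x = x \<longleftrightarrow> x \<in> {0, 1, - 1}"
proof
  assume "S x = x"
  then have "x ^ 3 = x" using S_S[of x] by simp
  then show "x \<in> {0, 1, - 1}" by (simp only: cube_eq_self)
qed (auto simp: S_minus)

lemma D_eq_1: "w \<noteq> 0 \<Longrightarrow> D w = 1 \<longleftrightarrow> w = 1 \<or> w = - 1"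
  using S_eq_self[of w] by (auto simp: D_eq)

lemma B_add_left: "B (s + s') t = B s t + B s' t"
  and B_add_right: "B s (t + t') = B s t + B s t'"
  and B_minus_left: "B (- s) t = - B s t" and B_minus_right: "B s (- t) = - B s t"
  and B_self [simp]: "B s s = 0" and B_0_left [simp]: "B 0 t = 0" and B_0_right [simp]: "B s 0 = 0"
  and B_swap: "B t s = - B s t"
  by (simp_all add: B_def S_add S_minus algebra_simps)

lemma B_diff_left: "B (s - s') t = B s t - B s' t"
  by (simp add: B_def S_diff algebra_simps)

lemma B_A: "w \<noteq> 0 \<Longrightarrow> B (A w * s) (A w * t) = D w * B s t"
  by (simp add: B_def S_mult A_S_A[symmetric] algebra_simps)

subsection \<open>The canonical additive character\<close>

definition Tr :: "'f \<Rightarrow> 'f" where "Tr x = (\<Sum>i<2 * n + 1. x ^ (3 ^ i))"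

lemma Tr_add: "Tr (x + y) = Tr x + Tr y"
  by (simp add: Tr_def frobenius_add sum.distrib)

lemma Tr_cube: "Tr (x ^ 3) = Tr x" and Tr_power3: "Tr x ^ 3 = Tr x"
proof -
  have 1: "Tr (x ^ 3) = (\<Sum>i<2 * n + 1. x ^ (3 ^ Suc i))"
    by (simp add: Tr_def power_mult del: sum.lessThan_Suc)
  also have "\<dots> = Tr x"
  proof -
    have "(\<Sum>i<Suc (2 * n + 1). x ^ (3 ^ i)) = x + (\<Sum>i<2 * n + 1. x ^ (3 ^ Suc i))"
      by (subst sum.lessThan_Suc_shift) simp
    moreover have "(\<Sum>i<Suc (2 * n + 1). x ^ (3 ^ i)) = Tr x + x"
      unfolding sum.lessThan_Suc[of _ "2 * n + 1"] power_card Tr_def ..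
    ultimately show ?thesis by (simp add: add.commute)
  qed
  finally show 2: "Tr (x ^ 3) = Tr x" .
  have "sum f I ^ 3 = (\<Sum>i\<in>I. f i ^ 3)" if "finite I" for f :: "nat \<Rightarrow> 'f" and I
    using that by induction (simp_all add: cube_add)
  then have "Tr x ^ 3 = Tr (x ^ 3)"
    by (simp add: Tr_def power_mult[symmetric] mult.commute del: sum.lessThan_Suc)
  then show "Tr x ^ 3 = Tr x" using 2 by simp
qed

lemma Tr_cases: "Tr x = 0 \<or> Tr x = 1 \<or> Tr x = - 1"
  using Tr_power3[of x] cube_eq_self[of "Tr x"] by auto

text \<open>The trace is a polynomial function of degree \<open>3\<^bsup>2n\<^esup> < q\<close>.\<close>

lemma Tr_nontrivial: "\<exists>x. Tr x \<noteq> 0"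
proof (rule ccontr)
  assume *: "\<not> ?thesis"
  define p :: "'f poly" where "p = (\<Sum>i<2 * n + 1. monom 1 (3 ^ i))"
  have p: "poly p x = Tr x" for x by (simp add: p_def Tr_def poly_sum poly_monom)
  have "coeff p (3 ^ (2 * n)) = (\<Sum>i<2 * n + 1. if i = 2 * n then 1 else 0)"
    unfolding p_def coeff_sum by (intro sum.cong) auto
  then have "coeff p (3 ^ (2 * n)) = 1" by simp
  then have p0: "p \<noteq> 0" by auto
  have "degree p \<le> 3 ^ (2 * n)"
    unfolding p_def by (intro degree_sum_le) (auto intro: order.trans[OF degree_monom_le])
  moreover have "card {x. poly p x = 0} \<le> degree p" using p0 by (rule card_poly_roots_bound)
  moreover have "{x. poly p x = 0} = UNIV" using * p by auto
  ultimately have "(3 :: nat) ^ (2 * n + 1) \<le> 3 ^ (2 * n)"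
    unfolding card_field[symmetric] by (metis order.trans)
  then show False by simp
qed

lemma om_eq: "om = Complex (- 1 / 2) (sqrt 3 / 2) \<or> om = Complex (- 1 / 2) (- sqrt 3 / 2)"
proof -
  have "exp (2 * of_real pi * \<i> / 3) = cis (2 * pi / 3)" by (simp add: cis_conv_exp mult_ac)
  then have "exp (2 * of_real pi * \<i> / 3) = Complex (- 1 / 2) (sqrt 3 / 2)"
    by (simp add: complex_eq_iff cos_120 sin_120)
  then show ?thesis using om by (auto simp: complex_eq_iff)
qed

lemma om_sum: "1 + om + cnj om = 0" and om_cnj: "om * cnj om = 1"
  and om_sq: "om * om = cnj om" and om_neq: "om \<noteq> 1" "cnj om \<noteq> 1" "om \<noteq> cnj om" "cnj om \<noteq> om"
  and om_nz: "om \<noteq> 0"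
proof -
  have "Re om = - 1 / 2" "Im om * Im om = 3 / 4" "Im om \<noteq> 0" using om_eq by auto
  then show "1 + om + cnj om = 0" "om * cnj om = 1" "om * om = cnj om"
    "om \<noteq> 1" "cnj om \<noteq> 1" "om \<noteq> cnj om" "cnj om \<noteq> om" "om \<noteq> 0"
    by (auto simp: complex_eq_iff)
qed

definition phi :: "'f \<Rightarrow> complex" where
  "phi x = (if Tr x = 0 then 1 else if Tr x = 1 then om else cnj om)"

lemma phi_add: "phi (x + y) = phi x * phi y"
proof -
  have "Tr (x + y) = Tr x + Tr y" by (rule Tr_add)
  moreover have "(1 :: 'f) + 1 = - 1" "- 1 + - 1 = (1 :: 'f)" using two_eq by (simp_all add: algebra_simps)
  moreover have "cnj om * cnj om = om" "cnj om * om = 1" using om_sq om_cnj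
    by (metis complex_cnj_cnj complex_cnj_mult, simp add: mult.commute)
  ultimately show ?thesis
    using Tr_cases[of x] Tr_cases[of y] one_neq_minus_one om_sq om_cnj
    by (auto simp: phi_def)
qed

lemma phi_0 [simp]: "phi 0 = 1" by (simp add: phi_def Tr_def)

lemma phi_values: "phi x = 1 \<or> phi x = om \<or> phi x = cnj om" by (simp add: phi_def)

lemma phi_nz [simp]: "phi x \<noteq> 0" using phi_values[of x] om_nz by auto

lemma phi_minus: "phi (- x) = cnj (phi x)"
proof -
  have "phi x * phi (- x) = 1" using phi_add[of x "- x"] by simp
  moreover have "phi x * cnj (phi x) = 1"
    using phi_values[of x] om_cnj by (auto simp: mult.commute)
  ultimately show ?thesis by (metis mult_left_cancel phi_nz)
qed

lemma phi_diff: "phi (x - y) = phi x * cnj (phi y)"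
  using phi_add[of x "- y"] by (simp add: phi_minus)

lemma phi_cube: "phi (x ^ 3) = phi x" by (simp add: phi_def Tr_cube)

lemma phi_frobenius: "phi (x ^ (3 ^ k)) = phi x"
proof (induction k)
  case (Suc k)
  have "x ^ (3 ^ Suc k) = (x ^ (3 ^ k)) ^ 3" by (simp add: power_mult[symmetric] mult.commute)
  then show ?case using Suc phi_cube by simp
qed simp

lemma phi_S: "phi (S x) = phi x" unfolding S_eq_frobenius by (rule phi_frobenius)

lemma phi_om: "\<exists>a. phi a = om"
proof -
  obtain x where "Tr x \<noteq> 0" using Tr_nontrivial by auto
  then have "phi x = om \<or> phi x = cnj om" by (simp add: phi_def)
  then show ?thesis using phi_minus[of x] by auto
qed

lemma phi_nontrivial:
  assumes "a \<noteq> 0" shows "\<exists>x. phi (a * x) \<noteq> 1"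
proof -
  obtain b where "phi b = om" using phi_om by auto
  then have "phi (a * (b / a)) \<noteq> 1" using assms om_neq by simp
  then show ?thesis by blast
qed

lemma sum_additive_character:
  assumes G: "\<And>x y. x \<in> G \<Longrightarrow> y \<in> G \<Longrightarrow> x + y \<in> G" "\<And>x. x \<in> G \<Longrightarrow> - x \<in> (G :: 'f set)"
    and f: "\<And>x y. x \<in> G \<Longrightarrow> y \<in> G \<Longrightarrow> f (x + y) = f x * (f y :: complex)"
    and a: "a \<in> G" "f a \<noteq> 1"
  shows "(\<Sum>x\<in>G. f x) = 0"
proof -
  have d: "x - a \<in> G" if "x \<in> G" for x using G(1)[OF that G(2)[OF a(1)]] by simp
  have "(\<Sum>x\<in>G. f x) = (\<Sum>x\<in>G. f (a + x))"
    by (rule sum.reindex_bij_witness[where i="\<lambda>x. a + x" and j="\<lambda>x. x - a"]) (use a G d in auto)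
  also have "\<dots> = f a * (\<Sum>x\<in>G. f x)" using f a by (simp add: sum_distrib_left)
  finally have "(f a - 1) * (\<Sum>x\<in>G. f x) = 0" by (simp add: algebra_simps)
  then show ?thesis using a by simp
qed

lemma sum_phi: "(\<Sum>x\<in>UNIV. phi (a * x)) = (if a = 0 then of_nat CARD('f) else 0)"
proof (cases "a = 0")
  case False
  obtain x where "phi (a * x) \<noteq> 1" using phi_nontrivial False by blast
  then have "(\<Sum>x\<in>UNIV. phi (a * x)) = 0"
    by (intro sum_additive_character[where a=x]) (auto simp: phi_add distrib_left)
  then show ?thesis using False by simp
qed simp

lemma card_phi_eq:
  assumes "z \<in> {1, om, cnj om}" shows "card {x. phi x = z} = 3 ^ (2 * n)"
proof -
  obtain a where a: "phi a = om" using phi_om by auto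
  have sh: "card {x. phi x = om * y} = card {x. phi x = y}" for y
    by (rule bij_betw_same_card[symmetric, of "\<lambda>x. x + a"], rule bij_betw_byWitness[where f'="\<lambda>x. x - a"])
      (use a om_cnj in \<open>auto simp: phi_add phi_diff\<close>)
  have eq: "card {x. phi x = om} = card {x. phi x = 1}" "card {x. phi x = cnj om} = card {x. phi x = 1}"
    using sh[of 1] sh[of om] om_sq by simp_all
  have "UNIV = {x. phi x = 1} \<union> ({x. phi x = om} \<union> {x. phi x = cnj om})"
    using phi_values by auto
  then have "CARD('f) = card ({x. phi x = 1} \<union> ({x. phi x = om} \<union> {x. phi x = cnj om}))" by simp
  also have "\<dots> = card {x. phi x = 1} + (card {x. phi x = om} + card {x. phi x = cnj om})"
    using om_neq by (subst card_Un_disjoint, simp, simp, force, subst card_Un_disjoint) auto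
  finally have "3 * card {x. phi x = 1} = 3 ^ (2 * n + 1)" using eq card_field by simp
  then show ?thesis using assms eq by auto
qed

text \<open>The radical of the alternating form \<open>phi \<circ> B\<close> is the prime field: the adjoint of \<open>S\<close> with
  respect to the trace form is the inverse of \<open>S\<close>, and \<open>S\<close> squares to cubing.\<close>

lemma sum_phi_B: "(\<Sum>t\<in>UNIV. phi (B s t)) = (if s \<in> {0, 1, - 1} then of_nat CARD('f) else 0)"
proof -
  obtain r where r: "s = S r" using S_surj by auto
  have "phi (B s t) = phi ((r - S s) * t)" for t
  proof -
    have "phi (B s t) = phi (S (r * t)) * cnj (phi (S s * t))"
      by (simp add: B_def phi_diff r S_mult)
    also have "\<dots> = phi ((r - S s) * t)" by (simp add: phi_S phi_diff left_diff_distrib)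
    finally show ?thesis .
  qed
  moreover have "r - S s = 0 \<longleftrightarrow> s \<in> {0, 1, - 1}"
  proof -
    have "r = S s \<longleftrightarrow> s = S (S s)" using r S_inj by metis
    then show ?thesis using cube_eq_self[of s] S_S[of s] by auto
  qed
  ultimately show ?thesis using sum_phi[of "r - S s"] by simp
qed

text \<open>An additive form of Hilbert's Theorem 90 for \<open>S\<close>. The map \<open>r \<mapsto> S r - r\<close> has the prime field as its
  kernel, and its image, of order \<open>q / 3\<close>, lies in the kernel of \<open>phi\<close> because \<open>phi\<close> is invariant
  under \<open>S\<close>; but the latter kernel also has order \<open>q / 3\<close>.\<close>

lemma phi_eq_1_iff_S_diff: "phi z = 1 \<longleftrightarrow> (\<exists>r. z = S r - r)"
proof -
  have "card {r. S r - r = y} = 3" if y: "y \<in> range (\<lambda>r. S r - r)" for y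
  proof -
    obtain r where r: "y = S r - r" using y by auto
    have "{r'. S r' - r' = y} = (\<lambda>c. r + c) ` {0, 1, - 1}"
    proof -
      have "S r' - r' = y \<longleftrightarrow> r' - r \<in> {0, 1, - 1}" for r'
      proof -
        have "S r' - r' = y \<longleftrightarrow> S (r' - r) = r' - r"
          unfolding r S_diff by (auto simp: algebra_simps)
        then show ?thesis by (simp only: S_eq_self)
      qed
      moreover have "r' - r \<in> {0, 1, - 1} \<longleftrightarrow> r' \<in> (\<lambda>c. r + c) ` {0, 1, - 1}" for r'
        by (auto simp: algebra_simps)
      ultimately show ?thesis by blast
    qed
    then show ?thesis using one_neq_minus_one by (simp add: card_image)
  qed
  moreover have "CARD('f) = (\<Sum>y\<in>range (\<lambda>r. S r - r). card {r. S r - r = y})"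
    using sum.image_gen[of UNIV "\<lambda>_. 1 :: nat" "\<lambda>r. S r - r"] by simp
  ultimately have "card (range (\<lambda>r. S r - r)) = 3 ^ (2 * n)" using card_field by simp
  moreover have "card {x. phi x = 1} = 3 ^ (2 * n)" using card_phi_eq by simp
  moreover have "range (\<lambda>r. S r - r) \<subseteq> {x. phi x = 1}"
  proof -
    have "phi (S r - r) = 1" for r
    proof -
      have "phi (S r - r) = phi (r - r)" unfolding phi_diff phi_S ..
      then show ?thesis by simp
    qed
    then show ?thesis by auto
  qed
  ultimately have "range (\<lambda>r. S r - r) = {x. phi x = 1}" by (intro card_subset_eq) auto
  then show ?thesis by auto
qed

subsection \<open>The quadratic Gauss sum\<close>

text \<open>\<open>D\<close> is the power map with exponent \<open>3\<theta> - 1\<close>, whose greatest common divisor with \<open>q - 1\<close> is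
  \<open>2\<close>; hence its values are the non-zero squares.\<close>

definition Sq :: "'f set" where "Sq = D ` (UNIV - {0})"

lemma D_eq_iff: "w \<noteq> 0 \<Longrightarrow> z \<noteq> 0 \<Longrightarrow> D w = D z \<longleftrightarrow> w = z \<or> w = - z"
proof -
  assume wz: "w \<noteq> 0" "z \<noteq> 0"
  have "D w = D z * D (w / z)" using wz D_mult[of z "w / z"] by simp
  then have "D w = D z \<longleftrightarrow> D (w / z) = 1" using wz by simp
  also have "\<dots> \<longleftrightarrow> w / z = 1 \<or> w / z = - 1" using wz by (intro D_eq_1) simp
  also have "\<dots> \<longleftrightarrow> w = z \<or> w = - z" using wz by (auto simp: field_simps)
  finally show ?thesis .
qed

lemma neq_minus_self: "z \<noteq> 0 \<Longrightarrow> (z :: 'f) \<noteq> - z"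
  using two_eq by (metis add_eq_0_iff mult_2 mult_minus1 neg_equal_0_iff_equal)

lemma sum_D: "(\<Sum>w\<in>UNIV - {0}. f (D w)) = (2 :: 'c :: comm_semiring_1) * (\<Sum>y\<in>Sq. f y)"
proof -
  have fib: "{w \<in> UNIV - {0}. D w = D z} = {z, - z}" if "z \<noteq> 0" for z
    using that D_eq_iff[OF _ that] by auto
  have "(\<Sum>w\<in>UNIV - {0}. f (D w)) = (\<Sum>y\<in>Sq. \<Sum>w\<in>{w \<in> UNIV - {0}. D w = y}. f (D w))"
    unfolding Sq_def by (rule sum.image_gen) simp
  also have "\<dots> = (\<Sum>y\<in>Sq. 2 * f y)"
  proof (rule sum.cong[OF refl])
    fix y assume "y \<in> Sq"
    then obtain z where z: "z \<noteq> 0" "y = D z" by (auto simp: Sq_def)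
    have "(\<Sum>w\<in>{z, - z}. f (D w)) = f (D z) + f (D (- z))"
      using neq_minus_self[OF z(1)] by (subst sum.insert) auto
    also have "D (- z) = D z" using z(1) D_eq_iff by (metis neg_equal_0_iff_equal)
    finally show "(\<Sum>w\<in>{w \<in> UNIV - {0}. D w = y}. f (D w)) = 2 * f y"
      unfolding z(2) fib[OF z(1)] mult_2 .
  qed
  finally show ?thesis by (simp add: sum_distrib_left)
qed

lemma card_nz: "card (UNIV - {0 :: 'f}) = 3 ^ (2 * n + 1) - 1"
  by (simp add: card_Diff_singleton card_field)

lemma card_Sq: "2 * card Sq = 3 ^ (2 * n + 1) - 1"
  using sum_D[of "\<lambda>_. 1 :: nat"] card_nz by simp

lemma D_power_half:
  assumes "w \<noteq> 0" shows "D w ^ card Sq = 1"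
proof -
  define k where "k = (3 * 3 ^ n - 1 :: nat) div 2"
  have "even (3 * 3 ^ n - 1 :: nat)" by simp
  then have k: "3 * 3 ^ n = Suc (2 * k)" unfolding k_def by simp
  have "D w * w = w ^ (2 * k) * w" using D_mult_self[OF assms] by (simp add: S_def k)
  then have "D w = w ^ (2 * k)" using assms by simp
  then have "D w ^ card Sq = w ^ (2 * card Sq * k)" by (simp add: power_mult[symmetric] mult_ac)
  also have "\<dots> = (w ^ (2 * card Sq)) ^ k" by (rule power_mult)
  also have "w ^ (2 * card Sq) = 1"
  proof -
    have "w ^ (3 ^ (2 * n + 1) - 1) * w = w"
      using power_card[of w] unfolding power_Suc2[symmetric] by simp
    then show ?thesis unfolding card_Sq using assms by simp
  qed
  finally show ?thesis by simp
qed

text \<open>An odd power of three is \<open>3\<close> modulo \<open>4\<close>.\<close>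

lemma odd_card_Sq: "odd (card Sq)"
proof -
  have "(3 ^ (2 * k + 1)) mod 4 = (3 :: nat)" for k
  proof (induction k)
    case (Suc k)
    have "3 ^ (2 * Suc k + 1) = (9 * 3 ^ (2 * k + 1) :: nat)" by simp
    then show ?case using Suc by presburger
  qed simp
  then have "(3 ^ (2 * n + 1)) mod 4 = (3 :: nat)" .
  then have "(2 * card Sq + 1) mod 4 = 3" using card_Sq by simp
  then show ?thesis by presburger
qed

lemma minus_Sq: "x \<in> Sq \<Longrightarrow> - x \<notin> Sq"
proof
  assume "x \<in> Sq" "- x \<in> Sq"
  moreover have "y ^ card Sq = 1" if y: "y \<in> Sq" for y
  proof -
    obtain w where "w \<noteq> 0" "y = D w" using y by (auto simp: Sq_def)
    then show ?thesis using D_power_half by simp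
  qed
  ultimately have "x ^ card Sq = 1" "(- x) ^ card Sq = 1" by blast+
  then show False using odd_card_Sq one_neq_minus_one by (simp add: power_minus_odd)
qed

lemma Sq_nz: "0 \<notin> Sq" and Sq_1 [simp]: "1 \<in> Sq" by (auto simp: Sq_def image_iff intro: bexI[of _ 1])

lemma nz_eq_Sq: "UNIV - {0} = Sq \<union> uminus ` Sq" and Sq_disjoint: "Sq \<inter> uminus ` Sq = {}"
proof -
  show disj: "Sq \<inter> uminus ` Sq = {}" using minus_Sq by auto
  have "card (Sq \<union> uminus ` Sq) = card Sq + card (uminus ` Sq)"
    using disj by (intro card_Un_disjoint) auto
  also have "card (uminus ` Sq) = card Sq" by (rule card_image) simp
  finally have "card (Sq \<union> uminus ` Sq) = card (UNIV - {0 :: 'f})" using card_Sq card_nz by simp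
  moreover have "Sq \<union> uminus ` Sq \<subseteq> UNIV - {0}" using Sq_nz by auto
  ultimately show "UNIV - {0} = Sq \<union> uminus ` Sq" by (intro card_subset_eq[symmetric]) auto
qed

lemma nz_cases: "y \<noteq> 0 \<Longrightarrow> y \<in> Sq \<or> - y \<in> Sq"
proof -
  assume "y \<noteq> 0"
  then have "y \<in> Sq \<union> uminus ` Sq" unfolding nz_eq_Sq[symmetric] by simp
  then show ?thesis by auto
qed

lemma sum_nz_D:
  "2 * (\<Sum>y\<in>UNIV - {0}. f y) = (\<Sum>w\<in>UNIV - {0}. f (D w) + (f (- D w) :: 'c :: comm_semiring_1))"
proof -
  have "2 * (\<Sum>y\<in>UNIV - {0}. f y) = 2 * (\<Sum>y\<in>Sq. f y) + 2 * (\<Sum>y\<in>uminus ` Sq. f y)"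
    unfolding nz_eq_Sq using Sq_disjoint by (subst sum.union_disjoint) (auto simp: distrib_left)
  also have "(\<Sum>y\<in>uminus ` Sq. f y) = (\<Sum>y\<in>Sq. f (- y))" by (subst sum.reindex) auto
  finally show ?thesis using sum_D[of f] sum_D[of "\<lambda>y. f (- y)"] by (simp add: sum.distrib)
qed

definition gauss :: "'f \<Rightarrow> complex" where "gauss u = (\<Sum>w\<in>UNIV - {0}. phi (D w * u))"

lemma gauss_D: "w \<noteq> 0 \<Longrightarrow> gauss (D w * u) = gauss u"
  unfolding gauss_def
  by (rule sum.reindex_bij_witness[where i="\<lambda>z. z / w" and j="\<lambda>z. z * w"])
    (auto simp: D_mult mult_ac)

lemma gauss_Sq: "u \<in> Sq \<Longrightarrow> gauss u = gauss 1" "u \<in> Sq \<Longrightarrow> gauss (- u) = gauss (- 1)"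
  using gauss_D[of _ 1] gauss_D[of _ "- 1"] by (auto simp: Sq_def)

lemma gauss_minus: "gauss (- u) = cnj (gauss u)"
  by (simp add: gauss_def phi_minus)

lemma gauss_0: "gauss 0 = of_nat (CARD('f) - 1)"
  by (simp add: gauss_def card_Diff_singleton)

lemma sum_nz_phi: "(\<Sum>y\<in>UNIV - {0}. phi y) = - 1"
proof -
  have "(\<Sum>y\<in>UNIV. phi y) = 0" using sum_phi[of 1] by simp
  then show ?thesis by (simp add: sum_diff1)
qed

lemma gauss_1_Re: "gauss 1 + cnj (gauss 1) = - 2"
proof -
  have "gauss 1 + cnj (gauss 1) = 2 * (\<Sum>y\<in>UNIV - {0}. phi y)"
    unfolding sum_nz_D by (simp add: gauss_def sum.distrib phi_minus)
  then show ?thesis using sum_nz_phi by simp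
qed

text \<open>Summed over all \<open>u\<close>, the squared modulus of \<open>gauss u\<close> counts the pairs with \<open>D w = D z\<close>, and all
  non-zero \<open>u\<close> contribute the same amount since \<open>gauss (- u)\<close> is the conjugate of \<open>gauss u\<close>.\<close>

lemma gauss_1_norm: "gauss 1 * cnj (gauss 1) = of_nat (CARD('f) + 1)"
proof -
  let ?q = "of_nat CARD('f) :: complex" and ?nz = "UNIV - {0 :: 'f}"
  have q1: "of_nat (CARD('f) - 1) = ?q - 1" by (simp add: of_nat_diff Suc_leI)
  have q3: "CARD('f) \<ge> 3" by (simp add: card_field)
  have "(\<Sum>u\<in>UNIV. gauss u * cnj (gauss u)) = (\<Sum>u\<in>UNIV. \<Sum>w\<in>?nz. \<Sum>z\<in>?nz. phi ((D w - D z) * u))"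
    by (simp add: gauss_def sum_product phi_diff left_diff_distrib)
  also have "\<dots> = (\<Sum>w\<in>?nz. \<Sum>z\<in>?nz. \<Sum>u\<in>UNIV. phi ((D w - D z) * u))"
    by (rule trans[OF sum.swap], rule sum.cong[OF refl], rule sum.swap)
  also have "\<dots> = (\<Sum>w\<in>?nz. \<Sum>z\<in>?nz. if D z = D w then ?q else 0)"
    by (intro sum.cong refl) (auto simp: sum_phi)
  also have "\<dots> = (\<Sum>w\<in>?nz. 2 * ?q)"
  proof (rule sum.cong[OF refl])
    fix w assume w: "w \<in> ?nz"
    have "{z \<in> ?nz. D z = D w} = {w, - w}" using w D_eq_iff[of _ w] by auto
    then have "card {z \<in> ?nz. D z = D w} = 2" using w neq_minus_self[of w] by simp
    then show "(\<Sum>z\<in>?nz. if D z = D w then ?q else 0) = 2 * ?q"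
      by (simp add: sum.inter_filter[symmetric])
  qed
  finally have 1: "(\<Sum>u\<in>UNIV. gauss u * cnj (gauss u)) = 2 * ?q * (?q - 1)"
    using q1 by (simp add: card_Diff_singleton)
  have "2 * (\<Sum>u\<in>?nz. gauss u * cnj (gauss u)) = (\<Sum>w\<in>?nz. 2 * (gauss 1 * cnj (gauss 1)))"
    unfolding sum_nz_D using gauss_D[of _ 1] by (intro sum.cong refl) (simp add: gauss_minus)
  also have "\<dots> = 2 * ((?q - 1) * (gauss 1 * cnj (gauss 1)))"
    using q1 by (simp add: card_Diff_singleton)
  finally have 2: "(\<Sum>u\<in>?nz. gauss u * cnj (gauss u)) = (?q - 1) * (gauss 1 * cnj (gauss 1))" by simp
  have "(\<Sum>u\<in>UNIV. gauss u * cnj (gauss u)) =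
      gauss 0 * cnj (gauss 0) + (\<Sum>u\<in>?nz. gauss u * cnj (gauss u))"
    by (rule sum.remove) auto
  then have "2 * ?q * (?q - 1) = (?q - 1) * (?q - 1) + (?q - 1) * (gauss 1 * cnj (gauss 1))"
    using 1 2 gauss_0 q1 by simp
  then have "(?q - 1) * (gauss 1 * cnj (gauss 1) - (?q + 1)) = 0" by (simp add: algebra_simps)
  moreover have "?q - 1 \<noteq> 0"
  proof
    assume "?q - 1 = 0"
    then have "(of_nat CARD('f) :: complex) = of_nat 1" by simp
    then have "CARD('f) = 1" by (simp only: of_nat_eq_iff)
    then show False using q3 by simp
  qed
  ultimately show ?thesis by simp
qed

lemma csqrt_m3: "csqrt (- 3) = \<i> * of_real (sqrt 3)"
  by (simp add: complex_eq_iff csqrt.simps)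

lemma gauss_1: "\<exists>\<delta>\<in>{1, - 1}. gauss 1 = - 1 + \<delta> * of_nat (3 ^ n) * csqrt (- 3)"
proof -
  define x y where "x = Re (gauss 1)" and "y = Im (gauss 1)"
  have g: "gauss 1 = Complex x y" by (simp add: x_def y_def)
  have x: "x = - 1" using gauss_1_Re by (simp add: g complex_eq_iff)
  have "x * x + y * y = real (CARD('f) + 1)"
    using gauss_1_norm by (simp add: g complex_eq_iff)
  then have "y\<^sup>2 = (3 ^ n * sqrt 3)\<^sup>2"
    using x by (simp add: card_field power_mult_distrib power2_eq_square power_add mult_2)
  then have "y = 3 ^ n * sqrt 3 \<or> y = - (3 ^ n * sqrt 3)" by (rule power2_eq_iff[THEN iffD1])
  then show ?thesis
  proof
    assume "y = 3 ^ n * sqrt 3"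
    then show ?thesis unfolding g x csqrt_m3 by (intro bexI[of _ 1]) (auto simp: complex_eq_iff)
  next
    assume "y = - (3 ^ n * sqrt 3)"
    then show ?thesis unfolding g x csqrt_m3 by (intro bexI[of _ "- 1"]) (auto simp: complex_eq_iff)
  qed
qed

text \<open>Exchanging the two primitive cube roots of unity conjugates the Gauss sum, so one of them
  gives it the sign wanted.\<close>

lemma gauss_sign:
  obtains z where "ree_field TYPE('f) n z" "ree_field.gauss n z (1 :: 'f) = - 1 + of_nat (3 ^ n) * csqrt (- 3)"
proof -
  interpret c: ree_field F n "cnj om"
    using card_field om by unfold_locales auto
  have "c.phi x = cnj (phi x)" for x by (simp add: c.phi_def phi_def)
  then have conj: "c.gauss 1 = cnj (gauss 1)" by (simp add: c.gauss_def gauss_def)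
  obtain \<delta> where \<delta>: "\<delta> \<in> {1, - 1}" "gauss 1 = - 1 + \<delta> * of_nat (3 ^ n) * csqrt (- 3)"
    using gauss_1 by blast
  show ?thesis
  proof (cases "\<delta> = 1")
    case True
    show ?thesis by (rule that[of om]) (use \<delta> True ree_field_axioms in auto)
  next
    case False
    show ?thesis
      by (rule that[of "cnj om"]) (use \<delta> False conj c.ree_field_axioms in \<open>auto simp: csqrt_m3\<close>)
  qed
qed

subsection \<open>A Lagrangian subgroup\<close>

text \<open>A maximal isotropic subgroup is its own orthogonal, and counting the pairs in
  \<open>L \<times> F\<^sub>q\<close> with a character sum in both orders gives \<open>|L|\<^sup>2 = 3 q\<close>.\<close>

definition isotropic :: "'f set \<Rightarrow> bool" where
  "isotropic L \<longleftrightarrow> 0 \<in> L \<and> (\<forall>s\<in>L. \<forall>t\<in>L. s + t \<in> L) \<and> (\<forall>s\<in>L. - s \<in> L) \<and>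
     (\<forall>s\<in>L. \<forall>t\<in>L. phi (B s t) = 1)"

lemma phi_of_nat: "phi (of_nat k * x) = phi x ^ k"
  by (induction k) (simp_all add: distrib_right phi_add)

lemma S_of_nat: "S (of_nat k) = of_nat k"
  by (induction k) (simp_all add: S_add)

lemma B_of_nat: "B (of_nat k * s) t = of_nat k * B s t" "B s (of_nat k * t) = of_nat k * B s t"
  by (simp_all add: B_def S_mult S_of_nat algebra_simps)

lemma isotropic_extend:
  assumes L: "isotropic L" and t: "\<And>s. s \<in> L \<Longrightarrow> phi (B s t) = 1"
  shows "isotropic {l + of_nat k * t | l k. l \<in> L}"
proof -
  have ts: "phi (B t s) = 1" if "s \<in> L" for s using t[OF that] by (simp add: B_swap[of t] phi_minus)
  have "phi (B (l + of_nat k * t) (l' + of_nat k' * t)) = 1" if "l \<in> L" "l' \<in> L" for l l' k k'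
    using that L t ts
    by (simp add: B_add_left B_add_right B_of_nat phi_add phi_of_nat isotropic_def)
  moreover have "\<exists>l'' k''. (l + of_nat k * t) + (l' + of_nat k' * t) = l'' + of_nat k'' * t \<and> l'' \<in> L"
    if "l \<in> L" "l' \<in> L" for l l' and k k' :: nat
    using that L by (intro exI[of _ "l + l'"] exI[of _ "k + k'"]) (auto simp: isotropic_def algebra_simps)
  moreover have "\<exists>l' k'. - (l + of_nat k * t) = l' + of_nat k' * t \<and> l' \<in> L" if "l \<in> L" for l and k :: nat
    using that L two_eq by (intro exI[of _ "- l"] exI[of _ "2 * k"]) (auto simp: isotropic_def algebra_simps)
  moreover have "\<exists>l k. 0 = l + of_nat k * t \<and> l \<in> L"
    using L by (intro exI[of _ 0]) (auto simp: isotropic_def)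
  ultimately show ?thesis unfolding isotropic_def by blast
qed

lemma Lagrangian_exists:
  "\<exists>L. isotropic L \<and> (\<forall>t. (\<forall>s\<in>L. phi (B s t) = 1) \<longrightarrow> t \<in> L) \<and> card L = 3 * 3 ^ n \<and> {0, 1, - 1} \<subseteq> L"
proof -
  have "isotropic {0}" by (simp add: isotropic_def)
  then obtain L where L: "isotropic L" and max: "\<And>L'. isotropic L' \<Longrightarrow> card L' \<le> card L"
    using ex_has_greatest_nat[of isotropic "{0}" card "Suc CARD('f)"]
    by (metis card_mono finite top_greatest less_Suc_eq_le)
  have self: "t \<in> L" if "\<forall>s\<in>L. phi (B s t) = 1" for t
  proof (rule ccontr)
    assume t: "t \<notin> L"
    let ?L' = "{l + of_nat k * t | l k. l \<in> L}"
    have "insert t L \<subseteq> ?L'"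
    proof -
      have "t = 0 + of_nat 1 * t" "0 \<in> L" using L by (auto simp: isotropic_def)
      moreover have "l = l + of_nat 0 * t" for l by simp
      ultimately show ?thesis by blast
    qed
    then have "card (insert t L) \<le> card ?L'" by (intro card_mono) auto
    moreover have "isotropic ?L'" using L that by (intro isotropic_extend) auto
    ultimately show False using max[of ?L'] t by simp
  qed
  have rad: "{0, 1, - 1} \<subseteq> L"
  proof
    fix r :: 'f assume r: "r \<in> {0, 1, - 1}"
    have "phi (B s r) = 1" for s
    proof -
      have "B 1 s = s ^ (3 * 3 ^ n) - s" by (simp add: B_def S_def)
      have "phi (B 1 s) = phi (S s - s)" by (simp add: B_def)
      also have "\<dots> = 1" using phi_eq_1_iff_S_diff by blast
      finally show ?thesis using r by (auto simp: B_swap[of s] B_minus_left phi_minus)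
    qed
    then show "r \<in> L" using self by simp
  qed
  have "(\<Sum>s\<in>L. \<Sum>t\<in>UNIV. phi (B s t)) = (\<Sum>s\<in>L. if s \<in> {0, 1, - 1} then of_nat CARD('f) else 0)"
    by (simp only: sum_phi_B)
  also have "\<dots> = (\<Sum>s\<in>{0, 1, - 1 :: 'f}. of_nat CARD('f))"
    using rad by (intro sum.mono_neutral_cong_right) auto
  also have "\<dots> = 3 * of_nat CARD('f)" using one_neq_minus_one by simp
  finally have 1: "(\<Sum>s\<in>L. \<Sum>t\<in>UNIV. phi (B s t)) = of_nat (3 * CARD('f))" by simp
  have "(\<Sum>s\<in>L. \<Sum>t\<in>UNIV. phi (B s t)) = (\<Sum>t\<in>UNIV. \<Sum>s\<in>L. phi (B s t))" by (rule sum.swap)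
  also have "\<dots> = (\<Sum>t\<in>UNIV. if t \<in> L then of_nat (card L) else 0)"
  proof (rule sum.cong[OF refl])
    fix t
    show "(\<Sum>s\<in>L. phi (B s t)) = (if t \<in> L then of_nat (card L) else 0)"
    proof (cases "t \<in> L")
      case True
      then show ?thesis using L by (simp add: isotropic_def)
    next
      case False
      then obtain a where a: "a \<in> L" "phi (B a t) \<noteq> 1" using self by blast
      then have "(\<Sum>s\<in>L. phi (B s t)) = 0"
        using L by (intro sum_additive_character[where a=a]) (auto simp: isotropic_def B_add_left phi_add)
      then show ?thesis using False by simp
    qed
  qed
  also have "\<dots> = of_nat (card L * card L)" by (simp add: sum.If_cases)
  finally have "(of_nat (card L * card L) :: complex) = of_nat (3 * CARD('f))" using 1 by simp
  then have "card L * card L = 3 * CARD('f)" by (simp only: of_nat_eq_iff)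
  also have "\<dots> = (3 * 3 ^ n) * (3 * 3 ^ n)" by (simp add: card_field power_add mult_2)
  finally have "(card L)\<^sup>2 = (3 * 3 ^ n)\<^sup>2" unfolding power2_eq_square .
  then have "card L = 3 * 3 ^ n" by (rule power2_eq_imp_eq) auto
  then show ?thesis using L self rad by blast
qed

end

section \<open>Coordinates on the Sylow normaliser\<close>

text \<open>The primitive cube root of unity \<open>om\<close> is chosen so that the Gauss sum has the sign of the table
  (\<open>gauss_sign\<close>).\<close>

locale ree_char = ree_group G n x h + ree_field "TYPE('f)" n om
  for G :: "('a, 'b) monoid_scheme" (structure) and n
    and x :: "'f::{field, finite} \<Rightarrow> 'f \<Rightarrow> 'f \<Rightarrow> 'a" and h and om +
  assumes gauss_value: "gauss 1 = - 1 + of_nat (3 ^ n) * csqrt (- 3)"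
begin

definition cocycle :: "'f \<Rightarrow> 'f \<Rightarrow> 'f \<Rightarrow> 'f \<Rightarrow> 'f" where
  "cocycle t1 u1 t2 u2 = t2 * u1 - t1 * u2 + t1\<^sup>2 * S t2 + S t1 * t2\<^sup>2"

text \<open>In the new coordinates \<open>u\<close> is additive up to the alternating form \<open>B\<close>, and \<open>v\<close> is additive up to
  \<open>cocycle\<close>, whose part of degree one in the \<open>u\<^sub>i\<close> is antisymmetric and whose other part is symmetric.\<close>

definition p :: "'f \<Rightarrow> 'f \<Rightarrow> 'f \<Rightarrow> 'a" where "p t u v = x t (u + t * S t) (v + t * u)"

definition e :: "'f \<Rightarrow> 'f \<Rightarrow> 'f \<Rightarrow> 'f \<Rightarrow> 'a" where "e t u v w = p t u v \<otimes> h w"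

abbreviation "N \<equiv> ree_N G x"

lemma x_carrier [simp]: "x t u v \<in> carrier G"
  using sylow_P subgroup.mem_carrier[of "ree_P x" G] by (auto simp: sylow_subgroup_def ree_P_def)

lemma h_carrier [simp]: "w \<noteq> 0 \<Longrightarrow> h w \<in> carrier G"
  using subgroup_W subgroup.mem_carrier[of "ree_W h" G] by (auto simp: ree_W_def)

lemma p_carrier [simp]: "p t u v \<in> carrier G" by (simp add: p_def)
lemma e_carrier [simp]: "w \<noteq> 0 \<Longrightarrow> e t u v w \<in> carrier G" by (simp add: e_def)

lemma h_1: "h 1 = \<one>"
  using h_mult[of 1 1] h_carrier[of 1] by (metis l_cancel_one mult_1 one_neq_zero)

lemma p_mult: "p t1 u1 v1 \<otimes> p t2 u2 v2 = p (t1 + t2) (u1 + u2 + B t1 t2) (v1 + v2 + cocycle t1 u1 t2 u2)"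
proof -
  have S1: "t2 ^ (3 * 3 ^ n) = S t2" "t2 ^ (3 * 3 ^ n + 1) = t2 * S t2" by (simp_all add: S_def)
  have u: "u1 + t1 * S t1 + (u2 + t2 * S t2) - t1 * S t2 =
      u1 + u2 + B t1 t2 + (t1 + t2) * S (t1 + t2)"
    by (rule eq_mod_3I[of _ _ "t1 * S t2"]) (simp add: B_def S_add algebra_simps)
  have v: "v1 + t1 * u1 + (v2 + t2 * u2) - t2 * (u1 + t1 * S t1) + t1 * (t2 * S t2) - t1\<^sup>2 * S t2 =
      v1 + v2 + cocycle t1 u1 t2 u2 + (t1 + t2) * (u1 + u2 + B t1 t2)"
    by (rule eq_mod_3I[of _ _ "t2 * u1 + t1\<^sup>2 * S t2"])
      (simp add: B_def cocycle_def algebra_simps power2_eq_square)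
  show ?thesis unfolding p_def x_mult S1 u v ..
qed

lemma p_0: "p 0 0 0 = \<one>"
proof -
  have "p 0 0 0 \<otimes> p 0 0 0 = p 0 0 0" by (simp add: p_mult cocycle_def)
  then show ?thesis using p_carrier by (metis l_cancel_one)
qed

lemma p_inj: "p t u v = p t' u' v' \<longleftrightarrow> t = t' \<and> u = u' \<and> v = v'"
  unfolding p_def using x_inj by fastforce

lemma ree_P_eq: "ree_P x = {p t u v | t u v. True}"
proof -
  have "x t u v = p t (u - t * S t) (v - t * (u - t * S t))" for t u v by (simp add: p_def)
  then show ?thesis unfolding ree_P_def p_def by blast
qed

lemma h_p:
  assumes "w \<noteq> 0" shows "h w \<otimes> p t u v = p (A w * t) (D w * u) (w * v) \<otimes> h w"
proof -
  have "h w \<otimes> p t u v \<otimes> inv (h w) = p (A w * t) (D w * u) (w * v)"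
  proof -
    have "D w * (u + t * S t) = D w * u + A w * t * S (A w * t)"
      using A_S_A[OF assms] by (simp add: S_mult algebra_simps)
    moreover have "w * (v + t * u) = w * v + A w * t * (D w * u)"
      using A_mult_D[OF assms] by (simp add: algebra_simps)
    ultimately show ?thesis
      unfolding p_def h_conj[OF assms] A_def[symmetric] D_def[symmetric] by simp
  qed
  then show ?thesis using assms by (metis inv_solve_right' m_closed h_carrier p_carrier)
qed

definition mul_u where "mul_u t1 u1 w1 t2 u2 = u1 + D w1 * u2 + B t1 (A w1 * t2)"
definition mul_v where "mul_v t1 u1 v1 w1 t2 u2 v2 = v1 + w1 * v2 + cocycle t1 u1 (A w1 * t2) (D w1 * u2)"

lemma e_mult:
  assumes "w1 \<noteq> 0" "w2 \<noteq> 0"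
  shows "e t1 u1 v1 w1 \<otimes> e t2 u2 v2 w2 =
    e (t1 + A w1 * t2) (mul_u t1 u1 w1 t2 u2) (mul_v t1 u1 v1 w1 t2 u2 v2) (w1 * w2)"
proof -
  have "e t1 u1 v1 w1 \<otimes> e t2 u2 v2 w2 = p t1 u1 v1 \<otimes> (h w1 \<otimes> p t2 u2 v2) \<otimes> h w2"
    using assms by (simp add: e_def m_assoc)
  also have "\<dots> = (p t1 u1 v1 \<otimes> p (A w1 * t2) (D w1 * u2) (w1 * v2)) \<otimes> (h w1 \<otimes> h w2)"
    using assms by (simp add: h_p m_assoc)
  finally show ?thesis using assms by (simp add: p_mult h_mult e_def mul_u_def mul_v_def)
qed

lemma e_inj:
  assumes "w \<noteq> 0" "w' \<noteq> 0"
  shows "e t u v w = e t' u' v' w' \<longleftrightarrow> t = t' \<and> u = u' \<and> v = v' \<and> w = w'"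
proof
  assume eq: "e t u v w = e t' u' v' w'"
  have P: "subgroup (ree_P x) G" using sylow_P by (simp add: sylow_subgroup_def)
  have "inv (p t' u' v') \<otimes> p t u v = h w' \<otimes> inv (h w)"
  proof -
    have "inv (p t' u' v') \<otimes> (p t u v \<otimes> h w) = inv (p t' u' v') \<otimes> (p t' u' v' \<otimes> h w')"
      using eq by (simp add: e_def)
    then have "inv (p t' u' v') \<otimes> p t u v \<otimes> h w = h w'"
      using assms by (simp add: m_assoc[symmetric])
    then show ?thesis using assms by (metis inv_solve_right h_carrier inv_closed m_closed p_carrier)
  qed
  moreover have "inv (p t' u' v') \<otimes> p t u v \<in> ree_P x"
    using P by (intro subgroup.m_closed subgroup.m_inv_closed) (auto simp: ree_P_eq)
  moreover have "h w' \<otimes> inv (h w) \<in> ree_W h"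
    using subgroup_W assms by (intro subgroup.m_closed subgroup.m_inv_closed) (auto simp: ree_W_def)
  ultimately have "inv (p t' u' v') \<otimes> p t u v = \<one>" "h w' \<otimes> inv (h w) = \<one>"
    using P_W_disjoint by auto
  then have "p t u v = p t' u' v'" "h w' = h w"
    using assms by (metis inv_equality inv_inv inv_closed p_carrier, metis inv_equality inv_inv inv_closed h_carrier)
  then show "t = t' \<and> u = u' \<and> v = v' \<and> w = w'"
    using p_inj h_inj assms by (auto simp: inj_on_def)
qed auto

lemma carrier_N: "carrier N = {e t u v w | t u v w. w \<noteq> 0}"
proof -
  have "carrier N = ree_P x <#> ree_W h" by (simp add: ree_N_def normalizer_P)
  then show ?thesis unfolding ree_P_eq ree_W_def set_mult_def e_def by blast
qed

lemma e_N [simp]: "w \<noteq> 0 \<Longrightarrow> e t u v w \<in> carrier N" by (auto simp: carrier_N)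

lemma e_one: "e 0 0 0 1 = \<one>" by (simp add: e_def p_0 h_1)

lemma N_simps [simp]: "(\<otimes>\<^bsub>N\<^esub>) = (\<otimes>)" "\<one>\<^bsub>N\<^esub> = \<one>" by (simp_all add: ree_N_def)

lemma e_inverse: "w \<noteq> 0 \<Longrightarrow> \<exists>t' u' v' w'. w' \<noteq> 0 \<and> e t' u' v' w' \<otimes> e t u v w = \<one>"
proof -
  assume w: "w \<noteq> 0"
  let ?w = "1 / w"
  let ?t = "- (A ?w * t)"
  let ?u = "- (D ?w * u)"
  let ?v = "- (?w * v + cocycle ?t ?u (A ?w * t) (D ?w * u))"
  have "e ?t ?u ?v ?w \<otimes> e t u v w = e 0 0 0 1"
    using w by (simp add: e_mult mul_u_def mul_v_def B_minus_left)
  then show ?thesis using w unfolding e_one by (intro exI[of _ ?t] exI[of _ ?u] exI[of _ ?v] exI[of _ ?w]) auto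
qed

lemma subgroup_N: "subgroup (carrier N) G"
proof (rule subgroupI)
  show "carrier N \<subseteq> carrier G" by (auto simp: carrier_N)
  show "carrier N \<noteq> {}" by (auto simp: carrier_N intro: exI[of _ 1])
  fix a assume "a \<in> carrier N"
  then obtain t u v w where a: "w \<noteq> 0" "a = e t u v w" by (auto simp: carrier_N)
  obtain t' u' v' w' where "w' \<noteq> 0" "e t' u' v' w' \<otimes> a = \<one>" using e_inverse a by blast
  then show "inv a \<in> carrier N" using a by (metis e_N e_carrier inv_equality)
next
  fix a b assume "a \<in> carrier N" "b \<in> carrier N"
  then show "a \<otimes> b \<in> carrier N" by (auto simp: carrier_N) (metis e_mult mult_eq_0_iff)
qed

lemma group_N: "group N"
  using subgroup.subgroup_is_group[OF subgroup_N is_group] by (simp add: ree_N_def)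

lemma inv_N [simp]: "a \<in> carrier N \<Longrightarrow> inv\<^bsub>N\<^esub> a = inv a"
  using m_inv_consistent[OF subgroup_N] by (simp add: ree_N_def)

lemma carrier_N_image:
  "carrier N = (\<lambda>(t, u, v, w). e t u v w) ` (UNIV \<times> UNIV \<times> UNIV \<times> (UNIV - {0}))"
  unfolding carrier_N by (fastforce simp: image_iff)

lemma sum_N: "(\<Sum>y\<in>carrier N. f y) = (\<Sum>t\<in>UNIV. \<Sum>u\<in>UNIV. \<Sum>v\<in>UNIV. \<Sum>w\<in>UNIV - {0}. f (e t u v w))"
proof -
  have "(\<Sum>t\<in>UNIV. \<Sum>u\<in>UNIV. \<Sum>v\<in>UNIV. \<Sum>w\<in>UNIV - {0}. f (e t u v w)) =
      (\<Sum>(t, u, v, w)\<in>UNIV \<times> UNIV \<times> UNIV \<times> (UNIV - {0}). f (e t u v w))"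
    by (simp add: sum.cartesian_product)
  also have "\<dots> = (\<Sum>y\<in>carrier N. f y)"
    unfolding carrier_N_image by (subst sum.reindex) (auto simp: inj_on_def e_inj case_prod_unfold)
  finally show ?thesis ..
qed

lemma finite_N: "finite (carrier N)" unfolding carrier_N_image by simp

text \<open>Coordinates of a conjugate \<open>y g y\<^sup>-\<^sup>1\<close>, obtained from the equation \<open>y g = g' y\<close>.\<close>

definition conj_t where "conj_t t w s k = (1 - A k) * t + A w * s"
definition conj_u where "conj_u t u w s r k =
  (1 - D k) * u + D w * r + B t (A w * s) - B (conj_t t w s k) (A k * t)"
definition conj_v where "conj_v t u v w s r z k =
  (1 - k) * v + w * z + cocycle t u (A w * s) (D w * r) - cocycle (conj_t t w s k) (conj_u t u w s r k) (A k * t) (D k * u)"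

lemma e_conj:
  assumes "w \<noteq> 0" "k \<noteq> 0"
  shows "e t u v w \<otimes> e s r z k \<otimes> inv (e t u v w) =
    e (conj_t t w s k) (conj_u t u w s r k) (conj_v t u v w s r z k) k"
proof -
  have "e t u v w \<otimes> e s r z k = e (conj_t t w s k) (conj_u t u w s r k) (conj_v t u v w s r z k) k \<otimes> e t u v w"
    using assms by (simp add: e_mult mul_u_def mul_v_def conj_t_def conj_u_def conj_v_def algebra_simps)
  then show ?thesis using assms by (simp add: inv_solve_right')
qed

lemma conj_coords_P [simp]: "conj_t t w s 1 = A w * s" "conj_u t u w s r 1 = D w * r - B t (A w * s)"
  "conj_v t u v w 0 r z 1 = w * z + t * (D w * r)"
proof -
  show "conj_t t w s 1 = A w * s" by (simp add: conj_t_def)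
  note 3 = double_eq_minus
  show "conj_u t u w s r 1 = D w * r - B t (A w * s)"
    using 3[of "B t (A w * s)"] by (simp add: conj_u_def conj_t_def B_swap[of "A w * s"])
  show "conj_v t u v w 0 r z 1 = w * z + t * (D w * r)"
    using 3[of "t * (D w * r)"] by (simp add: conj_v_def cocycle_def conj_u_def conj_t_def algebra_simps)
qed

lemma conj_coords_J [simp]: "conj_t t w s (- 1) = A w * s - t" "conj_u t u w s r (- 1) = D w * r"
proof -
  note 3 = double_eq_minus
  show *: "conj_t t w s (- 1) = A w * s - t" using 3[of t] by (simp add: conj_t_def algebra_simps)
  show "conj_u t u w s r (- 1) = D w * r"
    unfolding conj_u_def * by (simp add: B_diff_left B_minus_right B_swap[of "A w * s"])
qed

end

section \<open>The induced characters\<close>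

context ree_char
begin

abbreviation nz :: "'f set" where "nz \<equiv> UNIV - {0}"

definition Q :: complex where "Q = 3 ^ (2 * n + 1)"
abbreviation M :: complex where "M \<equiv> 3 ^ n"

lemma of_nat_card_field [simp]: "of_nat CARD('f) = Q" by (simp add: Q_def card_field)

lemma Q_nz: "Q \<noteq> 0" "Q = 3 * M * M" by (simp_all add: Q_def power_add mult_2)

lemma of_nat_card_nz [simp]: "of_nat (card nz) = Q - 1"
  by (simp add: card_nz of_nat_diff Q_def)

lemma Q_neq_1: "Q \<noteq> 1"
proof
  have "1 \<in> nz" by simp
  then have "of_nat (card nz) \<noteq> (0 :: complex)" by (metis card_eq_0_iff empty_iff finite of_nat_eq_0_iff)
  moreover assume "Q = 1"
  ultimately show False by (simp only: of_nat_card_nz) simp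
qed

definition by_coords :: "('f \<Rightarrow> 'f \<Rightarrow> 'f \<Rightarrow> 'f \<Rightarrow> complex) \<Rightarrow> 'a \<Rightarrow> complex" where
  "by_coords l y = (THE c. \<exists>t u v w. w \<noteq> 0 \<and> y = e t u v w \<and> c = l t u v w)"

lemma by_coords_e [simp]: "w \<noteq> 0 \<Longrightarrow> by_coords l (e t u v w) = l t u v w"
  unfolding by_coords_def by (rule the_equality) (auto simp: e_inj)

text \<open>The subgroups from which characters are induced are all given by a condition on the coordinates
  \<open>t\<close> and \<open>w\<close>.\<close>

definition tw_set :: "('f \<Rightarrow> 'f \<Rightarrow> bool) \<Rightarrow> 'a set" where
  "tw_set R = {e t u v w | t u v w. w \<noteq> 0 \<and> R t w}"

definition mono_char where "mono_char R l = ind_char N (tw_set R) (by_coords l)"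

lemma e_tw_set [simp]: "w \<noteq> 0 \<Longrightarrow> e t u v w \<in> tw_set R \<longleftrightarrow> R t w"
  by (auto simp: tw_set_def e_inj)

lemma card_tw_set: "card (tw_set R) = CARD('f) * CARD('f) * card {(t, w). w \<noteq> 0 \<and> R t w}"
proof -
  have "tw_set R = (\<lambda>(u, v, t, w). e t u v w) ` (UNIV \<times> UNIV \<times> {(t, w). w \<noteq> 0 \<and> R t w})"
    unfolding tw_set_def by (fastforce simp: image_iff)
  moreover have "inj_on (\<lambda>(u, v, t, w). e t u v w) (UNIV \<times> UNIV \<times> {(t, w). w \<noteq> 0 \<and> R t w})"
    by (auto simp: inj_on_def e_inj)
  ultimately show ?thesis by (simp add: card_image card_cartesian_product)
qed

lemma mono_char_value:
  assumes "k \<noteq> 0"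
  shows "mono_char R l (e s r z k) =
    (\<Sum>t\<in>UNIV. \<Sum>u\<in>UNIV. \<Sum>v\<in>UNIV. \<Sum>w\<in>nz.
       if R (conj_t t w s k) k then l (conj_t t w s k) (conj_u t u w s r k) (conj_v t u v w s r z k) k else 0)
     / of_nat (card (tw_set R))"
  (is "_ = ?rhs")
proof -
  have "mono_char R l (e s r z k) =
    (\<Sum>t\<in>UNIV. \<Sum>u\<in>UNIV. \<Sum>v\<in>UNIV. \<Sum>w\<in>nz.
       if e t u v w \<otimes> e s r z k \<otimes> inv (e t u v w) \<in> tw_set R
       then by_coords l (e t u v w \<otimes> e s r z k \<otimes> inv (e t u v w)) else 0) / of_nat (card (tw_set R))"
    using assms unfolding mono_char_def ind_char_def by (simp add: sum_N cong: if_cong)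
  also have "\<dots> = ?rhs"
    using assms by (intro arg_cong2[where f="(/)"] sum.cong refl) (simp add: e_conj)
  finally show ?thesis .
qed

lemma mono_char_irreducible:
  assumes one: "R 0 1"
    and mult: "\<And>t1 t2 w1 w2. w1 \<noteq> 0 \<Longrightarrow> w2 \<noteq> 0 \<Longrightarrow> R t1 w1 \<Longrightarrow> R t2 w2 \<Longrightarrow> R (t1 + A w1 * t2) (w1 * w2)"
    and l_mult: "\<And>t1 t2 u1 u2 v1 v2 w1 w2. w1 \<noteq> 0 \<Longrightarrow> w2 \<noteq> 0 \<Longrightarrow> R t1 w1 \<Longrightarrow> R t2 w2 \<Longrightarrow>
      l (t1 + A w1 * t2) (mul_u t1 u1 w1 t2 u2) (mul_v t1 u1 v1 w1 t2 u2 v2) (w1 * w2) =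
      l t1 u1 v1 w1 * l t2 u2 v2 w2"
    and l_nz: "\<And>t u v w. w \<noteq> 0 \<Longrightarrow> R t w \<Longrightarrow> l t u v w \<noteq> 0"
    and mackey: "\<And>t u v w. w \<noteq> 0 \<Longrightarrow> \<not> R t w \<Longrightarrow>
      \<exists>s r z k. k \<noteq> 0 \<and> R s k \<and> R (conj_t t w s k) k \<and>
        l (conj_t t w s k) (conj_u t u w s r k) (conj_v t u v w s r z k) k \<noteq> l s r z k"
  shows "mono_char R l \<in> irr_characters N"
  unfolding mono_char_def
proof (rule ind_char_irreducible[OF group_N finite_N])
  interpret N: group N by (rule group_N)
  have sub: "tw_set R \<subseteq> carrier N" by (auto simp: tw_set_def)
  have closed: "a \<otimes> b \<in> tw_set R" if "a \<in> tw_set R" "b \<in> tw_set R" for a b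
    using that mult unfolding tw_set_def by (auto simp: e_mult) (metis no_zero_divisors)
  have one_in: "\<one> \<in> tw_set R" using one e_tw_set[of 1 0 0 0 R] by (simp add: e_one)
  show "subgroup (tw_set R) N"
  proof (rule N.subgroupI[OF sub])
    show "tw_set R \<noteq> {}" using one_in by auto
    fix a assume a: "a \<in> tw_set R"
    \<comment> \<open>left multiplication by \<open>a\<close> permutes the finite set, hence hits the identity\<close>
    have aN: "a \<in> carrier N" using a sub by auto
    have "inj_on (\<lambda>b. a \<otimes> b) (tw_set R)"
      using N.inj_on_cmult[OF aN] sub by (simp add: inj_on_subset)
    then have "(\<lambda>b. a \<otimes> b) ` tw_set R = tw_set R"
      using closed a finite_subset[OF sub finite_N] by (intro endo_inj_surj) auto
    then obtain b where b: "b \<in> tw_set R" "a \<otimes> b = \<one>" using one_in by (metis imageE)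
    then have "b = inv\<^bsub>N\<^esub> a" using aN sub N.inv_equality[of b a] N.inv_comm[of a b] by auto
    then show "inv\<^bsub>N\<^esub> a \<in> tw_set R" using b by simp
  qed (use closed in auto)
  show "by_coords l (a \<otimes>\<^bsub>N\<^esub> b) = by_coords l a * by_coords l b" if "a \<in> tw_set R" "b \<in> tw_set R" for a b
    using that l_mult by (auto simp: tw_set_def e_mult)
  show "by_coords l a \<noteq> 0" if "a \<in> tw_set R" for a using that l_nz by (auto simp: tw_set_def)
  show "\<exists>a\<in>tw_set R. y \<otimes>\<^bsub>N\<^esub> a \<otimes>\<^bsub>N\<^esub> inv\<^bsub>N\<^esub> y \<in> tw_set R \<and> by_coords l (y \<otimes>\<^bsub>N\<^esub> a \<otimes>\<^bsub>N\<^esub> inv\<^bsub>N\<^esub> y) \<noteq> by_coords l a"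
    if y: "y \<in> carrier N" "y \<notin> tw_set R" for y
  proof -
    obtain t u v w where w: "w \<noteq> 0" "y = e t u v w" using y by (auto simp: carrier_N)
    then have "\<not> R t w" using y by simp
    then obtain s r z k where k: "k \<noteq> 0" "R s k" "R (conj_t t w s k) k"
      "l (conj_t t w s k) (conj_u t u w s r k) (conj_v t u v w s r z k) k \<noteq> l s r z k"
      using mackey[OF w(1), of t u v] by blast
    show ?thesis
      by (rule bexI[of _ "e s r z k"]) (use k w in \<open>simp_all add: e_conj\<close>)
  qed
qed

subsection \<open>Linear characters\<close>

lemma linear_mono_char:
  assumes "\<And>w w'. w \<noteq> 0 \<Longrightarrow> w' \<noteq> 0 \<Longrightarrow> \<kappa> (w * w') = \<kappa> w * \<kappa> w'" "\<And>w. w \<noteq> 0 \<Longrightarrow> \<kappa> w \<noteq> 0"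
  shows "mono_char (\<lambda>_ _. True) (\<lambda>t u v w. \<kappa> w) \<in> irr_characters N"
    and "k \<noteq> 0 \<Longrightarrow> mono_char (\<lambda>_ _. True) (\<lambda>t u v w. \<kappa> w) (e s r z k) = \<kappa> k"
proof -
  show "mono_char (\<lambda>_ _. True) (\<lambda>t u v w. \<kappa> w) \<in> irr_characters N"
    by (rule mono_char_irreducible) (use assms in auto)
  assume k: "k \<noteq> 0"
  have "{(t, w). w \<noteq> (0 :: 'f)} = (UNIV :: 'f set) \<times> nz" by auto
  then have "card {(t :: 'f, w). w \<noteq> (0 :: 'f)} = CARD('f) * card nz" by (simp add: card_cartesian_product)
  then show "mono_char (\<lambda>_ _. True) (\<lambda>t u v w. \<kappa> w) (e s r z k) = \<kappa> k"
    using k Q_nz(1) Q_neq_1 by (simp add: mono_char_value card_tw_set del: card_Diff_insert)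
qed

subsection \<open>The character of degree \<open>q - 1\<close>\<close>

lemma sum_phi_A:
  "(\<Sum>w\<in>nz. phi (A w * s)) = (if s = 0 then Q - 1 else - 1)"
proof (cases "s = 0")
  case False
  define g where "g y = (y / s) * (y / s) * S (y / s)" for y
  have "y \<noteq> 0 \<Longrightarrow> A (g y) = y / s" for y using False A_inv[of "y / s"] by (simp only: g_def divide_eq_0_iff simp_thms)
  moreover have "w \<noteq> 0 \<Longrightarrow> g (A w * s) = w" for w using False by (simp add: g_def A_A_S_A)
  moreover have "y \<noteq> 0 \<Longrightarrow> g y \<noteq> 0" for y using False by (simp add: g_def)
  ultimately have "(\<Sum>w\<in>nz. phi (A w * s)) = (\<Sum>y\<in>nz. phi y)"
    by (intro sum.reindex_bij_witness[where j="\<lambda>w. A w * s" and i=g]) (use False in auto)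
  then show ?thesis using False sum_nz_phi by simp
qed simp

definition Lam where "Lam = mono_char (\<lambda>t w. w = 1) (\<lambda>t u v w. phi t)"

text \<open>An element with \<open>w \<noteq> 1\<close> multiplies the coordinate \<open>t\<close> by \<open>A w \<noteq> 1\<close>.\<close>

lemma Lam_irr: "Lam \<in> irr_characters N"
  unfolding Lam_def
proof (rule mono_char_irreducible)
  fix t u v w :: 'f assume w: "w \<noteq> 0" "w \<noteq> 1"
  then have "A w - 1 \<noteq> 0" using A_eq_1 by simp
  then obtain s where s: "phi ((A w - 1) * s) \<noteq> 1" using phi_nontrivial by blast
  have "phi (A w * s) \<noteq> phi s"
  proof
    assume "phi (A w * s) = phi s"
    then have "phi (s + (A w - 1) * s) = phi s" by (simp add: algebra_simps)
    then show False using s by (simp add: phi_add)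
  qed
  then show "\<exists>s r z k. k \<noteq> 0 \<and> k = 1 \<and> k = 1 \<and> phi (conj_t t w s k) \<noteq> phi s"
    by (intro exI[of _ s] exI[of _ 1]) auto
qed (auto simp: phi_add)

lemma Lam_value:
  assumes "k \<noteq> 0"
  shows "Lam (e s r z k) = (if k = 1 then if s = 0 then Q - 1 else - 1 else 0)"
proof -
  have "{(t, w). w \<noteq> 0 \<and> w = 1} = (UNIV :: 'f set) \<times> {1 :: 'f}" by auto
  then have "card (tw_set (\<lambda>t w. w = 1)) = CARD('f) * CARD('f) * CARD('f)"
    by (simp add: card_tw_set card_cartesian_product)
  then show ?thesis using assms Q_nz(1)
    by (auto simp: Lam_def mono_char_value sum_phi_A)
qed

subsection \<open>The character of degree \<open>q (q - 1)\<close>\<close>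

definition Psi where "Psi = mono_char (\<lambda>t w. t = 0 \<and> w = 1) (\<lambda>t u v w. phi v)"

text \<open>An element with \<open>w \<noteq> 1\<close> multiplies the central coordinate \<open>v\<close> by \<open>w\<close>, and one with \<open>w = 1\<close>,
  \<open>t \<noteq> 0\<close> adds \<open>t u\<close> to it.\<close>

lemma Psi_irr: "Psi \<in> irr_characters N"
  unfolding Psi_def
proof (rule mono_char_irreducible)
  fix t u v w :: 'f assume w: "w \<noteq> 0" "\<not> (t = 0 \<and> w = 1)"
  have "\<exists>r z. phi (w * z + t * (D w * r)) \<noteq> phi z"
  proof (cases "w = 1")
    case False
    then have "w - 1 \<noteq> 0" by simp
    then obtain z where z: "phi ((w - 1) * z) \<noteq> 1" using phi_nontrivial by blast
    have "phi (w * z) = phi (z + (w - 1) * z)" by (simp add: algebra_simps)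
    then have "phi (w * z + t * (D w * 0)) \<noteq> phi z" using z by (simp add: phi_add)
    then show ?thesis by blast
  next
    case True
    then obtain r where "phi (t * r) \<noteq> 1" using phi_nontrivial w by blast
    then have "phi (w * 0 + t * (D w * r)) \<noteq> phi 0" using True by simp
    then show ?thesis by blast
  qed
  then obtain r z where "phi (w * z + t * (D w * r)) \<noteq> phi z" by blast
  then show "\<exists>s r z k. k \<noteq> 0 \<and> (s = 0 \<and> k = 1) \<and> (conj_t t w s k = 0 \<and> k = 1) \<and>
      phi (conj_v t u v w s r z k) \<noteq> phi z"
    by (intro exI[of _ 0] exI[of _ r] exI[of _ z] exI[of _ 1]) auto
qed (auto simp: phi_add mul_v_def cocycle_def)

lemma Psi_value:
  assumes "k \<noteq> 0"
  shows "Psi (e s r z k) =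
    (if k = 1 \<and> s = 0 \<and> r = 0 then if z = 0 then Q * (Q - 1) else - Q else 0)"
proof -
  have "{(t, w). w \<noteq> 0 \<and> t = 0 \<and> w = 1} = {(0 :: 'f, 1 :: 'f)}" by auto
  then have card: "card (tw_set (\<lambda>t w. t = 0 \<and> w = 1)) = CARD('f) * CARD('f)"
    by (simp add: card_tw_set)
  show ?thesis
  proof (cases "k = 1 \<and> s = 0")
    case False
    then have "\<not> (conj_t t w s k = 0 \<and> k = 1)" if "w \<in> nz" for t w
      using that by (cases "k = 1") auto
    then have "(\<Sum>t\<in>UNIV. \<Sum>u\<in>(UNIV :: 'f set). \<Sum>v\<in>(UNIV :: 'f set). \<Sum>w\<in>nz.
        if conj_t t w s k = 0 \<and> k = 1 then phi (conj_v t u v w s r z k) else 0) = 0"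
      by (intro sum.neutral ballI if_not_P)
    then show ?thesis using assms False by (auto simp: Psi_def mono_char_value)
  next
    case True
    have "Psi (e s r z k) = (\<Sum>t\<in>UNIV. Q * (Q * (\<Sum>w\<in>nz. phi (w * z) * phi (t * (D w * r))))) / (Q * Q)"
      using True by (simp add: Psi_def mono_char_value card phi_add)
    also have "\<dots> = (\<Sum>t\<in>UNIV. \<Sum>w\<in>nz. phi (w * z) * phi (t * (D w * r)))"
      using Q_nz(1) by (simp add: sum_distrib_left[symmetric])
    also have "\<dots> = (\<Sum>w\<in>nz. phi (w * z) * (\<Sum>t\<in>UNIV. phi ((D w * r) * t)))"
      by (subst sum.swap) (simp add: sum_distrib_left mult_ac)
    also have "\<dots> = (\<Sum>w\<in>nz. phi (w * z) * (if r = 0 then Q else 0))"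
      by (intro sum.cong refl arg_cong2[where f="(*)"]) (auto simp: sum_phi)
    also have "\<dots> = (if r = 0 then Q * (\<Sum>w\<in>nz. phi (w * z)) else 0)"
      by (simp add: sum_distrib_left mult_ac)
    also have "(\<Sum>w\<in>nz. phi (w * z)) = (\<Sum>w\<in>UNIV. phi (z * w)) - 1"
      by (simp add: sum_diff1 mult.commute)
    finally show ?thesis using True by (auto simp: sum_phi)
  qed
qed

subsection \<open>The characters induced from a Lagrangian subgroup\<close>

definition Lag :: "'f set" where
  "Lag = (SOME L. isotropic L \<and> (\<forall>t. (\<forall>s\<in>L. phi (B s t) = 1) \<longrightarrow> t \<in> L) \<and>
     card L = 3 * 3 ^ n \<and> {0, 1, - 1} \<subseteq> L)"

lemma Lag: "isotropic Lag" "(\<And>s. s \<in> Lag \<Longrightarrow> phi (B s t) = 1) \<Longrightarrow> t \<in> Lag"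
  "card Lag = 3 * 3 ^ n" "{0, 1, - 1} \<subseteq> Lag"
proof -
  have *: "isotropic Lag \<and> (\<forall>t. (\<forall>s\<in>Lag. phi (B s t) = 1) \<longrightarrow> t \<in> Lag) \<and>
     card Lag = 3 * 3 ^ n \<and> {0, 1, - 1} \<subseteq> Lag"
    unfolding Lag_def by (rule someI_ex) (rule Lagrangian_exists)
  show "isotropic Lag" "card Lag = 3 * 3 ^ n" "{0, 1, - 1} \<subseteq> Lag" using * by simp_all
  show "(\<And>s. s \<in> Lag \<Longrightarrow> phi (B s t) = 1) \<Longrightarrow> t \<in> Lag" using * by blast
qed

lemma Lag_simps [simp]: "0 \<in> Lag" "1 \<in> Lag" "- 1 \<in> Lag"
  "s \<in> Lag \<Longrightarrow> - s \<in> Lag" "s \<in> Lag \<Longrightarrow> t \<in> Lag \<Longrightarrow> s + t \<in> Lag" "s \<in> Lag \<Longrightarrow> t \<in> Lag \<Longrightarrow> phi (B s t) = 1"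
  using Lag(1,4) by (auto simp: isotropic_def)

lemma Lag_diff [simp]: "s \<in> Lag \<Longrightarrow> t \<in> Lag \<Longrightarrow> s - t \<in> Lag"
  using Lag_simps(5)[of s "- t"] by simp

text \<open>The sign \<open>\<eta>\<close> is the value at \<open>h (- 1)\<close> of the linear character that extends \<open>phi u\<close>.\<close>

definition Mu where "Mu \<eta> = mono_char (\<lambda>t w. t \<in> Lag \<and> (w = 1 \<or> w = - 1)) (\<lambda>t u v w. (if w = 1 then 1 else \<eta>) * phi u)"

definition c0 :: 'f where "c0 = (SOME a. phi a = om)"

lemma phi_c0: "phi c0 = om" unfolding c0_def by (rule someI_ex) (rule phi_om)

definition Chi where "Chi = mono_char (\<lambda>t w. t \<in> Lag \<and> w = 1) (\<lambda>t u v w. phi (u + c0 * t))"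

lemma phi_D_neq:
  assumes "w \<noteq> 0" "w \<noteq> 1" "w \<noteq> - 1" shows "\<exists>r. phi (D w * r) \<noteq> phi r"
proof -
  have "D w - 1 \<noteq> 0" using assms D_eq_1 by auto
  then obtain r where r: "phi ((D w - 1) * r) \<noteq> 1" using phi_nontrivial by blast
  have "phi (D w * r) = phi (r + (D w - 1) * r)" by (simp add: algebra_simps)
  then show ?thesis using r by (auto simp: phi_add intro!: exI[of _ r])
qed

text \<open>An element with \<open>w \<noteq> \<plusminus>1\<close> multiplies \<open>u\<close> by \<open>D w \<noteq> 1\<close>. For \<open>w = \<plusminus>1\<close> and \<open>t\<close> outside \<open>Lag\<close>,
  self-orthogonality gives an \<open>s\<close> in \<open>Lag\<close> with \<open>phi (B s t) \<noteq> 1\<close>.\<close>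

lemma Mu_irr:
  assumes "\<eta> = 1 \<or> \<eta> = - 1" shows "Mu \<eta> \<in> irr_characters N"
  unfolding Mu_def
proof (rule mono_char_irreducible)
  show "(if w1 * w2 = 1 then 1 else \<eta>) * phi (mul_u t1 u1 w1 t2 u2) =
      (if w1 = 1 then 1 else \<eta>) * phi u1 * ((if w2 = 1 then 1 else \<eta>) * phi u2)"
    if "t1 \<in> Lag \<and> (w1 = 1 \<or> w1 = - 1)" "t2 \<in> Lag \<and> (w2 = 1 \<or> w2 = - 1)" for t1 t2 u1 u2 w1 w2
    using that assms one_neq_minus_one
    by (auto simp: mul_u_def phi_add phi_diff B_minus_right phi_minus)
next
  fix t u v w :: 'f assume w: "w \<noteq> 0" and not: "\<not> (t \<in> Lag \<and> (w = 1 \<or> w = - 1))"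
  show "\<exists>s r z k. k \<noteq> 0 \<and> (s \<in> Lag \<and> (k = 1 \<or> k = - 1)) \<and> (conj_t t w s k \<in> Lag \<and> (k = 1 \<or> k = - 1)) \<and>
      (if k = 1 then 1 else \<eta>) * phi (conj_u t u w s r k) \<noteq> (if k = 1 then 1 else \<eta>) * phi r"
  proof (cases "w = 1 \<or> w = - 1")
    case True
    then obtain s where s: "s \<in> Lag" "phi (B s t) \<noteq> 1" using Lag(2) not by blast
    have "phi (B t s) \<noteq> 1" using s by (simp add: B_swap[of t] phi_minus)
    then show ?thesis using True s
      by (intro exI[of _ s] exI[of _ 0] exI[of _ 1]) (auto simp: B_minus_right phi_minus)
  next
    case False
    then obtain r where "phi (D w * r) \<noteq> phi r" using phi_D_neq w by blast
    then show ?thesis by (intro exI[of _ 0] exI[of _ r] exI[of _ 1]) auto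
  qed
qed (use assms in auto)

lemma Chi_irr: "Chi \<in> irr_characters N"
  unfolding Chi_def
proof (rule mono_char_irreducible)
  show "phi (mul_u t1 u1 w1 t2 u2 + c0 * (t1 + A w1 * t2)) = phi (u1 + c0 * t1) * phi (u2 + c0 * t2)"
    if "t1 \<in> Lag \<and> w1 = 1" "t2 \<in> Lag \<and> w2 = 1" for t1 t2 u1 u2 w1 w2
    using that by (simp add: mul_u_def phi_add distrib_left)
next
  fix t u v w :: 'f assume w: "w \<noteq> 0" and not: "\<not> (t \<in> Lag \<and> w = 1)"
  show "\<exists>s r z k. k \<noteq> 0 \<and> (s \<in> Lag \<and> k = 1) \<and> (conj_t t w s k \<in> Lag \<and> k = 1) \<and>
      phi (conj_u t u w s r k + c0 * conj_t t w s k) \<noteq> phi (r + c0 * s)"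
  proof -
    consider "w = 1" | "w = - 1" | "w \<noteq> 1" "w \<noteq> - 1" by blast
    then show ?thesis
    proof cases
      case 1
      then obtain s where s: "s \<in> Lag" "phi (B s t) \<noteq> 1" using Lag(2) not by blast
      then show ?thesis using 1
        by (intro exI[of _ s] exI[of _ 0] exI[of _ 1]) (auto simp: phi_add B_swap[of t])
    next
      \<comment> \<open>conjugation by \<open>h (- 1)\<close> inverts the radical, on which the linear character is non-trivial\<close>
      case 2
      have "phi (B t 1) = 1"
      proof -
        have "phi (B 1 t) = 1" unfolding B_def using phi_eq_1_iff_S_diff by auto
        then show ?thesis by (simp add: B_swap[of t] phi_minus)
      qed
      then show ?thesis using 2 one_neq_minus_one om_neq
        by (intro exI[of _ 1] exI[of _ 0] exI[of _ 1])
          (auto simp: phi_add B_minus_right phi_minus phi_c0)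
    next
      case 3
      then obtain r where "phi (D w * r) \<noteq> phi r" using phi_D_neq w by blast
      then show ?thesis by (intro exI[of _ 0] exI[of _ r] exI[of _ 1]) auto
    qed
  qed
qed auto

text \<open>The sum over \<open>t\<close> annihilates every term in which \<open>A w * s\<close> is not in the radical of \<open>phi \<circ> B\<close>.\<close>

lemma sum_Lag:
  "(\<Sum>t\<in>UNIV. \<Sum>u\<in>(UNIV :: 'f set). \<Sum>v\<in>(UNIV :: 'f set). \<Sum>w\<in>nz. if A w * s \<in> Lag
      then f (A w * s) * phi (D w * r - B t (A w * s)) else 0) =
    Q * Q * Q * (\<Sum>w\<in>nz. if A w * s \<in> {0, 1, - 1} then f (A w * s) * phi (D w * r) else 0)"
proof -
  let ?g = "\<lambda>t w. if A w * s \<in> Lag then f (A w * s) * phi (D w * r - B t (A w * s)) else 0"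
  let ?k = "\<lambda>w. if A w * s \<in> {0, 1, - 1} then f (A w * s) * phi (D w * r) else 0"
  have "(\<Sum>t\<in>UNIV. \<Sum>u\<in>(UNIV :: 'f set). \<Sum>v\<in>(UNIV :: 'f set). \<Sum>w\<in>nz. ?g t w) =
      Q * Q * (\<Sum>t\<in>UNIV. \<Sum>w\<in>nz. ?g t w)"
    by (simp add: sum_distrib_left mult_ac)
  also have "\<dots> = Q * Q * (\<Sum>w\<in>nz. \<Sum>t\<in>UNIV. ?g t w)"
    by (subst sum.swap) simp
  also have "\<dots> = Q * Q * (\<Sum>w\<in>nz. Q * (?k w))"
  proof (intro arg_cong2[where f="(*)"] refl sum.cong)
    fix w
    have "phi (D w * r - B t (A w * s)) = phi (D w * r) * phi (B (A w * s) t)" for t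
      by (simp add: B_swap[of t] phi_add)
    then have "(\<Sum>t\<in>UNIV. ?g t w) =
        (if A w * s \<in> Lag then f (A w * s) * phi (D w * r) * (\<Sum>t\<in>UNIV. phi (B (A w * s) t)) else 0)"
      by (simp add: sum_distrib_left mult_ac)
    also have "\<dots> = Q * (?k w)"
      unfolding sum_phi_B using Lag(4) by (auto simp: mult_ac)
    finally show "(\<Sum>t\<in>UNIV. ?g t w) =
      Q * (?k w)" .
  qed
  finally show ?thesis by (simp add: sum_distrib_left mult_ac)
qed

text \<open>Exactly two elements \<open>w\<close>, which differ in sign and so have the same \<open>D w\<close>, move \<open>s\<close> into the prime
  field, one to \<open>1\<close> and the other to \<open>- 1\<close>.\<close>

lemma sum_A_in_F3:
  assumes "s \<noteq> 0"
  shows "(\<Sum>w\<in>nz. if A w * s \<in> {0, 1, - 1} then f (A w * s) * phi (D w * r) else 0) =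
    (f 1 + f (- 1)) * phi (r / (s * S s))"
proof -
  define w0 where "w0 = (1 / s) * (1 / s) * S (1 / s)"
  have w0: "w0 \<noteq> 0" "A w0 = 1 / s" using assms A_inv[of "1 / s"] by (auto simp: w0_def)
  have D0: "D w0 = 1 / (s * S s)" using A_S_A[OF w0(1)] w0 by (simp add: S_divide)
  have neg: "A (- w) = - A w" "D (- w) = D w" if "w \<noteq> 0" for w
    using that A_mult[of "- 1" w] D_mult[of "- 1" w] by simp_all
  have inj: "w = w0" if w: "w \<noteq> 0" "A w * s = 1" for w
  proof -
    have "A w0 * A (w / w0) = A w" using w w0 A_mult[of w0 "w / w0"] by simp
    then have "A (w / w0) = 1" using w w0 assms by (simp add: field_simps)
    then show ?thesis using w w0 A_eq_1[of "w / w0"] by simp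
  qed
  have set: "{w \<in> nz. A w * s \<in> {0, 1, - 1}} = {w0, - w0}"
  proof (rule Set.set_eqI)
    fix w
    have "w = - w0" if "w \<noteq> 0" "A w * s = - 1"
    proof -
      have "- w = w0" using that neg[OF that(1)] by (intro inj) simp_all
      then have "- (- w) = - w0" by simp
      then show ?thesis by simp
    qed
    then show "w \<in> {w \<in> nz. A w * s \<in> {0, 1, - 1}} \<longleftrightarrow> w \<in> {w0, - w0}"
      using inj[of w] assms w0 neg[OF w0(1)] by auto
  qed
  have "(\<Sum>w\<in>nz. if A w * s \<in> {0, 1, - 1} then f (A w * s) * phi (D w * r) else 0) =
      (\<Sum>w\<in>{w \<in> nz. A w * s \<in> {0, 1, - 1}}. f (A w * s) * phi (D w * r))"
    by (rule sum.inter_filter[symmetric]) simp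
  also have "\<dots> = f (A w0 * s) * phi (D w0 * r) + f (A (- w0) * s) * phi (D (- w0) * r)"
    unfolding set using neq_minus_self[OF w0(1)] by (subst sum.insert) auto
  finally show ?thesis using w0 D0 neg[OF w0(1)] assms by (simp add: distrib_right)
qed

lemma Mu_value:
  assumes "k \<noteq> 0"
  shows "Mu \<eta> (e s r z k) =
    (if k = 1 then if s = 0 then M * gauss r / 2 else M * phi (r / (s * S s))
     else if k = - 1 then \<eta> * gauss r / 2 else 0)"
proof -
  have "{(t, w). w \<noteq> 0 \<and> t \<in> Lag \<and> (w = 1 \<or> w = - 1)} = Lag \<times> {1, - 1 :: 'f}" by auto
  then have "card (tw_set (\<lambda>t w. t \<in> Lag \<and> (w = 1 \<or> w = - 1))) = CARD('f) * CARD('f) * (3 * 3 ^ n * 2)"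
    using one_neq_minus_one by (simp add: card_tw_set card_cartesian_product Lag(3))
  then have card: "of_nat (card (tw_set (\<lambda>t w. t \<in> Lag \<and> (w = 1 \<or> w = - 1)))) = Q * Q * (6 * M)"
    by simp
  consider "k = 1" | "k = - 1" | "k \<noteq> 1" "k \<noteq> - 1" by blast
  then show ?thesis
  proof cases
    case 1
    have "Mu \<eta> (e s r z k) = Q * Q * Q * (\<Sum>w\<in>nz. if A w * s \<in> {0, 1, - 1} then phi (D w * r) else 0) / (Q * Q * (6 * M))"
      using 1 card sum_Lag[of s "\<lambda>_. 1" r] by (simp add: Mu_def mono_char_value cong: if_cong)
    also have "\<dots> = M / 2 * (\<Sum>w\<in>nz. if A w * s \<in> {0, 1, - 1} then phi (D w * r) else 0)"
      using Q_nz by (simp add: field_simps)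
    also have "(\<Sum>w\<in>nz. if A w * s \<in> {0, 1, - 1} then phi (D w * r) else 0) =
        (if s = 0 then gauss r else 2 * phi (r / (s * S s)))"
      using sum_A_in_F3[of s "\<lambda>_. 1" r] by (simp add: gauss_def cong: if_cong)
    finally show ?thesis using 1 by (cases "s = 0") simp_all
  next
    case 2
    let ?g = "\<lambda>t w. if A w * s - t \<in> Lag then \<eta> * phi (D w * r) else 0"
    have "Mu \<eta> (e s r z k) = (\<Sum>t\<in>UNIV. \<Sum>u\<in>(UNIV :: 'f set). \<Sum>v\<in>(UNIV :: 'f set). \<Sum>w\<in>nz. ?g t w) / (Q * Q * (6 * M))"
      using 2 card one_neq_minus_one by (simp add: Mu_def mono_char_value cong: if_cong)
    also have "(\<Sum>t\<in>UNIV. \<Sum>u\<in>(UNIV :: 'f set). \<Sum>v\<in>(UNIV :: 'f set). \<Sum>w\<in>nz. ?g t w) =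
        Q * Q * (\<Sum>w\<in>nz. \<Sum>t\<in>UNIV. ?g t w)"
      by (subst (2) sum.swap) (simp add: sum_distrib_left mult_ac)
    also have "(\<Sum>w\<in>nz. \<Sum>t\<in>UNIV. ?g t w) =
        (\<Sum>w\<in>nz. of_nat (card Lag) * (\<eta> * phi (D w * r)))"
    proof (rule sum.cong[OF refl])
      fix w
      have "(\<Sum>t\<in>UNIV. ?g t w) =
          (\<Sum>t\<in>UNIV. if t \<in> Lag then \<eta> * phi (D w * r) else 0)"
        by (rule sum.reindex_bij_witness[where i="\<lambda>t. A w * s - t" and j="\<lambda>t. A w * s - t"]) auto
      then show "(\<Sum>t\<in>UNIV. ?g t w) =
          of_nat (card Lag) * (\<eta> * phi (D w * r))"
        by (simp add: sum.If_cases)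
    qed
    also have "\<dots> = 3 * M * \<eta> * gauss r"
      unfolding Lag(3) by (simp add: gauss_def sum_distrib_left mult_ac)
    finally show ?thesis using 2 Q_nz(1) one_neq_minus_one by simp
  next
    case 3
    then show ?thesis using assms by (simp add: Mu_def mono_char_value)
  qed
qed

lemma Chi_value:
  assumes "k \<noteq> 0"
  shows "Chi (e s r z k) =
    (if k = 1 then if s = 0 then M * gauss r else - M * phi (r / (s * S s)) else 0)"
proof (cases "k = 1")
  case False
  then show ?thesis using assms by (simp add: Chi_def mono_char_value)
next
  case True
  have "{(t, w). w \<noteq> 0 \<and> t \<in> Lag \<and> w = 1} = Lag \<times> {1 :: 'f}" by auto
  then have "card (tw_set (\<lambda>t w. t \<in> Lag \<and> w = 1)) = CARD('f) * CARD('f) * (3 * 3 ^ n)"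
    by (simp add: card_tw_set card_cartesian_product Lag(3))
  then have card: "of_nat (card (tw_set (\<lambda>t w. t \<in> Lag \<and> w = 1))) = Q * Q * (3 * M)" by simp
  have eq: "phi (D w * r - B t (A w * s) + c0 * (A w * s)) =
      phi (c0 * (A w * s)) * phi (D w * r - B t (A w * s))" for w t
    by (simp add: phi_add)
  have "Chi (e s r z k) = Q * Q * Q * (\<Sum>w\<in>nz. if A w * s \<in> {0, 1, - 1} then phi (c0 * (A w * s)) * phi (D w * r) else 0) / (Q * Q * (3 * M))"
    using True card sum_Lag[of s "\<lambda>y. phi (c0 * y)" r] by (simp add: Chi_def mono_char_value eq cong: if_cong)
  also have "\<dots> = M * (\<Sum>w\<in>nz. if A w * s \<in> {0, 1, - 1} then phi (c0 * (A w * s)) * phi (D w * r) else 0)"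
    using Q_nz by (simp add: field_simps)
  also have "(\<Sum>w\<in>nz. if A w * s \<in> {0, 1, - 1} then phi (c0 * (A w * s)) * phi (D w * r) else 0) =
      (if s = 0 then gauss r else - phi (r / (s * S s)))"
  proof -
    have "om + cnj om = - 1" using om_sum by (metis add.assoc add_eq_0_iff)
    then show ?thesis
      using sum_A_in_F3[of s "\<lambda>y. phi (c0 * y)" r] by (simp add: gauss_def phi_c0 phi_minus cong: if_cong)
  qed
  finally show ?thesis using True by simp
qed

end

section \<open>Conjugacy classes and centralisers\<close>

text \<open>The fibres of \<open>g \<mapsto> g a g\<^sup>-\<^sup>1\<close> are cosets of the centraliser.\<close>

lemma card_conj_class_centralizer:
  fixes G (structure)
  assumes "group G" and fin: "finite (carrier G)" and a: "a \<in> carrier G"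
  shows "card (conj_class G a) * card (centralizer G a) = card (carrier G)"
proof -
  interpret group G by fact
  have fib: "card {g \<in> carrier G. g \<otimes> a \<otimes> inv g = b} = card (centralizer G a)"
    if b: "b \<in> conj_class G a" for b
  proof -
    obtain g0 where g0: "g0 \<in> carrier G" "b = g0 \<otimes> a \<otimes> inv g0" using b by (auto simp: conj_class_def)
    have bC: "b \<in> carrier G" using g0 a by simp
    have iff: "g \<otimes> a \<otimes> inv g = b \<longleftrightarrow> inv g0 \<otimes> g \<in> centralizer G a" if g: "g \<in> carrier G" for g
    proof
      assume eq: "g \<otimes> a \<otimes> inv g = b"
      have "inv g0 \<otimes> g \<otimes> a = inv g0 \<otimes> (g \<otimes> a \<otimes> inv g) \<otimes> g"
        using g g0(1) a by (simp add: m_assoc)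
      also have "\<dots> = a \<otimes> (inv g0 \<otimes> g)"
        unfolding eq g0(2) using g g0(1) a by (simp add: m_assoc mult_inv_cancel)
      finally show "inv g0 \<otimes> g \<in> centralizer G a" using g g0(1) by (simp add: centralizer_def)
    next
      assume "inv g0 \<otimes> g \<in> centralizer G a"
      then have eq: "inv g0 \<otimes> g \<otimes> a = a \<otimes> (inv g0 \<otimes> g)" by (simp add: centralizer_def)
      have "g \<otimes> a \<otimes> inv g = g0 \<otimes> (inv g0 \<otimes> g \<otimes> a) \<otimes> inv g"
        using g g0(1) a by (simp add: m_assoc mult_inv_cancel)
      also have "\<dots> = b"
        unfolding eq g0(2) using g g0(1) a by (simp add: m_assoc mult_inv_cancel)
      finally show "g \<otimes> a \<otimes> inv g = b" .
    qed
    show ?thesis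
    proof (rule bij_betw_same_card[of "\<lambda>g. inv g0 \<otimes> g"], rule bij_betw_byWitness[where f'="\<lambda>g. g0 \<otimes> g"])
      show "(\<lambda>g. inv g0 \<otimes> g) ` {g \<in> carrier G. g \<otimes> a \<otimes> inv g = b} \<subseteq> centralizer G a"
        using iff by auto
      show "(\<lambda>g. g0 \<otimes> g) ` centralizer G a \<subseteq> {g \<in> carrier G. g \<otimes> a \<otimes> inv g = b}"
      proof
        fix y assume "y \<in> (\<lambda>g. g0 \<otimes> g) ` centralizer G a"
        then obtain g where g: "g \<in> centralizer G a" "y = g0 \<otimes> g" by blast
        have "g \<in> carrier G" using g by (simp add: centralizer_def)
        then show "y \<in> {g \<in> carrier G. g \<otimes> a \<otimes> inv g = b}"
          using iff[of y] g g0(1) by (simp add: mult_inv_cancel)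
      qed
    qed (use g0(1) in \<open>auto simp: mult_inv_cancel centralizer_def\<close>)
  qed
  have "card (carrier G) = (\<Sum>g\<in>carrier G. 1)" by simp
  also have "\<dots> = (\<Sum>b\<in>(\<lambda>g. g \<otimes> a \<otimes> inv g) ` carrier G. \<Sum>g\<in>{g \<in> carrier G. g \<otimes> a \<otimes> inv g = b}. 1)"
    by (rule sum.image_gen[OF fin])
  also have "(\<lambda>g. g \<otimes> a \<otimes> inv g) ` carrier G = conj_class G a" by (auto simp: conj_class_def)
  also have "(\<Sum>b\<in>conj_class G a. \<Sum>g\<in>{g \<in> carrier G. g \<otimes> a \<otimes> inv g = b}. 1) =
      (\<Sum>b\<in>conj_class G a. card (centralizer G a))"
    by (intro sum.cong refl) (simp add: fib)
  finally show ?thesis by simp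
qed

lemma conj_class_eq:
  fixes G (structure)
  assumes "group G" and a: "a \<in> carrier G" and b: "b \<in> conj_class G a"
  shows "conj_class G b = conj_class G a"
proof -
  interpret group G by fact
  obtain g where g: "g \<in> carrier G" "b = g \<otimes> a \<otimes> inv g" using b by (auto simp: conj_class_def)
  have 1: "k \<otimes> b \<otimes> inv k = (k \<otimes> g) \<otimes> a \<otimes> inv (k \<otimes> g)" if "k \<in> carrier G" for k
    using that g a by (simp add: m_assoc inv_mult_group)
  have 2: "k \<otimes> a \<otimes> inv k = (k \<otimes> inv g) \<otimes> b \<otimes> inv (k \<otimes> inv g)" if "k \<in> carrier G" for k
  proof -
    show ?thesis using that g a by (simp add: m_assoc inv_mult_group mult_inv_cancel)
  qed
  show ?thesis
  proof (intro equalityI subsetI)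
    fix y assume "y \<in> conj_class G b"
    then obtain k where k: "k \<in> carrier G" "y = k \<otimes> b \<otimes> inv k" by (auto simp: conj_class_def)
    then show "y \<in> conj_class G a" unfolding conj_class_def k(2) 1[OF k(1)] using k(1) g(1) by blast
  next
    fix y assume "y \<in> conj_class G a"
    then obtain k where k: "k \<in> carrier G" "y = k \<otimes> a \<otimes> inv k" by (auto simp: conj_class_def)
    then show "y \<in> conj_class G b" unfolding conj_class_def k(2) 2[OF k(1)] using k(1) g(1) by blast
  qed
qed

lemma conj_classes_eqI:
  fixes G (structure)
  assumes G: "group G" and cover: "\<And>a. a \<in> carrier G \<Longrightarrow> \<exists>C\<in>\<C>. a \<in> C"
    and cls: "\<And>C. C \<in> \<C> \<Longrightarrow> \<exists>a\<in>carrier G. C = conj_class G a"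
  shows "conj_classes G = \<C>"
proof (intro equalityI subsetI)
  fix C assume "C \<in> conj_classes G"
  then obtain a where a: "a \<in> carrier G" "C = conj_class G a" by (auto simp: conj_classes_def)
  obtain C' where C': "C' \<in> \<C>" "a \<in> C'" using cover[OF a(1)] by blast
  obtain b where b: "b \<in> carrier G" "C' = conj_class G b" using cls[OF C'(1)] by blast
  show "C \<in> \<C>" using conj_class_eq[OF G b(1)] C' a b by simp
next
  fix C assume "C \<in> \<C>"
  then show "C \<in> conj_classes G" using cls by (auto simp: conj_classes_def)
qed

context ree_char
begin

text \<open>Since \<open>W\<close> is abelian, a conjugacy class lies in one coset \<open>P h(k)\<close>, where it is cut out by a
  condition on the remaining coordinates.\<close>

definition slice :: "('f \<Rightarrow> 'f \<Rightarrow> 'f \<Rightarrow> bool) \<Rightarrow> 'f \<Rightarrow> 'a set" where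
  "slice P k = {e s r z k | s r z. P s r z}"

lemma e_slice [simp]: "k \<noteq> 0 \<Longrightarrow> k' \<noteq> 0 \<Longrightarrow> e s r z k \<in> slice P k' \<longleftrightarrow> k = k' \<and> P s r z"
  by (auto simp: slice_def e_inj)

lemma slice_subset: "k \<noteq> 0 \<Longrightarrow> slice P k \<subseteq> carrier N" by (auto simp: slice_def)

lemma card_slice: "k \<noteq> 0 \<Longrightarrow> card (slice P k) = card {(s, r, z). P s r z}"
proof -
  assume k: "k \<noteq> 0"
  have "slice P k = (\<lambda>(s, r, z). e s r z k) ` {(s, r, z). P s r z}"
    unfolding slice_def by (fastforce simp: image_iff)
  moreover have "inj_on (\<lambda>(s, r, z). e s r z k) {(s, r, z). P s r z}"
    using k by (auto simp: inj_on_def e_inj)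
  ultimately show ?thesis by (simp add: card_image)
qed

lemma conj_class_sliceI:
  assumes k: "k \<noteq> 0"
    and fwd: "\<And>t u v w. w \<noteq> 0 \<Longrightarrow> P (conj_t t w s k) (conj_u t u w s r k) (conj_v t u v w s r z k)"
    and bwd: "\<And>s' r' z'. P s' r' z' \<Longrightarrow>
      \<exists>t u v w. w \<noteq> 0 \<and> conj_t t w s k = s' \<and> conj_u t u w s r k = r' \<and> conj_v t u v w s r z k = z'"
  shows "conj_class N (e s r z k) = slice P k"
proof -
  have "conj_class N (e s r z k) =
      {e (conj_t t w s k) (conj_u t u w s r k) (conj_v t u v w s r z k) k | t u v w. w \<noteq> 0}"
  proof -
    have "conj_class N (e s r z k) = {y \<otimes> e s r z k \<otimes> inv y | y. y \<in> carrier N}"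
      unfolding conj_class_def by (auto, (metis inv_N)+)
    also have "\<dots> = {e t u v w \<otimes> e s r z k \<otimes> inv (e t u v w) | t u v w. w \<noteq> 0}"
      unfolding carrier_N by blast
    also have "\<dots> = {e (conj_t t w s k) (conj_u t u w s r k) (conj_v t u v w s r z k) k | t u v w. w \<noteq> 0}"
      using e_conj[OF _ k] by (intro Collect_cong ex_cong1) auto
    finally show ?thesis .
  qed
  also have "\<dots> = slice P k"
    unfolding slice_def using fwd bwd by blast
  finally show ?thesis .
qed

lemma x_eq_e: "x t u v = e t (u - t * S t) (v - t * (u - t * S t)) 1"
  by (simp add: e_def p_def h_1)

lemma class_one: "conj_class N (e 0 0 0 1) = slice (\<lambda>s r z. s = 0 \<and> r = 0 \<and> z = 0) 1"
  by (rule conj_class_sliceI) (auto intro: exI[of _ 1])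

lemma class_X: "conj_class N (e 0 0 1 1) = slice (\<lambda>s r z. s = 0 \<and> r = 0 \<and> z \<noteq> 0) 1"
  by (rule conj_class_sliceI) auto

text \<open>Conjugation multiplies \<open>u\<close> by an arbitrary value of \<open>D\<close>, and adds to \<open>v\<close> a multiple of \<open>u \<noteq> 0\<close> that can
  be prescribed through \<open>t\<close>.\<close>

lemma class_T:
  assumes "c = 1 \<or> c = - 1"
  shows "conj_class N (e 0 c 0 1) = slice (\<lambda>s r z. s = 0 \<and> c * r \<in> Sq) 1"
proof (rule conj_class_sliceI)
  have cc: "c * c = 1" "c \<noteq> 0" using assms by auto
  fix s' r' z' :: 'f assume *: "s' = 0 \<and> c * r' \<in> Sq"
  then obtain w where w: "w \<noteq> 0" "c * r' = D w" by (auto simp: Sq_def)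
  have r: "r' = D w * c"
  proof -
    have "r' = c * (c * r')" using cc by (simp flip: mult.assoc)
    then show ?thesis using w by (simp add: mult.commute)
  qed
  show "\<exists>t u v w. w \<noteq> 0 \<and> conj_t t w 0 1 = s' \<and> conj_u t u w 0 c 1 = r' \<and> conj_v t u v w 0 c 0 1 = z'"
    using w r * cc by (intro exI[of _ "z' / r'"] exI[of _ 0] exI[of _ w]) auto
next
  fix t u v w :: 'f assume "w \<noteq> 0"
  then show "conj_t t w 0 1 = 0 \<and> c * conj_u t u w 0 c 1 \<in> Sq" using assms by (auto simp: Sq_def)
qed simp

lemma phi_B_1: "phi (B t 1) = 1" "phi (B 1 t) = 1"
proof -
  show "phi (B 1 t) = 1" unfolding B_def using phi_eq_1_iff_S_diff by auto
  then show "phi (B t 1) = 1" by (simp add: B_swap[of t] phi_minus)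
qed

text \<open>Conjugation by \<open>W\<close> moves \<open>t\<close> to \<open>1\<close>. At \<open>t = 1\<close>, conjugation inside \<open>P\<close> changes \<open>u\<close> by an arbitrary \<open>S y - y\<close>,
  hence within a fibre of \<open>phi\<close>, and \<open>v\<close> arbitrarily.\<close>

lemma class_Y:
  "conj_class N (e 1 r 0 1) = slice (\<lambda>s' r' z'. s' \<noteq> 0 \<and> phi (r' / (s' * S s')) = phi r) 1"
proof (rule conj_class_sliceI)
  fix t u v w :: 'f assume w: "w \<noteq> 0"
  have "B t (A w) = D w * B (t / A w) 1" using w B_A[of w "t / A w" 1] by simp
  then have "(D w * r - B t (A w)) / D w = r - B (t / A w) 1" using w by (simp add: diff_divide_distrib)
  then have "phi ((D w * r - B t (A w)) / (A w * S (A w))) = phi r"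
    using w by (simp add: A_S_A phi_diff phi_B_1)
  then show "conj_t t w 1 1 \<noteq> 0 \<and> phi (conj_u t u w 1 r 1 / (conj_t t w 1 1 * S (conj_t t w 1 1))) = phi r"
    using w by simp
next
  fix s' r' z' :: 'f assume *: "s' \<noteq> 0 \<and> phi (r' / (s' * S s')) = phi r"
  define w where "w = s' * s' * S s'"
  have w: "w \<noteq> 0" "A w = s'" "D w = s' * S s'" using * A_inv[of s'] A_S_A[of w] by (auto simp: w_def)
  have "phi (r - r' / D w) = 1" using * w phi_minus[of r] phi_add[of r "- r"] by (simp add: phi_diff)
  then obtain y where y: "r - r' / D w = S y - y" using phi_eq_1_iff_S_diff by blast
  define t where "t = s' * (- y)"
  have "B t (A w) = D w * B (- y) 1" using B_A[OF w(1), of "- y" 1] w by (simp add: t_def)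
  also have "\<dots> = D w * (r - r' / D w)" unfolding y by (simp add: B_def S_minus)
  finally have conj_u: "conj_u t u w 1 r 1 = r'" for u using w * by (simp add: algebra_simps)
  have lin: "conj_v t u 0 w 1 r 0 1 = conj_v t 0 0 w 1 r 0 1 - s' * u" for u
    using double_eq_minus[of "s' * u"] conj_u w by (simp add: conj_v_def cocycle_def algebra_simps)
  have "conj_v t ((conj_v t 0 0 w 1 r 0 1 - z') / s') 0 w 1 r 0 1 = z'"
    by (subst lin) (use * in simp)
  then show "\<exists>t u v w. w \<noteq> 0 \<and> conj_t t w 1 1 = s' \<and> conj_u t u w 1 r 1 = r' \<and> conj_v t u v w 1 r 0 1 = z'"
    using w conj_u
    by (intro exI[of _ t] exI[of _ "(conj_v t 0 0 w 1 r 0 1 - z') / s'"] exI[of _ 0] exI[of _ w]) simp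
qed simp

lemma conj_v_shift: "conj_v t u v w s r z k = (1 - k) * v + conj_v t u 0 w s r z k"
  by (simp add: conj_v_def)

text \<open>The factors \<open>1 - A k\<close>, \<open>1 - D k\<close> and \<open>1 - k\<close> are non-zero, so that the three coordinates of a
  conjugate can be prescribed one after the other.\<close>

lemma class_K:
  assumes k: "k \<noteq> 0" "k \<noteq> 1" "k \<noteq> - 1"
  shows "conj_class N (e 0 0 0 k) = slice (\<lambda>_ _ _. True) k"
proof (rule conj_class_sliceI[OF k(1)])
  fix s' r' z' :: 'f
  have k1: "1 - k \<noteq> 0" "1 - A k \<noteq> 0" "1 - D k \<noteq> 0" using k A_eq_1[OF k(1)] D_eq_1[OF k(1)] by auto
  define t where "t = s' / (1 - A k)"
  have t: "conj_t t 1 0 k = s'" using k1 by (simp add: t_def conj_t_def)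
  define u where "u = (r' + B s' (A k * t)) / (1 - D k)"
  have u: "conj_u t u 1 0 0 k = r'" using k1 t by (simp add: u_def conj_u_def)
  have "conj_v t u ((z' - conj_v t u 0 1 0 0 0 k) / (1 - k)) 1 0 0 0 k = z'"
    by (subst conj_v_shift) (use k1 in simp)
  then show "\<exists>t u v w. w \<noteq> 0 \<and> conj_t t w 0 k = s' \<and> conj_u t u w 0 0 k = r' \<and> conj_v t u v w 0 0 0 k = z'"
    using t u by (metis one_neq_zero)
qed simp

text \<open>As \<open>h (- 1)\<close> inverts the coordinates \<open>t\<close> and \<open>v\<close> and fixes \<open>u\<close>, the former two can be prescribed
  for a conjugate, while the latter only gets multiplied by a value of \<open>D\<close>.\<close>

lemma class_J:
  "conj_class N (e 0 r 0 (- 1)) = slice (\<lambda>_ r' _. \<exists>w. w \<noteq> 0 \<and> r' = D w * r) (- 1)"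
proof (rule conj_class_sliceI)
  fix s' r' z' :: 'f assume "\<exists>w. w \<noteq> 0 \<and> r' = D w * r"
  then obtain w where w: "w \<noteq> 0" "r' = D w * r" by blast
  have sh: "conj_v t u v w s r z (- 1) = conj_v t u 0 w s r z (- 1) - v" for t u v s z
    by (subst conj_v_shift) (simp add: two_eq)
  have "conj_v (- s') 0 (conj_v (- s') 0 0 w 0 r 0 (- 1) - z') w 0 r 0 (- 1) = z'"
    by (subst sh) simp
  then show "\<exists>t u v w. w \<noteq> 0 \<and> conj_t t w 0 (- 1) = s' \<and> conj_u t u w 0 r (- 1) = r' \<and> conj_v t u v w 0 r 0 (- 1) = z'"
    using w by (intro exI[of _ "- s'"] exI[of _ 0] exI[of _ "conj_v (- s') 0 0 w 0 r 0 (- 1) - z'"] exI[of _ w]) simp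
qed auto

lemma class_JT:
  assumes "c = 1 \<or> c = - 1"
  shows "conj_class N (e 0 c 0 (- 1)) = slice (\<lambda>_ r _. c * r \<in> Sq) (- 1)"
proof -
  have "(\<exists>w. w \<noteq> 0 \<and> r' = D w * c) \<longleftrightarrow> c * r' \<in> Sq" for r'
    using assms by (auto simp: Sq_def image_iff) (metis add.inverse_inverse)+
  then show ?thesis unfolding class_J by simp
qed

lemma class_J0: "conj_class N (e 0 0 0 (- 1)) = slice (\<lambda>_ r _. r = 0) (- 1)"
  unfolding class_J by (rule arg_cong[where f="\<lambda>P. slice P _"]) (auto simp: fun_eq_iff intro: exI[of _ 1])

lemma card_N: "card (carrier N) = CARD('f) ^ 3 * (CARD('f) - 1)"
proof -
  have "card (carrier N) = (\<Sum>y\<in>carrier N. 1)" by simp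
  then show ?thesis unfolding sum_N by (simp add: power3_eq_cube card_Diff_singleton)
qed

lemma card_centralizer_slice:
  assumes "k \<noteq> 0" "conj_class N (e s r z k) = slice P k" "g \<in> slice P k"
  shows "card {(s, r, z). P s r z} * card (centralizer N g) = CARD('f) ^ 3 * (CARD('f) - 1)"
proof -
  have g: "g \<in> carrier N" using slice_subset assms by auto
  have "conj_class N g = slice P k"
    using conj_class_eq[OF group_N, of "e s r z k" g] assms by simp
  then show ?thesis
    using card_conj_class_centralizer[OF group_N finite_N g] card_slice[OF assms(1), of P] card_N by simp
qed

end

section \<open>The character table\<close>

locale ree_gen = ree_char G n x h om
  for G :: "('a, 'b) monoid_scheme" (structure) and n
    and x :: "'f::{field, finite} \<Rightarrow> 'f \<Rightarrow> 'f \<Rightarrow> 'a" and h and om +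
  fixes g0 :: 'f and \<xi> :: complex and q :: nat
  assumes g0: "g0 \<noteq> 0" and gen: "generate G {h g0} = ree_W h"
    and q: "q = 3 ^ (2 * n + 1)"
    and \<xi>: "\<xi> ^ (q - 1) = 1" "\<And>k. 0 < k \<Longrightarrow> k < q - 1 \<Longrightarrow> \<xi> ^ k \<noteq> 1"
begin

lemma CARD_q: "CARD('f) = q" by (simp add: card_field q)
lemma Q_q: "Q = of_nat q" by (simp add: q Q_def)

lemma q_ge: "q \<ge> 27"
proof -
  have "(3 :: nat) ^ 3 \<le> 3 ^ (2 * n + 1)" using n_pos by (intro power_increasing) auto
  then show ?thesis by (simp add: q)
qed

lemma q_half: "q - 1 = 2 * card Sq" "(q - 1) div 2 = card Sq" "0 < card Sq"
  using card_Sq q q_ge by auto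

lemma g0_power_q: "g0 ^ (q - 1) = 1"
proof -
  have "g0 ^ q = g0" using power_card q by simp
  moreover have "g0 ^ q = g0 ^ (q - 1) * g0" using q_ge by (subst power_Suc2[symmetric]) simp
  ultimately show ?thesis using g0 by simp
qed

lemma g0_power_mod: "g0 ^ (k mod (q - 1)) = g0 ^ k"
proof -
  have "g0 ^ k = g0 ^ ((q - 1) * (k div (q - 1)) + k mod (q - 1))" by simp
  then show ?thesis unfolding power_add power_mult g0_power_q by simp
qed

lemma xi_power_mod: "\<xi> ^ (i * (k mod (q - 1))) = \<xi> ^ (i * k)"
proof -
  have "\<xi> ^ (i * k) = \<xi> ^ (i * ((q - 1) * (k div (q - 1)) + k mod (q - 1)))" by simp
  also have "\<dots> = (\<xi> ^ (q - 1)) ^ (k div (q - 1) * i) * \<xi> ^ (i * (k mod (q - 1)))"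
    by (simp only: distrib_left power_add power_mult[symmetric] mult_ac)
  finally show ?thesis using \<xi>(1) by simp
qed

lemma h_power: "w \<noteq> 0 \<Longrightarrow> h w [^] (j :: nat) = h (w ^ j)"
  by (induction j) (simp_all add: h_1 h_mult mult.commute)

lemma nz_power: "w \<noteq> 0 \<Longrightarrow> \<exists>j < q - 1. w = g0 ^ j"
proof -
  assume w: "w \<noteq> 0"
  let ?H = "{h (g0 ^ j) | j :: nat. True}"
  have "subgroup ?H G"
  proof (rule subgroupI)
    show "?H \<subseteq> carrier G" using g0 by auto
    fix a assume "a \<in> ?H"
    then obtain j where j: "a = h (g0 ^ j)" by auto
    have "g0 ^ (j * (q - 2)) * g0 ^ j = (g0 ^ (q - 1)) ^ j"
    proof -
      have "j * (q - 2) + j = (q - 1) * j" using q_ge by (simp add: algebra_simps diff_mult_distrib2)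
      then show ?thesis by (simp only: power_add[symmetric] power_mult[symmetric])
    qed
    then have "h (g0 ^ (j * (q - 2))) \<otimes> a = \<one>" using g0 g0_power_q by (simp add: j h_mult h_1)
    then have "inv a = h (g0 ^ (j * (q - 2)))" using g0 by (intro inv_equality) (auto simp: j)
    then show "inv a \<in> ?H" by auto
  next
    fix a b assume "a \<in> ?H" "b \<in> ?H"
    then show "a \<otimes> b \<in> ?H" using g0 by (auto simp: h_mult power_add[symmetric])
  qed auto
  moreover have "{h g0} \<subseteq> ?H" by (auto intro: exI[of _ 1])
  ultimately have "generate G {h g0} \<subseteq> ?H" by (intro generate_subgroup_incl)
  then have "h w \<in> ?H" using w gen by (auto simp: ree_W_def)
  then obtain j where "h w = h (g0 ^ j)" by auto
  then have "w = g0 ^ j" using h_inj w g0 by (auto simp: inj_on_def)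
  then show ?thesis using g0_power_mod[of j] q_ge by (intro exI[of _ "j mod (q - 1)"]) auto
qed

lemma g0_power_inj: "inj_on (\<lambda>j. g0 ^ j) {..<q - 1}"
proof (rule eq_card_imp_inj_on)
  have "(\<lambda>j. g0 ^ j) ` {..<q - 1} = nz"
    using nz_power g0 by (auto simp: image_iff)
  then show "card ((\<lambda>j. g0 ^ j) ` {..<q - 1}) = card {..<q - 1}" using card_nz q by simp
qed simp

lemma g0_power_eq_1: "j < q - 1 \<Longrightarrow> g0 ^ j = 1 \<longleftrightarrow> j = 0"
  using g0_power_inj q_ge by (auto simp: inj_on_def dest: bspec[of _ _ 0])

lemma g0_power_half: "j < q - 1 \<Longrightarrow> g0 ^ j = - 1 \<longleftrightarrow> j = card Sq"
proof -
  have "(g0 ^ card Sq)\<^sup>2 = 1"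
    using g0_power_q q_half(1) by (simp add: power_mult[symmetric] mult.commute)
  moreover have "g0 ^ card Sq \<noteq> 1"
  proof -
    have "card Sq < q - 1" "card Sq \<noteq> 0" using q_half by linarith+
    then show ?thesis using g0_power_eq_1[of "card Sq"] by metis
  qed
  ultimately have *: "g0 ^ card Sq = - 1" by (simp add: power2_eq_1_iff)
  assume "j < q - 1"
  then show ?thesis using g0_power_inj q_half unfolding *[symmetric] by (auto simp: inj_on_def)
qed

lemma xi_half: "\<xi> ^ card Sq = - 1"
proof -
  have "(\<xi> ^ card Sq)\<^sup>2 = 1"
    using \<xi>(1) q_half(1) by (simp add: power_mult[symmetric] mult.commute)
  moreover have "\<xi> ^ card Sq \<noteq> 1" using \<xi>(2)[of "card Sq"] q_half by simp
  ultimately show ?thesis by (simp add: power2_eq_1_iff)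
qed

definition dlog :: "'f \<Rightarrow> nat" where "dlog w = (THE j. j < q - 1 \<and> w = g0 ^ j)"

lemma dlog: assumes "w \<noteq> 0" shows "dlog w < q - 1" "g0 ^ dlog w = w"
proof -
  have "\<exists>!j. j < q - 1 \<and> w = g0 ^ j"
    using nz_power[OF assms] g0_power_inj by (auto simp: inj_on_def)
  then have "dlog w < q - 1 \<and> w = g0 ^ dlog w" unfolding dlog_def by (rule theI')
  then show "dlog w < q - 1" "g0 ^ dlog w = w" by simp_all
qed

lemma dlog_power: "j < q - 1 \<Longrightarrow> dlog (g0 ^ j) = j"
  using dlog[of "g0 ^ j"] g0 g0_power_inj by (auto simp: inj_on_def)

lemma dlog_mult: "w \<noteq> 0 \<Longrightarrow> w' \<noteq> 0 \<Longrightarrow> dlog (w * w') = (dlog w + dlog w') mod (q - 1)"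
proof -
  assume w: "w \<noteq> 0" "w' \<noteq> 0"
  have "w * w' = g0 ^ ((dlog w + dlog w') mod (q - 1))"
    unfolding g0_power_mod power_add using dlog w by simp
  then show ?thesis using q_ge by (simp add: dlog_power)
qed

lemma dlog_1 [simp]: "dlog 1 = 0" and dlog_m1 [simp]: "dlog (- 1) = card Sq"
  using dlog_power[of 0] dlog_power[of "card Sq"] g0_power_half[of "card Sq"] q_half by auto

definition alpha :: "nat \<Rightarrow> 'a \<Rightarrow> complex" where
  "alpha i = mono_char (\<lambda>_ _. True) (\<lambda>t u v w. \<xi> ^ (i * dlog w))"

lemma xi_nz: "\<xi> \<noteq> 0" using \<xi>(1) q_ge by (auto simp: power_0_left)

lemma alpha: "alpha i \<in> irr_characters N" "k \<noteq> 0 \<Longrightarrow> alpha i (e s r z k) = \<xi> ^ (i * dlog k)"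
proof -
  have "\<xi> ^ (i * dlog (w * w')) = \<xi> ^ (i * dlog w) * \<xi> ^ (i * dlog w')" if "w \<noteq> 0" "w' \<noteq> 0" for w w'
    unfolding dlog_mult[OF that] xi_power_mod by (simp add: distrib_left power_add)
  then show "alpha i \<in> irr_characters N" "k \<noteq> 0 \<Longrightarrow> alpha i (e s r z k) = \<xi> ^ (i * dlog k)"
    unfolding alpha_def using linear_mono_char[of "\<lambda>w. \<xi> ^ (i * dlog w)"] xi_nz by auto
qed

lemma conj_char_e [simp]: "k \<noteq> 0 \<Longrightarrow> conj_char N f (e s r z k) = cnj (f (e s r z k))"
  by (simp add: conj_char_def)

subsection \<open>Completeness\<close>

definition nonlinear :: "('a \<Rightarrow> complex) list" where
  "nonlinear = [Lam, Mu 1, Mu (- 1), conj_char N (Mu 1), conj_char N (Mu (- 1)), Chi, conj_char N Chi, Psi]"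

definition table :: "('a \<Rightarrow> complex) set" where "table = alpha ` {0..q - 2} \<union> set nonlinear"

lemma gauss_values:
  "r \<in> Sq \<Longrightarrow> gauss r = - 1 + M * csqrt (- 3)" "- r \<in> Sq \<Longrightarrow> gauss r = - 1 - M * csqrt (- 3)"
  "gauss 0 = Q - 1" "gauss 1 = - 1 + M * csqrt (- 3)"
proof -
  show 1: "gauss 1 = - 1 + M * csqrt (- 3)" using gauss_value by simp
  show "r \<in> Sq \<Longrightarrow> gauss r = - 1 + M * csqrt (- 3)" using gauss_Sq(1) 1 by simp
  show "gauss r = - 1 - M * csqrt (- 3)" if "- r \<in> Sq"
  proof -
    have "gauss r = cnj (gauss (- r))" by (simp add: gauss_minus)
    then show ?thesis using gauss_Sq(1)[OF that] 1 by (simp add: csqrt_m3)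
  qed
  show "gauss 0 = Q - 1" unfolding gauss_0 CARD_q Q_q using q_ge by (simp add: of_nat_diff)
qed

lemma gauss_plus_cnj: "gauss r + cnj (gauss r) = (if r = 0 then 2 * (Q - 1) else - 2)"
proof (cases "r = 0")
  case True
  then show ?thesis by (simp add: gauss_values Q_q)
next
  case False
  then consider "r \<in> Sq" | "- r \<in> Sq" using nz_cases by blast
  then show ?thesis using False by cases (simp_all add: gauss_values csqrt_m3)
qed

lemma nonlinear_irr: "set nonlinear \<subseteq> irr_characters N"
  using Lam_irr Mu_irr Chi_irr Psi_irr by (auto simp: nonlinear_def intro!: irr_characters_conj[OF group_N])

lemma Re_M: "Re M = 3 ^ n" "Im M = 0"
proof -
  have "M = complex_of_real (3 ^ n)" by simp
  then show "Re M = 3 ^ n" "Im M = 0" by (simp_all only: Re_complex_of_real Im_complex_of_real)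
qed

lemma distinct_nonlinear: "distinct nonlinear"
proof -
  \<comment> \<open>the values at \<open>x(0, 1, 0)\<close> and \<open>h(- 1)\<close>, up to coordinates, separate the characters\<close>
  define \<tau> where "\<tau> f = (Im (f (e 0 1 0 1)), Re (f (e 0 0 0 (- 1))), Re (f (e 0 1 0 1 :: 'a)))" for f :: "'a \<Rightarrow> complex"
  have q: "Re Q = real q" "Im Q = 0" "real q \<ge> 27" using q_ge by (simp_all add: Q_q)
  have M: "Re M > 0" "Im M = 0" by (simp_all add: Re_M)
  have "distinct (map \<tau> nonlinear)"
    using q M one_neq_minus_one
    by (simp add: nonlinear_def \<tau>_def Lam_value Mu_value Chi_value Psi_value gauss_values csqrt_m3)
  then show ?thesis by (simp add: distinct_map)
qed

lemma alpha_inj: "inj_on alpha {0..q - 2}"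
proof (rule inj_onI)
  have xi_inj: "i = j" if "i \<le> j" "j \<le> q - 2" "\<xi> ^ i = \<xi> ^ j" for i j
  proof (rule ccontr)
    assume "i \<noteq> j"
    then have "\<xi> ^ (j - i) \<noteq> 1" using that q_ge by (intro \<xi>(2)) auto
    moreover have "\<xi> ^ i * \<xi> ^ (j - i) = \<xi> ^ j" using that(1) by (simp add: power_add[symmetric])
    then have "\<xi> ^ i * \<xi> ^ (j - i) = \<xi> ^ i * 1" using that(3) by simp
    then have "\<xi> ^ (j - i) = 1" unfolding mult_cancel_left using xi_nz by simp
    ultimately show False by simp
  qed
  fix i j assume ij: "i \<in> {0..q - 2}" "j \<in> {0..q - 2}" "alpha i = alpha j"
  have "dlog g0 = 1" using dlog_power[of 1] q_ge by simp
  then have "alpha k (e 0 0 0 g0) = \<xi> ^ k" for k using alpha(2)[OF g0] by simp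
  then have "\<xi> ^ i = \<xi> ^ j" using ij by metis
  moreover have "i \<le> q - 2" "j \<le> q - 2" using ij by simp_all
  ultimately show "i = j" using xi_inj by (metis nat_le_linear)
qed

lemma alpha_nonlinear: "alpha ` {0..q - 2} \<inter> set nonlinear = {}"
proof -
  have q: "Re Q = real q" "real q \<ge> 27" using q_ge by (simp_all add: Q_q)
  have M: "Re M \<ge> 1" "Im M = 0" by (simp_all add: Re_M)
  have MQ: "Re M * (real q - 1) \<ge> 26" using mult_mono[of 1 "Re M" 26 "real q - 1"] q M by simp
  \<comment> \<open>the degrees of the characters in \<open>nonlinear\<close> exceed \<open>1\<close>\<close>
  have "1 \<notin> (\<lambda>f. Re (f (e 0 0 0 1))) ` set nonlinear"
  proof -
    have "real q * (real q - 1) \<ge> 26" using mult_mono[of 1 "real q" 26 "real q - 1"] q by simp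
    then show ?thesis using q M MQ
      by (auto simp: nonlinear_def Lam_value Mu_value Chi_value Psi_value gauss_values Q_q)
  qed
  moreover have "alpha i (e 0 0 0 1) = 1" for i by (simp add: alpha)
  ultimately show ?thesis by (auto simp: image_iff)
qed

lemma sum_alpha:
  assumes "k \<noteq> 0"
  shows "(\<Sum>i\<in>{0..q - 2}. alpha i (e s r z k)) = (if k = 1 then Q - 1 else 0)"
proof (cases "k = 1")
  case True
  then show ?thesis using q_ge by (simp add: alpha Q_q of_nat_diff)
next
  case False
  have "dlog k \<noteq> 0" using dlog[OF assms] False by (metis power_0)
  then have "\<xi> ^ dlog k \<noteq> 1" using dlog[OF assms] by (intro \<xi>) auto
  moreover have "(\<xi> ^ dlog k) ^ (q - 1) = 1" using \<xi>(1) by (metis mult.commute power_mult power_one)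
  moreover have "{0..q - 2} = {..<q - 1}" using q_ge by auto
  ultimately have "(\<Sum>i\<in>{0..q - 2}. (\<xi> ^ dlog k) ^ i) = 0" by (simp add: geometric_sum)
  then show ?thesis using assms False by (simp add: alpha power_mult[symmetric] mult.commute)
qed

text \<open>Off \<open>P\<close>, the contributions of \<open>Mu 1\<close> and \<open>Mu (- 1)\<close> cancel. On elements of \<open>P\<close> with \<open>t = 0\<close>, those
  of \<open>Mu\<close> and \<open>Chi\<close> combine, by \<open>q = 3 m\<^sup>2\<close>, to \<open>q (q - 1)\<close> times the real part of the Gauss sum; on
  the other elements of \<open>P\<close> they cancel because \<open>Chi = - Mu\<close> there.\<close>

lemma sum_table:
  assumes "k \<noteq> 0"
  shows "(\<Sum>f\<in>table. f \<one> * f (e s r z k)) =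
    (if k = 1 \<and> s = 0 \<and> r = 0 \<and> z = 0 then Q ^ 3 * (Q - 1) else 0)"
proof -
  let ?g = "e s r z k"
  let ?nl = "(Q - 1) * Lam ?g + M * (Q - 1) / 2 * (Mu 1 ?g + cnj (Mu 1 ?g))
      + M * (Q - 1) / 2 * (Mu (- 1) ?g + cnj (Mu (- 1) ?g))
      + M * (Q - 1) * (Chi ?g + cnj (Chi ?g)) + Q * (Q - 1) * Psi ?g"
  have "(\<Sum>f\<in>table. f \<one> * f ?g) =
      (\<Sum>f\<in>alpha ` {0..q - 2}. f \<one> * f ?g) + (\<Sum>f\<in>set nonlinear. f \<one> * f ?g)"
    unfolding table_def using alpha_nonlinear by (intro sum.union_disjoint) auto
  also have "(\<Sum>f\<in>alpha ` {0..q - 2}. f \<one> * f ?g) = (\<Sum>i\<in>{0..q - 2}. alpha i ?g)"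
    using alpha_inj by (simp add: sum.reindex alpha e_one[symmetric])
  also have "\<dots> = (if k = 1 then Q - 1 else 0)" by (rule sum_alpha[OF assms])
  also have "(\<Sum>f\<in>set nonlinear. f \<one> * f ?g) = sum_list (map (\<lambda>f. f \<one> * f ?g) nonlinear)"
    by (rule sum_list_distinct_conv_sum_set[OF distinct_nonlinear, symmetric])
  also have "\<dots> = ?nl"
    using assms
    by (simp add: nonlinear_def Lam_value[of 1 0 0 0] Mu_value[of 1 _ 0 0 0] Chi_value[of 1 0 0 0]
        Psi_value[of 1 0 0 0] gauss_values Q_q distrib_left flip: e_one)
  finally have S: "(\<Sum>f\<in>table. f \<one> * f ?g) = (if k = 1 then Q - 1 else 0) + ?nl" .
  show ?thesis
  proof (cases "k = 1")
    case False
    then show ?thesis unfolding S using assms one_neq_minus_one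
      by (simp add: Lam_value Mu_value Chi_value Psi_value field_simps)
  next
    case k: True
    show ?thesis
    proof (cases "s = 0")
      case False
      then show ?thesis unfolding S using k
        by (simp add: Lam_value Mu_value Chi_value Psi_value field_simps)
    next
      case s: True
      have "(\<Sum>f\<in>table. f \<one> * f ?g) = (Q - 1) + (Q - 1) * (Q - 1)
          + (3 * M * M) * (Q - 1) / 2 * (gauss r + cnj (gauss r)) + Q * (Q - 1) * Psi ?g"
        unfolding S using k s by (simp add: Lam_value Mu_value Chi_value field_simps)
      also have "\<dots> = (Q - 1) + (Q - 1) * (Q - 1)
          + Q * (Q - 1) / 2 * (if r = 0 then 2 * (Q - 1) else - 2) + Q * (Q - 1) * Psi ?g"
        unfolding gauss_plus_cnj Q_nz(2)[symmetric] ..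
      also have "\<dots> = (if r = 0 \<and> z = 0 then Q ^ 3 * (Q - 1) else 0)"
        using k s by (simp add: Psi_value power3_eq_cube field_simps)
      finally show ?thesis using k s by simp
    qed
  qed
qed

lemma irr_characters_table: "irr_characters N = table"
proof (rule irr_characters_eqI[OF group_N finite_N])
  show "table \<subseteq> irr_characters N" using nonlinear_irr alpha(1) by (auto simp: table_def)
  show "(\<Sum>f\<in>table. f \<one>\<^bsub>N\<^esub> * f g) = 0" if "g \<in> carrier N" "g \<noteq> \<one>\<^bsub>N\<^esub>" for g
    using that by (auto simp: carrier_N sum_table e_one)
  show "(\<Sum>f\<in>table. f \<one>\<^bsub>N\<^esub> * f \<one>\<^bsub>N\<^esub>) \<noteq> 0"
    using sum_table[of 1 0 0 0] Q_nz(1) Q_neq_1 by (simp add: e_one)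
qed

lemma card_table: "card table = q + 7"
proof -
  have "card table = card (alpha ` {0..q - 2}) + card (set nonlinear)"
    unfolding table_def using alpha_nonlinear by (intro card_Un_disjoint) auto
  also have "card (alpha ` {0..q - 2}) = q - 1" using alpha_inj q_ge by (simp add: card_image)
  also have "card (set nonlinear) = 8"
    using distinct_card[OF distinct_nonlinear] by (simp add: nonlinear_def)
  finally show ?thesis using q_ge by simp
qed

subsection \<open>The list of classes\<close>

abbreviation om_std :: complex where "om_std \<equiv> exp (2 * of_real pi * \<i> / 3)"

lemma om_std: "om_std \<in> {om, cnj om}" "cnj om_std \<in> {om, cnj om}"
  "phi r = 1 \<or> phi r = om_std \<or> phi r = cnj om_std"
  "om_std \<noteq> 1" "cnj om_std \<noteq> 1" "om_std \<noteq> cnj om_std" "cnj om_std \<noteq> om_std"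
  using om phi_values[of r] om_neq by auto

definition C_one where "C_one = slice (\<lambda>s r z. s = 0 \<and> r = 0 \<and> z = 0) 1"
definition C_X where "C_X = slice (\<lambda>s r z. s = 0 \<and> r = 0 \<and> z \<noteq> 0) 1"
definition C_T where "C_T c = slice (\<lambda>s r z. s = 0 \<and> c * r \<in> Sq) 1"
definition C_Y where "C_Y y = slice (\<lambda>s r z. s \<noteq> 0 \<and> phi (r / (s * S s)) = y) 1"
definition C_J where "C_J = slice (\<lambda>_ r _. r = 0) (- 1)"
definition C_JT where "C_JT c = slice (\<lambda>_ r _. c * r \<in> Sq) (- 1)"
definition C_K where "C_K k = slice (\<lambda>_ _ _. True) k"

lemmas C_defs = C_one_def C_X_def C_T_def C_Y_def C_J_def C_JT_def C_K_def

lemma C_reps: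
  "C_one = conj_class N (e 0 0 0 1)" "C_X = conj_class N (e 0 0 1 1)"
  "c = 1 \<or> c = - 1 \<Longrightarrow> C_T c = conj_class N (e 0 c 0 1)"
  "C_Y (phi r) = conj_class N (e 1 r 0 1)"
  "C_J = conj_class N (e 0 0 0 (- 1))"
  "c = 1 \<or> c = - 1 \<Longrightarrow> C_JT c = conj_class N (e 0 c 0 (- 1))"
  "k \<noteq> 0 \<Longrightarrow> k \<noteq> 1 \<Longrightarrow> k \<noteq> - 1 \<Longrightarrow> C_K k = conj_class N (e 0 0 0 k)"
  by (simp_all add: C_defs class_one class_X class_T class_Y class_J0 class_JT class_K)

lemma phi_surj: "y \<in> {1, om_std, cnj om_std} \<Longrightarrow> \<exists>r. phi r = y"
proof -
  obtain a where "phi a = om" using phi_om by auto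
  then have "phi 0 = 1" "phi a = om" "phi (- a) = cnj om" by (simp_all add: phi_minus)
  then have "\<forall>y\<in>{1, om, cnj om}. \<exists>r. phi r = y" by blast
  then show "y \<in> {1, om_std, cnj om_std} \<Longrightarrow> \<exists>r. phi r = y" using om_std by blast
qed

definition class_list :: "'a set list" where
  "class_list = [C_one, C_X, C_T 1, C_T (- 1), C_Y 1, C_Y (cnj om_std), C_Y om_std, C_J, C_JT (- 1), C_JT 1]"

definition reg_idx :: "nat set" where "reg_idx = {1..q - 2} - {(q - 1) div 2}"

lemma reg_idx_iff: "j \<in> reg_idx \<longleftrightarrow> j < q - 1 \<and> j \<noteq> 0 \<and> j \<noteq> card Sq"
  unfolding reg_idx_def q_half(2) using q_ge by auto

lemma g0_power_reg_idx: "j \<in> reg_idx \<Longrightarrow> g0 ^ j \<noteq> 0 \<and> g0 ^ j \<noteq> 1 \<and> g0 ^ j \<noteq> - 1"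
  using g0 g0_power_eq_1[of j] g0_power_half[of j] by (simp add: reg_idx_iff)

lemma classes_are_classes:
  assumes "C \<in> set class_list \<union> (\<lambda>j. C_K (g0 ^ j)) ` reg_idx"
  shows "\<exists>a\<in>carrier N. C = conj_class N a"
proof -
  have Y: "\<exists>a\<in>carrier N. C_Y y = conj_class N a" if "y \<in> {1, om_std, cnj om_std}" for y
    using phi_surj[OF that] C_reps(4) e_N[of 1] by (metis zero_neq_one)
  from assms consider "C = C_one" | "C = C_X" | "C = C_T 1" | "C = C_T (- 1)" | y where "y \<in> {1, om_std, cnj om_std}" "C = C_Y y"
    | "C = C_J" | "C = C_JT (- 1)" | "C = C_JT 1" | j where "j \<in> reg_idx" "C = C_K (g0 ^ j)"
    unfolding class_list_def by auto
  then show ?thesis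
  proof cases
    case 5
    then show ?thesis using Y by simp
  next
    case 9
    then show ?thesis using C_reps(7) g0_power_reg_idx[of j] by (intro bexI[of _ "e 0 0 0 (g0 ^ j)"]) auto
  qed (use C_reps(1,2,3,5,6) in \<open>auto intro!: e_N bexI\<close>)
qed

lemma classes_cover:
  assumes "a \<in> carrier N"
  shows "\<exists>C\<in>set class_list \<union> (\<lambda>j. C_K (g0 ^ j)) ` reg_idx. a \<in> C"
proof -
  obtain s r z k where a: "k \<noteq> 0" "a = e s r z k" using assms by (auto simp: carrier_N)
  consider "k = 1" | "k = - 1" | "k \<noteq> 1" "k \<noteq> - 1" by blast
  then show ?thesis
  proof cases
    case 1
    then show ?thesis using a om_std(3)[of "r / (s * S s)"] nz_cases[of r]
      by (cases "s = 0"; cases "r = 0"; cases "z = 0") (auto simp: class_list_def C_defs)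
  next
    case 2
    then show ?thesis using a nz_cases[of r] by (cases "r = 0") (auto simp: class_list_def C_defs)
  next
    case 3
    have "dlog k \<noteq> 0" using dlog(2)[OF a(1)] 3 by (metis power_0)
    moreover have "dlog k \<noteq> card Sq" using dlog[OF a(1)] 3 g0_power_half[of "dlog k"] by metis
    ultimately have "dlog k \<in> reg_idx" using dlog(1)[OF a(1)] by (simp add: reg_idx_iff)
    moreover have "a \<in> C_K (g0 ^ dlog k)" using a dlog[OF a(1)] by (simp add: C_defs)
    ultimately show ?thesis by blast
  qed
qed

lemma conj_classes_N: "conj_classes N = set class_list \<union> (\<lambda>j. C_K (g0 ^ j)) ` reg_idx"
  by (rule conj_classes_eqI[OF group_N classes_cover classes_are_classes])

text \<open>A function that is constant on every class and separates the classes, so that they can be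
  counted.\<close>

definition label :: "'a \<Rightarrow> complex" where
  "label = by_coords (\<lambda>s r z k.
     if k = 1 then
       if s = 0 then if r = 0 then if z = 0 then 0 else 1 else if r \<in> Sq then 2 else 3
       else if phi (r / (s * S s)) = 1 then 4 else if phi (r / (s * S s)) = cnj om_std then 5 else 6
     else if k = - 1 then if r = 0 then 7 else if r \<in> Sq then 9 else 8
     else 10)"

lemma label_image:
  assumes "k \<noteq> 0" "P s r z" "\<And>s r z. P s r z \<Longrightarrow> label (e s r z k) = i"
  shows "label ` slice P k = {i}"
  using assms by (auto simp: slice_def image_iff)

lemma labels: "map ((`) label) class_list = [{0}, {1}, {2}, {3}, {4}, {5}, {6}, {7}, {8}, {9}]"
  and label_K: "j \<in> reg_idx \<Longrightarrow> label ` C_K (g0 ^ j) = {10}"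
proof -
  note lab = label_def
  have Sq: "r \<noteq> 0" "- r \<notin> Sq" if "r \<in> Sq" for r using that Sq_nz minus_Sq by auto
  have Sq': "r \<noteq> 0" "r \<notin> Sq" if "- r \<in> Sq" for r using that Sq_nz minus_Sq[of r] by auto
  obtain r1 r2 where r: "phi r1 = cnj om_std" "phi r2 = om_std" using phi_surj by blast
  have "label ` C_one = {0}" unfolding C_defs by (rule label_image[of _ _ 0 0 0]) (auto simp: lab)
  moreover have "label ` C_X = {1}" unfolding C_defs by (rule label_image[of _ _ 0 0 1]) (auto simp: lab)
  moreover have "label ` C_T 1 = {2}" unfolding C_defs by (rule label_image[of _ _ 0 1 0]) (auto simp: lab Sq)
  moreover have "label ` C_T (- 1) = {3}" unfolding C_defs by (rule label_image[of _ _ 0 "- 1" 0]) (auto simp: lab Sq')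
  moreover have "label ` C_Y 1 = {4}" unfolding C_defs by (rule label_image[of _ _ 1 0 0]) (auto simp: lab)
  moreover have "label ` C_Y (cnj om_std) = {5}" unfolding C_defs
    by (rule label_image[of _ _ 1 r1 0]) (use r om_std in \<open>auto simp: lab\<close>)
  moreover have "label ` C_Y om_std = {6}" unfolding C_defs
    by (rule label_image[of _ _ 1 r2 0]) (use r om_std in \<open>auto simp: lab\<close>)
  moreover have "label ` C_J = {7}" unfolding C_defs
    by (rule label_image[of _ _ 0 0 0]) (use one_neq_minus_one in \<open>auto simp: lab\<close>)
  moreover have "label ` C_JT (- 1) = {8}" unfolding C_defs
    by (rule label_image[of _ _ 0 "- 1" 0]) (use one_neq_minus_one in \<open>auto simp: lab Sq'\<close>)
  moreover have "label ` C_JT 1 = {9}" unfolding C_defs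
    by (rule label_image[of _ _ 0 1 0]) (use one_neq_minus_one in \<open>auto simp: lab Sq\<close>)
  ultimately show "map ((`) label) class_list = [{0}, {1}, {2}, {3}, {4}, {5}, {6}, {7}, {8}, {9}]"
    by (simp add: class_list_def)
  show "label ` C_K (g0 ^ j) = {10}" if "j \<in> reg_idx"
    unfolding C_defs by (rule label_image[of _ _ 0 0 0]) (use g0_power_reg_idx[OF that] in \<open>auto simp: lab\<close>)
qed

lemma distinct_classes: "distinct class_list"
proof -
  have "distinct (map ((`) label) class_list)" unfolding labels by simp
  then show ?thesis by (simp add: distinct_map)
qed

lemma card_conj_classes: "card (conj_classes N) = q + 7"
proof -
  have "set class_list \<inter> (\<lambda>j. C_K (g0 ^ j)) ` reg_idx = {}"
  proof -
    have "(`) label ` set class_list \<inter> {{10}} = {}"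
      unfolding set_map[symmetric] labels by simp
    then show ?thesis using label_K by blast
  qed
  then have "card (conj_classes N) = card (set class_list) + card ((\<lambda>j. C_K (g0 ^ j)) ` reg_idx)"
    unfolding conj_classes_N by (intro card_Un_disjoint) (auto simp: reg_idx_def)
  also have "card (set class_list) = 10"
    using distinct_card[OF distinct_classes] by (simp add: class_list_def)
  also have "card ((\<lambda>j. C_K (g0 ^ j)) ` reg_idx) = card reg_idx"
  proof (rule card_image, rule inj_onI)
    fix i j assume ij: "i \<in> reg_idx" "j \<in> reg_idx" "C_K (g0 ^ i) = C_K (g0 ^ j)"
    have "e 0 0 0 (g0 ^ i) \<in> C_K (g0 ^ j)" unfolding ij(3)[symmetric] using g0 by (simp add: C_defs)
    then have "g0 ^ i = g0 ^ j" using g0 by (simp add: C_defs)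
    then show "i = j" using g0_power_inj ij by (auto simp: inj_on_def reg_idx_iff)
  qed
  also have "card reg_idx = q - 3"
    unfolding reg_idx_def using q_half q_ge by (subst card_Diff_singleton) auto
  finally show ?thesis using q_ge by simp
qed

subsection \<open>Centralisers\<close>

lemma card_scaled_Sq: "c = 1 \<or> c = - 1 \<Longrightarrow> card {r. c * r \<in> Sq} = card Sq"
proof -
  assume c: "c = 1 \<or> c = - 1"
  then have cc: "c * (c * r) = r" for r by auto
  show ?thesis
    by (rule bij_betw_same_card[of "\<lambda>r. c * r"], rule bij_betw_byWitness[where f'="\<lambda>r. c * r"])
      (auto simp: cc)
qed

lemma centralizers:
  shows "g \<in> C_one \<Longrightarrow> card (centralizer N g) = q ^ 3 * (q - 1)"
    and "g \<in> C_X \<Longrightarrow> card (centralizer N g) = q ^ 3"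
    and "c = 1 \<or> c = - 1 \<Longrightarrow> g \<in> C_T c \<Longrightarrow> card (centralizer N g) = 2 * q ^ 2"
    and "y \<in> {1, om_std, cnj om_std} \<Longrightarrow> g \<in> C_Y y \<Longrightarrow> card (centralizer N g) = 3 * q"
    and "g \<in> C_J \<Longrightarrow> card (centralizer N g) = q * (q - 1)"
    and "c = 1 \<or> c = - 1 \<Longrightarrow> g \<in> C_JT c \<Longrightarrow> card (centralizer N g) = 2 * q"
    and "j \<in> reg_idx \<Longrightarrow> g \<in> C_K (g0 ^ j) \<Longrightarrow> card (centralizer N g) = q - 1"
proof -
  note qb = q_half(1)
  have key: "card (centralizer N g) = d"
    if "k \<noteq> 0" "conj_class N (e s r z k) = slice P k" "g \<in> slice P k"
      "card {(s, r, z). P s r z} * d = q ^ 3 * (q - 1)" "q ^ 3 * (q - 1) \<noteq> 0" for k s r z P d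
  proof -
    have "card {(s, r, z). P s r z} * card (centralizer N g) = card {(s, r, z). P s r z} * d"
      using card_centralizer_slice[OF that(1-3)] that(4) CARD_q by simp
    moreover have "card {(s, r, z). P s r z} \<noteq> 0" using that(4,5) by (metis mult_eq_0_iff)
    ultimately show ?thesis by simp
  qed
  have nz': "q ^ 3 * (q - 1) \<noteq> 0" using q_ge by simp
  show "g \<in> C_one \<Longrightarrow> card (centralizer N g) = q ^ 3 * (q - 1)"
    unfolding C_defs
  proof (rule key[OF _ class_one])
    have "{(s :: 'f, r :: 'f, z :: 'f). s = 0 \<and> r = 0 \<and> z = 0} = {(0 :: 'f, 0 :: 'f, 0)}" by auto
    then show "card {(s :: 'f, r :: 'f, z :: 'f). s = 0 \<and> r = 0 \<and> z = 0} * (q ^ 3 * (q - 1)) = q ^ 3 * (q - 1)" by simp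
  qed (use nz' in auto)
  show "g \<in> C_X \<Longrightarrow> card (centralizer N g) = q ^ 3"
    unfolding C_defs
  proof (rule key[OF _ class_X])
    have 1: "{(s :: 'f, r :: 'f, z :: 'f). s = 0 \<and> r = 0 \<and> z \<noteq> 0} = {0 :: 'f} \<times> {0 :: 'f} \<times> nz" by auto
    have 2: "card ({0 :: 'f} \<times> {0 :: 'f} \<times> nz) = card nz"
      unfolding card_cartesian_product by simp
    have "card {(s :: 'f, r :: 'f, z :: 'f). s = 0 \<and> r = 0 \<and> z \<noteq> 0} = q - 1"
      by (simp only: 1 2 card_nz q)
    then show "card {(s :: 'f, r :: 'f, z :: 'f). s = 0 \<and> r = 0 \<and> z \<noteq> 0} * q ^ 3 = q ^ 3 * (q - 1)" by simp
  qed (use nz' in auto)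
  show "card (centralizer N g) = 2 * q ^ 2" if c: "c = 1 \<or> c = - 1" and g: "g \<in> C_T c"
  proof (rule key[OF _ class_T[OF c] g[unfolded C_defs]])
    have "{(s, r, z). s = (0 :: 'f) \<and> c * r \<in> Sq} = {0 :: 'f} \<times> {r. c * r \<in> Sq} \<times> (UNIV :: 'f set)" by auto
    then have "card {(s, r, z :: 'f). s = (0 :: 'f) \<and> c * r \<in> Sq} = card Sq * q"
      by (simp add: card_cartesian_product card_scaled_Sq[OF c] CARD_q)
    then show "card {(s, r, z :: 'f). s = (0 :: 'f) \<and> c * r \<in> Sq} * (2 * q\<^sup>2) = q ^ 3 * (q - 1)"
      unfolding qb by (simp add: power2_eq_square power3_eq_cube)
  qed (use nz' in auto)
  show "card (centralizer N g) = 3 * q" if y: "y \<in> {1, om_std, cnj om_std}" and "g \<in> C_Y y"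
  proof -
    obtain r where r: "phi r = y" using phi_surj[OF y] by blast
    have "y \<in> {1, om, cnj om}" using y om_std by auto
    note cy = card_phi_eq[OF this]
    have "card {r'. phi (r' / (s * S s)) = y} = card {r'. phi r' = y}" if "s \<noteq> 0" for s
      by (rule bij_betw_same_card[of "\<lambda>r'. r' / (s * S s)"], rule bij_betw_byWitness[where f'="\<lambda>r'. r' * (s * S s)"])
        (use that in auto)
    moreover have "{(s, r', z :: 'f). s \<noteq> 0 \<and> phi (r' / (s * S s)) = y} =
        Sigma nz (\<lambda>s. {r'. phi (r' / (s * S s)) = y} \<times> (UNIV :: 'f set))" by auto
    ultimately have "card {(s, r', z :: 'f). s \<noteq> 0 \<and> phi (r' / (s * S s)) = y} = card nz * (3 ^ (2 * n) * q)"
      by (simp add: card_SigmaI card_cartesian_product cy CARD_q del: card_Diff_insert)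
    then have "card {(s, r', z :: 'f). s \<noteq> 0 \<and> phi (r' / (s * S s)) = y} = (q - 1) * (3 ^ (2 * n) * q)"
      unfolding card_nz q .
    moreover have "(q - 1) * (3 ^ (2 * n) * q) * (3 * q) = q ^ 3 * (q - 1)"
    proof -
      have "3 * 3 ^ (2 * n) = q" by (simp add: q)
      then show ?thesis by (metis mult.assoc mult.commute power3_eq_cube)
    qed
    ultimately have card: "card {(s, r', z :: 'f). s \<noteq> 0 \<and> phi (r' / (s * S s)) = y} * (3 * q) = q ^ 3 * (q - 1)"
      by simp
    show ?thesis
      by (rule key[OF _ class_Y[of r]]) (use that(2) nz' card in \<open>auto simp: C_defs r\<close>)
  qed
  show "g \<in> C_J \<Longrightarrow> card (centralizer N g) = q * (q - 1)"
    unfolding C_defs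
  proof (rule key[OF _ class_J0])
    have "{(s :: 'f, r :: 'f, z :: 'f). r = 0} = UNIV \<times> {0} \<times> UNIV" by auto
    then show "card {(s :: 'f, r :: 'f, z :: 'f). r = 0} * (q * (q - 1)) = q ^ 3 * (q - 1)"
      by (simp add: card_cartesian_product CARD_q power3_eq_cube)
  qed (use nz' in auto)
  show "card (centralizer N g) = 2 * q" if c: "c = 1 \<or> c = - 1" and g: "g \<in> C_JT c"
  proof (rule key[OF _ class_JT[OF c] g[unfolded C_defs]])
    have "{(s :: 'f, r, z :: 'f). c * r \<in> Sq} = UNIV \<times> {r. c * r \<in> Sq} \<times> UNIV" by auto
    then have "card {(s :: 'f, r, z :: 'f). c * r \<in> Sq} = q * (card Sq * q)"
      by (simp add: card_cartesian_product card_scaled_Sq[OF c] CARD_q)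
    then show "card {(s :: 'f, r, z :: 'f). c * r \<in> Sq} * (2 * q) = q ^ 3 * (q - 1)"
      unfolding qb by (simp add: power3_eq_cube)
  qed (use nz' in auto)
  show "card (centralizer N g) = q - 1" if j: "j \<in> reg_idx" and g: "g \<in> C_K (g0 ^ j)"
  proof (rule key[OF _ class_K g[unfolded C_defs]])
    have "{(s :: 'f, r :: 'f, z :: 'f). True} = UNIV \<times> UNIV \<times> UNIV" by auto
    then show "card {(s :: 'f, r :: 'f, z :: 'f). True} * (q - 1) = q ^ 3 * (q - 1)"
      by (simp add: card_cartesian_product CARD_q power3_eq_cube)
  qed (use nz' g0_power_reg_idx[OF j] in auto)
qed

lemma centralizer_table:
  "table_row (\<lambda>g. card (centralizer N g))
     [C_one, C_X, C_T 1, C_T (- 1), C_Y 1, C_Y (cnj om_std), C_Y om_std, C_J, C_JT (- 1), C_JT 1]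
     [q ^ 3 * (q - 1), q ^ 3, 2 * q ^ 2, 2 * q ^ 2, 3 * q, 3 * q, 3 * q, q * (q - 1), 2 * q, 2 * q]" (is ?t1)
  "\<forall>j\<in>reg_idx. table_row (\<lambda>g. card (centralizer N g)) [C_K (g0 ^ j)] [q - 1]" (is ?t2)
proof -
  have *: "1 = (1 :: 'f) \<or> 1 = (- 1 :: 'f)" "- 1 = (1 :: 'f) \<or> - 1 = (- 1 :: 'f)"
    "1 \<in> {1, om_std, cnj om_std}" "om_std \<in> {1, om_std, cnj om_std}" "cnj om_std \<in> {1, om_std, cnj om_std}" by simp_all
  note facts = centralizers(1,2,5) centralizers(3)[OF *(1)] centralizers(3)[OF *(2)]
    centralizers(4)[OF *(3)] centralizers(4)[OF *(4)] centralizers(4)[OF *(5)]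
    centralizers(6)[OF *(1)] centralizers(6)[OF *(2)]
  show ?t1 unfolding table_row_def by (simp add: facts)
  show ?t2 unfolding table_row_def using centralizers(7) by simp
qed

subsection \<open>The classes and characters in the original coordinates\<close>

lemma C_statement:
  "{\<one>} = C_one" "{x 0 0 v | v. v \<noteq> 0} = C_X"
  "conj_class N (h (- 1)) = C_J"
  "conj_class N (x 0 (- 1) 0 \<otimes> h (- 1)) = C_JT (- 1)"
  "conj_class N (x 0 1 0 \<otimes> h (- 1)) = C_JT 1"
  "ree_P x #> (h g0 [^] (j :: nat)) = C_K (g0 ^ j)"
proof -
  show "{\<one>} = C_one" by (simp add: C_defs slice_def e_one)
  show "{x 0 0 v | v. v \<noteq> 0} = C_X" by (auto simp: C_defs slice_def x_eq_e)
  have "h (- 1) = e 0 0 0 (- 1)" by (simp add: e_def p_0)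
  then show "conj_class N (h (- 1)) = C_J" by (simp add: C_reps)
  have "x 0 c 0 \<otimes> h (- 1) = e 0 c 0 (- 1)" for c by (simp add: e_def p_def)
  then show "conj_class N (x 0 (- 1) 0 \<otimes> h (- 1)) = C_JT (- 1)" "conj_class N (x 0 1 0 \<otimes> h (- 1)) = C_JT 1"
    by (simp_all add: C_reps)
  show "ree_P x #> (h g0 [^] j) = C_K (g0 ^ j)"
    using g0 unfolding h_power[OF g0] ree_P_eq C_defs slice_def e_def r_coset_def by blast
qed

lemma T_union: "C_T 1 \<union> C_T (- 1) = {x 0 u v | u v. u \<noteq> 0}"
proof (intro equalityI subsetI)
  fix a assume "a \<in> C_T 1 \<union> C_T (- 1)"
  then obtain u v where "u \<in> Sq \<or> - u \<in> Sq" and a: "a = e 0 u v 1" by (auto simp: C_defs slice_def)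
  then have "u \<noteq> 0" using Sq_nz by auto
  then show "a \<in> {x 0 u v | u v. u \<noteq> 0}" unfolding a by (auto simp: e_def p_def h_1)
next
  fix a assume "a \<in> {x 0 u v | u v. u \<noteq> 0}"
  then obtain u v where "u \<noteq> 0" "a = x 0 u v" by auto
  then show "a \<in> C_T 1 \<union> C_T (- 1)"
    using nz_cases by (simp add: x_eq_e C_defs)
qed

lemma T_inverse: "C_T (- 1) = {inv g | g. g \<in> C_T 1}"
proof -
  have inv: "inv (e 0 r z 1) = e 0 (- r) (- z) 1" for r z
    by (rule inv_equality) (simp_all add: e_mult mul_u_def mul_v_def cocycle_def e_one)
  show ?thesis
  proof (intro equalityI subsetI)
    fix a assume "a \<in> C_T (- 1)"
    then obtain r z where "- r \<in> Sq" "a = e 0 r z 1" by (auto simp: C_defs slice_def)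
    then have "a = inv (e 0 (- r) (- z) 1)" "e 0 (- r) (- z) 1 \<in> C_T 1" by (simp_all add: inv C_defs)
    then show "a \<in> {inv g | g. g \<in> C_T 1}" by blast
  next
    fix a assume "a \<in> {inv g | g. g \<in> C_T 1}"
    then obtain r z where "r \<in> Sq" "a = inv (e 0 r z 1)" by (auto simp: C_defs slice_def)
    then show "a \<in> C_T (- 1)" by (simp add: inv C_defs)
  qed
qed

lemma Y_union: "C_Y 1 \<union> C_Y (cnj om_std) \<union> C_Y om_std = {x t u v | t u v. t \<noteq> 0}"
proof (intro equalityI subsetI)
  fix a assume "a \<in> C_Y 1 \<union> C_Y (cnj om_std) \<union> C_Y om_std"
  then obtain t u v where "t \<noteq> 0" "a = e t u v 1" by (auto simp: C_defs slice_def)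
  then show "a \<in> {x t u v | t u v. t \<noteq> 0}" by (auto simp: e_def p_def h_1)
next
  fix a assume "a \<in> {x t u v | t u v. t \<noteq> 0}"
  then obtain t u v where "t \<noteq> 0" "a = x t u v" by auto
  then show "a \<in> C_Y 1 \<union> C_Y (cnj om_std) \<union> C_Y om_std"
    using om_std(3) by (auto simp: x_eq_e C_defs)
qed

lemma ball_slice: "(\<forall>g\<in>slice P k. R g) \<longleftrightarrow> (\<forall>s r z. P s r z \<longrightarrow> R (e s r z k))"
  by (auto simp: slice_def)

abbreviation P_classes :: "'a set list" where
  "P_classes \<equiv> [C_one, C_X, C_T 1, C_T (- 1), C_Y 1, C_Y (cnj om_std), C_Y om_std]"

abbreviation other_classes :: "nat \<Rightarrow> 'a set list" where
  "other_classes j \<equiv> [C_K (g0 ^ j), C_J, C_JT (- 1), C_JT 1]"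

lemma alpha_table:
  "table_row (alpha i) P_classes [1, 1, 1, 1, 1, 1, 1]" (is ?P)
  "j \<in> reg_idx \<Longrightarrow> table_row (alpha i) (other_classes j) [\<xi> ^ (i * j), (- 1) ^ i, (- 1) ^ i, (- 1) ^ i]"
    (is "_ \<Longrightarrow> ?J")
proof -
  have "\<xi> ^ (i * card Sq) = (- 1) ^ i" by (metis mult.commute power_mult xi_half)
  moreover have "dlog (g0 ^ j) = j" if "j \<in> reg_idx" using that by (intro dlog_power) (simp add: reg_idx_iff)
  ultimately show "j \<in> reg_idx \<Longrightarrow> ?J"
    using g0 by (simp add: table_row_def C_defs ball_slice alpha)
  show ?P by (simp add: table_row_def C_defs ball_slice alpha)
qed

lemma Lam_table:
  "table_row Lam P_classes
     [Q - 1, Q - 1, Q - 1, Q - 1, - 1, - 1, - 1]"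
  "j \<in> reg_idx \<Longrightarrow> table_row Lam (other_classes j) [0, 0, 0, 0]"
  using g0_power_reg_idx[of j] one_neq_minus_one
  by (simp_all add: table_row_def C_defs ball_slice Lam_value)

lemma Psi_table:
  "table_row Psi P_classes
     [Q * (Q - 1), - Q, 0, 0, 0, 0, 0]"
  "j \<in> reg_idx \<Longrightarrow> table_row Psi (other_classes j) [0, 0, 0, 0]"
  using g0_power_reg_idx[of j] one_neq_minus_one Sq_nz
  by (auto simp: table_row_def C_defs ball_slice Psi_value)

lemma Mu_table:
  "table_row (Mu \<eta>) P_classes
     [M * (Q - 1) / 2, M * (Q - 1) / 2, (- M + M ^ 2 * csqrt (- 3)) / 2,
      (- M - M ^ 2 * csqrt (- 3)) / 2, M, M * cnj om_std, M * om_std]"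
  "table_row (conj_char N (Mu \<eta>)) P_classes
     [M * (Q - 1) / 2, M * (Q - 1) / 2, (- M - M ^ 2 * csqrt (- 3)) / 2,
      (- M + M ^ 2 * csqrt (- 3)) / 2, M, M * om_std, M * cnj om_std]"
  by (auto simp: table_row_def C_defs ball_slice Mu_value gauss_values power2_eq_square field_simps
      csqrt_m3 Q_q)

lemma Mu_table_J:
  assumes "j \<in> reg_idx"
  shows "table_row (Mu 1) (other_classes j)
     [0, (Q - 1) / 2, (- 1 - M * csqrt (- 3)) / 2, (- 1 + M * csqrt (- 3)) / 2]"
  "table_row (Mu (- 1)) (other_classes j)
     [0, - ((Q - 1) / 2), (1 + M * csqrt (- 3)) / 2, (1 - M * csqrt (- 3)) / 2]"
  "table_row (conj_char N (Mu 1)) (other_classes j)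
     [0, (Q - 1) / 2, (- 1 + M * csqrt (- 3)) / 2, (- 1 - M * csqrt (- 3)) / 2]"
  "table_row (conj_char N (Mu (- 1))) (other_classes j)
     [0, - ((Q - 1) / 2), (1 - M * csqrt (- 3)) / 2, (1 + M * csqrt (- 3)) / 2]"
  using g0_power_reg_idx[OF assms] one_neq_minus_one
  by (auto simp: table_row_def C_defs ball_slice Mu_value gauss_values csqrt_m3 Q_q field_simps)

lemma Chi_table:
  "table_row Chi P_classes
     [M * (Q - 1), M * (Q - 1), - M + M ^ 2 * csqrt (- 3),
      - M - M ^ 2 * csqrt (- 3), - M, - M * cnj om_std, - M * om_std]"
  "table_row (conj_char N Chi) P_classes
     [M * (Q - 1), M * (Q - 1), - M - M ^ 2 * csqrt (- 3),
      - M + M ^ 2 * csqrt (- 3), - M, - M * om_std, - M * cnj om_std]"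
  "j \<in> reg_idx \<Longrightarrow> table_row Chi (other_classes j) [0, 0, 0, 0]"
  "j \<in> reg_idx \<Longrightarrow> table_row (conj_char N Chi) (other_classes j) [0, 0, 0, 0]"
  using g0_power_reg_idx[of j] one_neq_minus_one
  by (auto simp: table_row_def C_defs ball_slice Chi_value gauss_values power2_eq_square field_simps
      csqrt_m3 Q_q)

end

theorem theorem2p6:
  fixes G :: "('a, 'b) monoid_scheme"
    and x :: "'f::{field, finite} \<Rightarrow> 'f \<Rightarrow> 'f \<Rightarrow> 'a" and h :: "'f \<Rightarrow> 'a"
    and N :: "('a, 'b) monoid_scheme" and P :: "'a set" and c :: 'a
    and n q m :: nat and Q M \<omega> \<xi> s :: complex
  assumes ree: "ree_group G n x h"
    and q: "q = 3 ^ (2 * n + 1)" and m: "m = 3 ^ n"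
    and Q: "Q = of_nat q" and M: "M = of_nat m"
    and P: "P = ree_P x"
    and N: "N = ree_N G x"
    and c: "c \<in> ree_W h" "generate G {c} = ree_W h"
    and \<omega>: "\<omega> = exp (2 * of_real pi * \<i> / 3)"
    and s: "s = csqrt (- 3)"
    and \<xi>: "\<xi> ^ (q - 1) = 1" "\<And>k. 0 < k \<Longrightarrow> k < q - 1 \<Longrightarrow> \<xi> ^ k \<noteq> 1"
  shows
   "let I = {1..q - 2} - {(q - 1) div 2};
        K = (\<lambda>j. P #>\<^bsub>G\<^esub> (c [^]\<^bsub>G\<^esub> j));
        E = {\<one>\<^bsub>G\<^esub>};
        X = {x 0 0 v | v. v \<noteq> 0};
        J = conj_class N (h (- 1));
        JT = conj_class N (x 0 (- 1) 0 \<otimes>\<^bsub>G\<^esub> h (- 1));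
        JT' = conj_class N (x 0 1 0 \<otimes>\<^bsub>G\<^esub> h (- 1))
    in
    \<exists>T T' Y YT YT'.
      \<comment> \<open>the labelling of the classes\<close>
      T \<in> conj_classes N \<and> T' \<in> conj_classes N \<and> T \<noteq> T' \<and>
      T' = {inv\<^bsub>G\<^esub> g | g. g \<in> T} \<and>
      T \<union> T' = {x 0 u v | u v. u \<noteq> 0} \<and>
      Y \<in> conj_classes N \<and> YT \<in> conj_classes N \<and> YT' \<in> conj_classes N \<and>
      distinct [Y, YT, YT'] \<and>
      Y \<union> YT \<union> YT' = {x t u v | t u v. t \<noteq> 0} \<and>
      conj_classes N = {E, X, T, T', Y, YT, YT', J, JT, JT'} \<union> K ` I \<and>
      card (conj_classes N) = q + 7 \<and>
      \<comment> \<open>the orders of the centralisers\<close>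
      table_row (\<lambda>g. card (centralizer N g))
        [E, X, T, T', Y, YT, YT', J, JT, JT']
        [q ^ 3 * (q - 1), q ^ 3, 2 * q ^ 2, 2 * q ^ 2, 3 * q, 3 * q, 3 * q,
         q * (q - 1), 2 * q, 2 * q] \<and>
      (\<forall>j\<in>I. table_row (\<lambda>g. card (centralizer N g)) [K j] [q - 1]) \<and>
      \<comment> \<open>the irreducible characters\<close>
      (\<exists>\<epsilon>\<in>{1, - 1 :: complex}. \<exists>\<alpha> \<Lambda> \<mu>1 \<mu>2 \<chi> \<psi>.
        irr_characters N =
          \<alpha> ` {0..q - 2} \<union>
          {\<Lambda>, \<mu>1, \<mu>2, conj_char N \<mu>1, conj_char N \<mu>2, \<chi>, conj_char N \<chi>, \<psi>} \<and>
        card (irr_characters N) = q + 7 \<and>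
        \<alpha> 0 = (\<lambda>g\<in>carrier N. 1) \<and>
        \<comment> \<open>values on the classes contained in P\<close>
        (let Cs = [E, X, T, T', Y, YT, YT'] in
          (\<forall>i\<in>{0..q - 2}. table_row (\<alpha> i) Cs [1, 1, 1, 1, 1, 1, 1]) \<and>
          table_row \<Lambda> Cs [Q - 1, Q - 1, Q - 1, Q - 1, - 1, - 1, - 1] \<and>
          table_row \<mu>1 Cs
            [M * (Q - 1) / 2, M * (Q - 1) / 2, (- M + M ^ 2 * s) / 2, (- M - M ^ 2 * s) / 2,
             - \<epsilon> * M, - \<epsilon> * M * cnj \<omega>, - \<epsilon> * M * \<omega>] \<and>
          table_row \<mu>2 Cs
            [M * (Q - 1) / 2, M * (Q - 1) / 2, (- M + M ^ 2 * s) / 2, (- M - M ^ 2 * s) / 2,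
             - \<epsilon> * M, - \<epsilon> * M * cnj \<omega>, - \<epsilon> * M * \<omega>] \<and>
          table_row (conj_char N \<mu>1) Cs
            [M * (Q - 1) / 2, M * (Q - 1) / 2, (- M - M ^ 2 * s) / 2, (- M + M ^ 2 * s) / 2,
             - \<epsilon> * M, - \<epsilon> * M * \<omega>, - \<epsilon> * M * cnj \<omega>] \<and>
          table_row (conj_char N \<mu>2) Cs
            [M * (Q - 1) / 2, M * (Q - 1) / 2, (- M - M ^ 2 * s) / 2, (- M + M ^ 2 * s) / 2,
             - \<epsilon> * M, - \<epsilon> * M * \<omega>, - \<epsilon> * M * cnj \<omega>] \<and>
          table_row \<chi> Cs
            [M * (Q - 1), M * (Q - 1), - M + M ^ 2 * s, - M - M ^ 2 * s,
             \<epsilon> * M, \<epsilon> * M * cnj \<omega>, \<epsilon> * M * \<omega>] \<and>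
          table_row (conj_char N \<chi>) Cs
            [M * (Q - 1), M * (Q - 1), - M - M ^ 2 * s, - M + M ^ 2 * s,
             \<epsilon> * M, \<epsilon> * M * \<omega>, \<epsilon> * M * cnj \<omega>] \<and>
          table_row \<psi> Cs [Q * (Q - 1), - Q, 0, 0, 0, 0, 0]) \<and>
        \<comment> \<open>values on the remaining classes\<close>
        (\<forall>j\<in>I. let Ds = [K j, J, JT, JT'] in
          (\<forall>i\<in>{0..q - 2}. table_row (\<alpha> i) Ds [\<xi> ^ (i * j), (- 1) ^ i, (- 1) ^ i, (- 1) ^ i]) \<and>
          table_row \<Lambda> Ds [0, 0, 0, 0] \<and>
          table_row \<mu>1 Ds
            [0, (Q - 1) / 2, (- 1 - M * s) / 2, (- 1 + M * s) / 2] \<and>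
          table_row \<mu>2 Ds
            [0, - ((Q - 1) / 2), (1 + M * s) / 2, (1 - M * s) / 2] \<and>
          table_row (conj_char N \<mu>1) Ds
            [0, (Q - 1) / 2, (- 1 + M * s) / 2, (- 1 - M * s) / 2] \<and>
          table_row (conj_char N \<mu>2) Ds
            [0, - ((Q - 1) / 2), (1 - M * s) / 2, (1 + M * s) / 2] \<and>
          table_row \<chi> Ds [0, 0, 0, 0] \<and>
          table_row (conj_char N \<chi>) Ds [0, 0, 0, 0] \<and>
          table_row \<psi> Ds [0, 0, 0, 0]))"
proof -
  obtain om where om: "ree_field TYPE('f) n om"
    "ree_field.gauss n om (1 :: 'f) = - 1 + of_nat (3 ^ n) * csqrt (- 3)"
  proof -
    interpret ree_group G n x h by (rule ree)
    interpret F: ree_field "TYPE('f)" n "exp (2 * of_real pi * \<i> / 3)"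
      using card_field by unfold_locales auto
    show ?thesis by (rule F.gauss_sign) (rule that)
  qed
  obtain g0 where g0: "g0 \<noteq> 0" "c = h g0" using c(1) by (auto simp: ree_W_def)
  have char: "ree_char G n x h om" using ree om by (intro ree_char.intro ree_char_axioms.intro)
  interpret R: ree_gen G n x h om g0 \<xi> q
    using char g0 c(2) q \<xi> by (intro ree_gen.intro ree_gen_axioms.intro) auto
  have Q': "Q = R.Q" and M': "M = 3 ^ n" using Q M m by (simp_all add: R.Q_q)
  note irr = R.irr_characters_table[unfolded R.table_def R.nonlinear_def list.set]
  have one: "R.alpha 0 = (\<lambda>g\<in>carrier R.N. 1)"
  proof
    fix g
    show "R.alpha 0 g = (\<lambda>g\<in>carrier R.N. 1) g"
    proof (cases "g \<in> carrier R.N")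
      case True
      then show ?thesis by (auto simp: R.carrier_N R.alpha(2))
    next
      case False
      then show ?thesis by (simp add: R.alpha_def R.mono_char_def ind_char_def)
    qed
  qed
  note classes = R.conj_classes_N[unfolded R.class_list_def R.reg_idx_def list.set, folded \<omega>]
  have distinct: "distinct R.class_list" by (rule R.distinct_classes)
  note centralizers = R.centralizer_table[unfolded R.reg_idx_def, folded \<omega>]
  \<comment> \<open>the sign of the theorem is \<open>- 1\<close>: on elements with \<open>t \<noteq> 0\<close> the character \<open>R.Mu 1\<close> is
    \<open>m\<close> times a cube root of unity, and that cube root labels the three classes\<close>
  have neg: "- (- 1) * z = (z :: complex)" "(- 1) * z = (- z :: complex)" for z by simp_all
  note card = R.card_table[folded R.irr_characters_table]
  note tables = R.alpha_table R.Lam_table R.Psi_table R.Mu_table R.Mu_table_J R.Chi_table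
  note tables' = tables[unfolded R.reg_idx_def, folded \<omega>]
  show ?thesis
    unfolding Let_def N P R.C_statement g0(2) Q' M' s
  proof (rule exI[of _ "R.C_T 1"], rule exI[of _ "R.C_T (- 1)"], rule exI[of _ "R.C_Y 1"],
      rule exI[of _ "R.C_Y (cnj \<omega>)"], rule exI[of _ "R.C_Y \<omega>"], intro conjI)
    show "R.C_T 1 \<in> conj_classes R.N" "R.C_T (- 1) \<in> conj_classes R.N"
      "R.C_Y 1 \<in> conj_classes R.N" "R.C_Y (cnj \<omega>) \<in> conj_classes R.N" "R.C_Y \<omega> \<in> conj_classes R.N"
      unfolding classes by simp_all
    show "R.C_T 1 \<noteq> R.C_T (- 1)" "distinct [R.C_Y 1, R.C_Y (cnj \<omega>), R.C_Y \<omega>]"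
      using distinct unfolding R.class_list_def \<omega> by simp_all
    show "R.C_T (- 1) = {inv\<^bsub>G\<^esub> g | g. g \<in> R.C_T 1}" by (rule R.T_inverse)
    show "R.C_T 1 \<union> R.C_T (- 1) = {x 0 u v | u v. u \<noteq> 0}" by (rule R.T_union)
    show "R.C_Y 1 \<union> R.C_Y (cnj \<omega>) \<union> R.C_Y \<omega> = {x t u v | t u v. t \<noteq> 0}"
      unfolding \<omega> by (rule R.Y_union)
  qed (rule classes, rule R.card_conj_classes, rule centralizers, rule centralizers,
      rule bexI[of _ "- 1"], unfold neg, rule exI[of _ R.alpha], rule exI[of _ R.Lam],
      rule exI[of _ "R.Mu 1"], rule exI[of _ "R.Mu (- 1)"], rule exI[of _ R.Chi], rule exI[of _ R.Psi],
      intro conjI ballI, (rule irr card one tables' | assumption | simp)+)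
qed

end
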